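(* Let $\phi\colon\mathbb{R}\to\mathbb{R}$ be an increasing homeomorphism with $\phi(0)=0$, $f\colon\mathbb{R}\to\mathbb{R}$ continuous, and $g\colon[0,T]\times\mathbb{R}\to\mathbb{R}$ a Carathéodory function. For $s\in\mathbb{R}$ consider $$(\phi(u'))'+f(u)u'+g(t,u)=s.\qquad(\mathscr{E}_s)$$ Assume: $(H_0)$ for all $t_0\in[0,T]$, $u_0\in\mathbb{R}$, $\varepsilon>0$ there is $\delta>0$ such that $|t-t_0|<\delta$, $|u-u_0|<\delta$ imply $|g(t,u)-g(t,u_0)|<\varepsilon$ for a.e. $t$; $(H_1^{\rm II})$ there is $\gamma_0\in L^1([0,T],\mathbb{R}^+)$ with $g(t,u)\le\gamma_0(t)$ for all $u$ and a.e. $t$; $(H_2^{\rm II})$ there are $u_0,g_0\in\mathbb{R}$ with $g(t,u_0)\ge g_0$ for a.e. $t$; $(H_4^{\rm II})$ there exist $\nu<\min\{0,g_0\}$ and $d>0$ such that $\frac1T\int_0^Tg(t,u(t))\,dt<\nu$ for every $u\in\mathcal{C}^1_T$ with $u(t)\ge d$ for all $t$. Let $\nu^*$ be the infimum of those $\nu\in\,]-\infty,g_0[$ for which $(H_4^{\rm II})$ holds with this $\nu$ (for some $d>0$). Then there exists $s_0\in\,]\nu^*,+\infty[$ such that: for $\nu^*<s<s_0$, $(\mathscr{E}_s)$ has at least one $T$-periodic solution; for $s>s_0$, $(\mathscr{E}_s)$ has no $T$-periodic solutions. Moreover, if also $(H_3^{\rm II})$ there exist $\nu<\min\{0,g_0\}$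 and $d>0$ such that $\frac1T\int_0^Tg(t,u(t))\,dt<\nu$ for every $u\in\mathcal{C}^1_T$ with $u(t)\le -d$ for all $t$, holds, and $\nu^{**}$ denotes the infimum of those $\nu\in[\nu^*,g_0[$ for which $(H_3^{\rm II})$ holds with this $\nu$, then: for $s=s_0$, $(\mathscr{E}_s)$ has at least one $T$-periodic solution; for $\nu^{**}<s<s_0$, $(\mathscr{E}_s)$ has at least two $T$-periodic solutions.
   Context: $\mathcal{C}^1_T=\{u\in\mathcal{C}^1([0,T]):u(0)=u(T),\,u'(0)=u'(T)\}$. A $T$-periodic solution of $(\mathscr{E}_s)$ is $u\in\mathcal{C}^1_T$ with $\phi(u')$ absolutely continuous satisfying the equation a.e. A Carathéodory function is measurable in $t$, continuous in $u$, and for each $r>0$ bounded in absolute value on $[0,T]\times[-r,r]$ by an $L^1$ function of $t$. $\mathbb{R}^+$ denotes the nonnegative reals. *)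

theory Defs
  imports "HOL-Analysis.Analysis"
begin

definition abs_cont_on :: "real set \<Rightarrow> (real \<Rightarrow> real) \<Rightarrow> bool" where
  "abs_cont_on S F \<longleftrightarrow>
     (\<forall>\<epsilon>>0. \<exists>\<delta>>0. \<forall>(n::nat) (a::nat \<Rightarrow> real) b.
        (\<forall>i<n. a i \<in> S \<and> b i \<in> S \<and> a i \<le> b i \<and> {a i..b i} \<subseteq> S) \<and>
        (\<forall>i<n. \<forall>j<n. i \<noteq> j \<longrightarrow> b i \<le> a j \<or> b j \<le> a i) \<and>
        (\<Sum>i<n. b i - a i) < \<delta>
        \<longrightarrow> (\<Sum>i<n. \<bar>F (b i) - F (a i)\<bar>) < \<epsilon>)"

definition caratheodory :: "real \<Rightarrow> (real \<Rightarrow> real \<Rightarrow> real) \<Rightarrow> bool" where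
  "caratheodory T g \<longleftrightarrow>
     (\<forall>u. (\<lambda>t. g t u) \<in> borel_measurable (lebesgue_on {0..T})) \<and>
     (\<forall>t\<in>{0..T}. continuous_on UNIV (g t)) \<and>
     (\<forall>r>0. \<exists>h. integrable (lebesgue_on {0..T}) h \<and>
        (\<forall>t\<in>{0..T}. \<forall>u. \<bar>u\<bar> \<le> r \<longrightarrow> \<bar>g t u\<bar> \<le> h t))"

definition C1_with_deriv :: "real \<Rightarrow> (real \<Rightarrow> real) \<Rightarrow> (real \<Rightarrow> real) \<Rightarrow> bool" where
  "C1_with_deriv T u v \<longleftrightarrow>
     continuous_on {0..T} v \<and>
     (\<forall>t\<in>{0..T}. (u has_real_derivative v t) (at t within {0..T}))"

definition C1T :: "real \<Rightarrow> (real \<Rightarrow> real) \<Rightarrow> bool" where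
  "C1T T u \<longleftrightarrow> (\<exists>v. C1_with_deriv T u v \<and> u 0 = u T \<and> v 0 = v T)"

definition periodic_solution ::
  "real \<Rightarrow> (real \<Rightarrow> real) \<Rightarrow> (real \<Rightarrow> real) \<Rightarrow> (real \<Rightarrow> real \<Rightarrow> real) \<Rightarrow> real \<Rightarrow> (real \<Rightarrow> real) \<Rightarrow> bool"
  where
  "periodic_solution T \<phi> f g s u \<longleftrightarrow>
     (\<exists>v. C1_with_deriv T u v \<and> u 0 = u T \<and> v 0 = v T \<and>
        abs_cont_on {0..T} (\<lambda>t. \<phi> (v t)) \<and>
        (AE t in lebesgue_on {0..T}.
           \<exists>w. ((\<lambda>t. \<phi> (v t)) has_real_derivative w) (at t within {0..T}) \<and>
               w + f (u t) * v t + g t (u t) = s))"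

definition mean_g :: "real \<Rightarrow> (real \<Rightarrow> real \<Rightarrow> real) \<Rightarrow> (real \<Rightarrow> real) \<Rightarrow> real" where
  "mean_g T g u = (1 / T) * integral\<^sup>L (lebesgue_on {0..T}) (\<lambda>t. g t (u t))"

definition H4_cond :: "real \<Rightarrow> (real \<Rightarrow> real \<Rightarrow> real) \<Rightarrow> real \<Rightarrow> real \<Rightarrow> bool" where
  "H4_cond T g \<nu> d \<longleftrightarrow> (\<forall>u. C1T T u \<and> (\<forall>t\<in>{0..T}. u t \<ge> d) \<longrightarrow> mean_g T g u < \<nu>)"

definition H3_cond :: "real \<Rightarrow> (real \<Rightarrow> real \<Rightarrow> real) \<Rightarrow> real \<Rightarrow> real \<Rightarrow> bool" where
  "H3_cond T g \<nu> d \<longleftrightarrow> (\<forall>u. C1T T u \<and> (\<forall>t\<in>{0..T}. u t \<le> - d) \<longrightarrow> mean_g T g u < \<nu>)"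

end

theory Submission
  imports Defs "HOL-Complex_Analysis.Great_Picard"
begin

text \<open>
  Let \<open>F' = f\<close>. A function \<open>u\<close> is a periodic solution iff \<open>\<phi>(u') + F(u)\<close> is, up to a constant, the
  primitive of \<open>s - g(t,u)\<close>; integrating over a period shows that \<open>s\<close> is the mean of \<open>g(t,u)\<close>. An
  intermediate value argument takes the place of degree theory: fix a sub-solution \<open>\<alpha>\<close> at a level
  \<open>s1 > s\<close> and write \<open>u = z + c - min (z - \<alpha>)\<close>, so that \<open>c = min (u - \<alpha>)\<close>.
  For each \<open>c\<close> a Schauder argument in \<open>z\<close> solves the equation at the level \<open>m = mean g(t,u)\<close>, and moving \<open>c\<close>
  along with \<open>z\<close> in the same fixed point problem produces a solution with \<open>m = s\<close> as soon as \<open>m - s\<close> has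
  opposite signs at the two ends. For \<open>c = 0\<close> the solution touches \<open>\<alpha>\<close> from above, which by \<open>(H\<^sub>0)\<close> is
  impossible for \<open>m \<le> s\<close>; for large positive \<open>c\<close> condition \<open>(H\<^sub>4)\<close> forces \<open>m < s\<close>, and for large negative \<open>c\<close>
  condition \<open>(H\<^sub>3)\<close> does, since the oscillation of solutions is bounded a priori. Thus there is one solution
  above \<open>\<alpha>\<close> and, under \<open>(H\<^sub>3)\<close>, a second one that goes below \<open>\<alpha>\<close> somewhere. With \<open>\<alpha>\<close> constant or a solution
  at a higher level, \<open>s\<^sub>0\<close> is the supremum of the solvable levels, and the case \<open>s = s\<^sub>0\<close> follows by compactness.
\<close>

section \<open>A fixed point theorem of Schauder type\<close>

text \<open>\<open>g\<close> is bounded only from above. At levels \<open>m \<ge> s\<close> this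
  suffices: \<open>g(t,u) - m\<close> has mean zero and an integrable upper bound independent of
  \<open>u\<close>, and zero mean turns the one-sided bound into a two-sided one for the primitive.
  Below \<open>s\<close> no such estimate is at hand, so the path of the fixed point problem is
  continued past offset 0 by a deformation of \<open>g\<close>. Neither growth of \<phi> nor a sign
  of \<open>f\<close> is available: multiplying \<open>\<phi>(u') + F(u)\<close> by
  \<open>u'\<close> and integrating removes \<open>F\<close> and bounds the total variation of
  \<open>u\<close>; the velocity is bounded afterwards. Periodicity of \<open>u\<close> is not built
  into the operator; the integration constant is a further scalar unknown that enforces it. Both
  scalars are updated by a clamped step, and a fixed point at an end of its interval reveals the
  sign of the residual, which is refuted there. A Caratheodory \<open>g\<close> tells nothing at a
  single contact time; \<open>(H0)\<close> supplies a comparison for almost every nearby time.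
  Solutions are defined through absolute continuity, so both halves of Lebesgue's fundamental
  theorem are needed to reach the integrated form and to return from it.\<close>

lemma convergent_subsequence_coordinates:
  fixes x :: "nat \<Rightarrow> nat \<Rightarrow> real"
  assumes "\<And>k i. i < n \<Longrightarrow> x k i \<in> {0..1}"
  shows "\<exists>r y. strict_mono (r :: nat \<Rightarrow> nat) \<and> (\<forall>i<n. y i \<in> {0..1} \<and> (\<lambda>k. x (r k) i) \<longlonglongrightarrow> y i)"
  using assms
proof (induction n)
  case 0
  show ?case by (rule exI[of _ id]) (auto simp: strict_mono_def)
next
  case (Suc n)
  have "\<exists>r y. strict_mono (r :: nat \<Rightarrow> nat) \<and> (\<forall>i<n. y i \<in> {0..1} \<and> (\<lambda>k. x (r k) i) \<longlonglongrightarrow> y i)"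
    by (rule Suc.IH, rule Suc.prems) simp
  then obtain r y where r: "strict_mono (r :: nat \<Rightarrow> nat)"
    and y: "\<And>i. i < n \<Longrightarrow> y i \<in> {0..1} \<and> (\<lambda>k. x (r k) i) \<longlonglongrightarrow> y i"
    by blast
  have "seq_compact {0..1::real}"
    by (simp add: compact_imp_seq_compact)
  moreover have "\<forall>k. x (r k) n \<in> {0..1}" using Suc.prems by auto
  ultimately obtain l s where l: "l \<in> {0..1}" and s: "strict_mono s" and lim: "((\<lambda>k. x (r k) n) \<circ> s) \<longlonglongrightarrow> l"
    by (rule seq_compactE)
  have "strict_mono (r \<circ> s)" using r s by (rule strict_mono_o)
  moreover have "(y(n := l)) i \<in> {0..1} \<and> (\<lambda>k. x ((r \<circ> s) k) i) \<longlonglongrightarrow> (y(n := l)) i" if "i < Suc n" for i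
  proof (cases "i = n")
    case True
    then show ?thesis using l lim by (simp add: o_def)
  next
    case False
    with that have "i < n" by simp
    with LIMSEQ_subseq_LIMSEQ[OF conjunct2[OF y[OF this]] s] y[OF this] False show ?thesis
      by (simp add: o_def)
  qed
  ultimately show ?case by blast
qed

text \<open>The library states Brouwer's theorem for Euclidean space types; here the dimension is a
  natural number, so it is derived anew from Kuhn's combinatorial lemma.\<close>

lemma brouwer_unit_cube_nat:
  fixes f :: "(nat \<Rightarrow> real) \<Rightarrow> nat \<Rightarrow> real"
  assumes ran: "\<And>x i. (\<forall>j<n. x j \<in> {0..1}) \<Longrightarrow> i < n \<Longrightarrow> f x i \<in> {0..1}"
    and cont: "\<And>x y i. (\<forall>k. \<forall>j<n. x k j \<in> {0..1}) \<Longrightarrow> (\<forall>j<n. y j \<in> {0..1}) \<Longrightarrow>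
       (\<forall>j<n. (\<lambda>k. x k j) \<longlonglongrightarrow> y j) \<Longrightarrow> i < n \<Longrightarrow> (\<lambda>k. f (x k) i) \<longlonglongrightarrow> f y i"
  shows "\<exists>x. \<forall>i<n. x i \<in> {0..1} \<and> f x i = x i"
proof -
  define sc where "sc p q = (\<lambda>i. real (q i) / real p)" for p :: nat and q :: "nat \<Rightarrow> nat"
  \<comment> \<open>Label 1 means that \<open>f\<close> does not increase coordinate
    \<open>i\<close>, except that the faces \<open>q i = p\<close> and \<open>q i = 0\<close>
    receive the labels 1 and 0 that Kuhn's lemma prescribes. On these faces the range of
    \<open>f\<close> gives the corresponding inequality.\<close>
  define label where "label p q i = (if q i = p \<or> (q i \<noteq> 0 \<and> f (sc p q) i \<le> sc p q i) then 1 else 0 :: nat)" for p q i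
  have sc01: "\<forall>j<n. sc p q j \<in> {0..1}" if "\<forall>j<n. q j \<le> p" for p q
    using that by (auto simp: sc_def divide_le_eq_1)
  have "\<exists>q. (\<forall>i<n. q i < p) \<and> (\<forall>i<n. \<exists>r s. (\<forall>j<n. q j \<le> r j \<and> r j \<le> q j + 1) \<and>
        (\<forall>j<n. q j \<le> s j \<and> s j \<le> q j + 1) \<and> f (sc p r) i \<le> sc p r i \<and> sc p s i \<le> f (sc p s) i)" if "p > 0" for p
  proof -
    obtain q where q: "\<forall>i<n. q i < p" and
      lab: "\<forall>i<n. \<exists>r s. (\<forall>j<n. q j \<le> r j \<and> r j \<le> q j + 1) \<and> (\<forall>j<n. q j \<le> s j \<and> s j \<le> q j + 1) \<and> label p r i \<noteq> label p s i"
      by (rule kuhn_lemma[OF \<open>p > 0\<close>, of n "label p"]) (use \<open>p > 0\<close> in \<open>auto simp: label_def\<close>)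
    have one: "f (sc p r) i \<le> sc p r i" if "label p r i = 1" "i < n" "\<forall>j<n. q j \<le> r j \<and> r j \<le> q j + 1" for r i
    proof (cases "r i = p")
      case True
      have "\<forall>j<n. r j \<le> p" using q that(3) by fastforce
      with ran[OF sc01 \<open>i < n\<close>] have "f (sc p r) i \<le> 1" by auto
      with True \<open>p > 0\<close> show ?thesis by (simp add: sc_def)
    qed (use that in \<open>auto simp: label_def split: if_splits\<close>)
    have zero: "sc p r i \<le> f (sc p r) i" if "label p r i \<noteq> 1" "i < n" "\<forall>j<n. q j \<le> r j \<and> r j \<le> q j + 1" for r i
    proof (cases "r i = 0")
      case True
      have "\<forall>j<n. r j \<le> p" using q that(3) by fastforce
      with ran[OF sc01 \<open>i < n\<close>] have "0 \<le> f (sc p r) i" by auto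
      with True show ?thesis by (simp add: sc_def)
    qed (use that in \<open>auto simp: label_def split: if_splits\<close>)
    have "\<exists>r s. (\<forall>j<n. q j \<le> r j \<and> r j \<le> q j + 1) \<and>
        (\<forall>j<n. q j \<le> s j \<and> s j \<le> q j + 1) \<and> f (sc p r) i \<le> sc p r i \<and> sc p s i \<le> f (sc p s) i" if "i < n" for i
    proof -
      obtain r s where rs: "\<forall>j<n. q j \<le> r j \<and> r j \<le> q j + 1" "\<forall>j<n. q j \<le> s j \<and> s j \<le> q j + 1" "label p r i \<noteq> label p s i"
        using lab \<open>i < n\<close> by blast
      have "label p r i = 1 \<and> label p s i \<noteq> 1 \<or> label p s i = 1 \<and> label p r i \<noteq> 1"
        using rs(3) unfolding label_def by (auto split: if_splits)
      then show ?thesis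
        using one zero rs(1,2) \<open>i < n\<close> by blast
    qed
    with q show ?thesis by blast
  qed
  then have "\<exists>q. \<forall>k. (\<forall>i<n. q k i < Suc k) \<and> (\<forall>i<n. \<exists>r s. (\<forall>j<n. q k j \<le> r j \<and> r j \<le> q k j + 1) \<and>
        (\<forall>j<n. q k j \<le> s j \<and> s j \<le> q k j + 1) \<and> f (sc (Suc k) r) i \<le> sc (Suc k) r i \<and> sc (Suc k) s i \<le> f (sc (Suc k) s) i)"
    by (intro choice) blast
  then obtain q where q: "\<And>k i. i < n \<Longrightarrow> q k i < Suc k" and
    q2: "\<And>k i. i < n \<Longrightarrow> \<exists>r s. (\<forall>j<n. q k j \<le> r j \<and> r j \<le> q k j + 1) \<and>
        (\<forall>j<n. q k j \<le> s j \<and> s j \<le> q k j + 1) \<and> f (sc (Suc k) r) i \<le> sc (Suc k) r i \<and> sc (Suc k) s i \<le> f (sc (Suc k) s) i"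
    by blast
  obtain \<theta> y where \<theta>: "strict_mono (\<theta> :: nat \<Rightarrow> nat)" and
    y: "\<And>i. i < n \<Longrightarrow> y i \<in> {0..1} \<and> (\<lambda>k. sc (Suc (\<theta> k)) (q (\<theta> k)) i) \<longlonglongrightarrow> y i"
    using convergent_subsequence_coordinates[of n "\<lambda>k. sc (Suc k) (q k)"] sc01[of "q k" "Suc k" for k] q
    by (meson less_imp_le)
  \<comment> \<open>The vertices \<open>r\<close> and \<open>s\<close> depend on \<open>i\<close>,
    but every vertex of the cell at \<open>q\<close> is within one mesh of it in each coordinate, so
    all choices share the limit \<open>y\<close>. The two opposite inequalities, found at different
    vertices, meet there.\<close>
  have lim: "(\<lambda>k. sc (Suc (\<theta> k)) (r k) j) \<longlonglongrightarrow> y j"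
    if "\<And>k. \<forall>j<n. q (\<theta> k) j \<le> r k j \<and> r k j \<le> q (\<theta> k) j + 1" "j < n" for r j
  proof -
    have "(\<lambda>k. 1 / real (Suc k)) \<longlonglongrightarrow> 0" by (rule LIMSEQ_Suc[OF lim_1_over_n])
    from LIMSEQ_subseq_LIMSEQ[OF this \<theta>] have "(\<lambda>k. 1 / real (Suc (\<theta> k))) \<longlonglongrightarrow> 0"
      by (simp add: o_def)
    from tendsto_add[OF conjunct2[OF y[OF that(2)]] this]
    have up: "(\<lambda>k. sc (Suc (\<theta> k)) (q (\<theta> k)) j + 1 / real (Suc (\<theta> k))) \<longlonglongrightarrow> y j" by simp
    show ?thesis
    proof (rule real_tendsto_sandwich[OF _ _ conjunct2[OF y[OF that(2)]] up])
      show "\<forall>\<^sub>F k in sequentially. sc (Suc (\<theta> k)) (q (\<theta> k)) j \<le> sc (Suc (\<theta> k)) (r k) j"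
        using that by (intro always_eventually allI) (simp add: sc_def divide_right_mono)
      show "\<forall>\<^sub>F k in sequentially. sc (Suc (\<theta> k)) (r k) j \<le> sc (Suc (\<theta> k)) (q (\<theta> k)) j + 1 / real (Suc (\<theta> k))"
      proof (intro always_eventually allI)
        fix k
        have "real (r k j) \<le> real (q (\<theta> k) j) + 1" using that(1)[of k] that(2) by (metis of_nat_1 of_nat_add of_nat_le_iff)
        then show "sc (Suc (\<theta> k)) (r k) j \<le> sc (Suc (\<theta> k)) (q (\<theta> k)) j + 1 / real (Suc (\<theta> k))"
          unfolding sc_def by (metis add_divide_distrib divide_right_mono of_nat_0_le_iff)
      qed
    qed
  qed
  have "f y i = y i" if "i < n" for i
  proof -
    have "\<exists>r. \<forall>k. (\<forall>j<n. q (\<theta> k) j \<le> r k j \<and> r k j \<le> q (\<theta> k) j + 1) \<and>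
        f (sc (Suc (\<theta> k)) (r k)) i \<le> sc (Suc (\<theta> k)) (r k) i"
      by (intro choice allI) (use q2[OF that] in blast)
    then obtain r where r: "\<And>k. \<forall>j<n. q (\<theta> k) j \<le> r k j \<and> r k j \<le> q (\<theta> k) j + 1"
       "\<And>k. f (sc (Suc (\<theta> k)) (r k)) i \<le> sc (Suc (\<theta> k)) (r k) i" by blast
    have "\<exists>s. \<forall>k. (\<forall>j<n. q (\<theta> k) j \<le> s k j \<and> s k j \<le> q (\<theta> k) j + 1) \<and>
        sc (Suc (\<theta> k)) (s k) i \<le> f (sc (Suc (\<theta> k)) (s k)) i"
      by (intro choice allI) (use q2[OF that] in blast)
    then obtain s where s: "\<And>k. \<forall>j<n. q (\<theta> k) j \<le> s k j \<and> s k j \<le> q (\<theta> k) j + 1"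
       "\<And>k. sc (Suc (\<theta> k)) (s k) i \<le> f (sc (Suc (\<theta> k)) (s k)) i" by blast
    have le: "\<forall>j<n. p j \<le> Suc (\<theta> k)" if "\<forall>j<n. q (\<theta> k) j \<le> p j \<and> p j \<le> q (\<theta> k) j + 1" for p k
    proof (intro allI impI)
      fix j assume "j < n"
      with that q[of j "\<theta> k"] show "p j \<le> Suc (\<theta> k)" by fastforce
    qed
    have fr: "(\<lambda>k. f (sc (Suc (\<theta> k)) (r k)) i) \<longlonglongrightarrow> f y i"
      using sc01[OF le[OF r(1)]] y lim[OF r(1)] that by (intro cont) auto
    have fs: "(\<lambda>k. f (sc (Suc (\<theta> k)) (s k)) i) \<longlonglongrightarrow> f y i"
      using sc01[OF le[OF s(1)]] y lim[OF s(1)] that by (intro cont) auto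
    have "f y i \<le> y i"
      by (rule LIMSEQ_le[OF fr lim[OF r(1) that]]) (use r(2) in auto)
    moreover have "y i \<le> f y i"
      by (rule LIMSEQ_le[OF lim[OF s(1) that] fs]) (use s(2) in auto)
    ultimately show ?thesis by simp
  qed
  with y show ?thesis by blast
qed

lemma brouwer_box_nat:
  fixes f :: "(nat \<Rightarrow> real) \<Rightarrow> nat \<Rightarrow> real" and l r :: "nat \<Rightarrow> real"
  assumes lr: "\<And>i. i < n \<Longrightarrow> l i \<le> r i"
    and ran: "\<And>x i. (\<forall>j<n. x j \<in> {l j..r j}) \<Longrightarrow> i < n \<Longrightarrow> f x i \<in> {l i..r i}"
    and cont: "\<And>x y i. (\<forall>k. \<forall>j<n. x k j \<in> {l j..r j}) \<Longrightarrow> (\<forall>j<n. y j \<in> {l j..r j}) \<Longrightarrow>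
       (\<forall>j<n. (\<lambda>k. x k j) \<longlonglongrightarrow> y j) \<Longrightarrow> i < n \<Longrightarrow> (\<lambda>k. f (x k) i) \<longlonglongrightarrow> f y i"
  shows "\<exists>x. \<forall>i<n. x i \<in> {l i..r i} \<and> f x i = x i"
proof -
  define S where "S y = (\<lambda>i. l i + (r i - l i) * y i)" for y :: "nat \<Rightarrow> real"
  \<comment> \<open>In a degenerate direction \<open>r i = l i\<close> the quotient is a division by
    zero and equals 0; the fixed point identity there is recovered at the end from the range of
    \<open>f\<close>.\<close>
  define h where "h y = (\<lambda>i. (f (S y) i - l i) / (r i - l i))" for y
  have S: "\<forall>j<n. S y j \<in> {l j..r j}" if "\<forall>j<n. y j \<in> {0..1}" for y
  proof (intro allI impI)
    fix j assume "j < n"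
    then have "0 \<le> r j - l j" "0 \<le> y j" "y j \<le> 1" using lr that by auto
    then have "0 \<le> (r j - l j) * y j" "(r j - l j) * y j \<le> r j - l j"
      by (auto intro: mult_left_le)
    then show "S y j \<in> {l j..r j}" by (auto simp: S_def)
  qed
  have "\<exists>y. \<forall>i<n. y i \<in> {0..1} \<and> h y i = y i"
  proof (rule brouwer_unit_cube_nat)
    fix x :: "nat \<Rightarrow> real" and i assume x: "\<forall>j<n. x j \<in> {0..1}" and i: "i < n"
    from ran[OF S[OF x] i] lr[OF i] show "h x i \<in> {0..1}"
      by (auto simp: h_def divide_le_eq_1)
  next
    fix x :: "nat \<Rightarrow> nat \<Rightarrow> real" and y i
    assume x: "\<forall>k. \<forall>j<n. x k j \<in> {0..1}" and y: "\<forall>j<n. y j \<in> {0..1}" and lim: "\<forall>j<n. (\<lambda>k. x k j) \<longlonglongrightarrow> y j" and i: "i < n"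
    have "(\<lambda>k. f (S (x k)) i) \<longlonglongrightarrow> f (S y) i"
      using x y S lim i by (intro cont) (auto simp: S_def intro!: tendsto_intros)
    then show "(\<lambda>k. h (x k) i) \<longlonglongrightarrow> h y i"
      unfolding h_def by (cases "r i = l i") (auto intro!: tendsto_intros)
  qed
  then obtain y where y: "\<And>i. i < n \<Longrightarrow> y i \<in> {0..1}" "\<And>i. i < n \<Longrightarrow> h y i = y i" by blast
  have "f (S y) i = S y i" if "i < n" for i
  proof (cases "r i = l i")
    case True
    with ran[OF S that, of y] y(1) S[of y] that show ?thesis by force
  next
    case False
    with y(2)[OF that] show ?thesis by (simp add: h_def S_def field_simps)
  qed
  with S[of y] y(1) show ?thesis by (intro exI[of _ "S y"]) auto
qed

text \<open>A version of Schauder's theorem in which finite-dimensional projections are given by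
  normalized hat functions, so that order boxes are mapped into themselves.\<close>

definition node :: "real \<Rightarrow> nat \<Rightarrow> nat \<Rightarrow> real" where
  "node T N k = T * real k / real N"

text \<open>The half-width is two meshes, and the last node not after a given time is less than one
  mesh away, so the normalising sum in \<open>hat_interp\<close> never vanishes on
  \<open>{0..T}\<close>.\<close>

definition hat :: "real \<Rightarrow> nat \<Rightarrow> nat \<Rightarrow> real \<Rightarrow> real" where
  "hat T N k t = max 0 (2 * T / real N - \<bar>t - node T N k\<bar>)"

definition hat_interp :: "real \<Rightarrow> nat \<Rightarrow> (nat \<Rightarrow> real) \<Rightarrow> real \<Rightarrow> real" where
  "hat_interp T N x t = (\<Sum>k\<le>N. x k * hat T N k t) / (\<Sum>k\<le>N. hat T N k t)"

lemma hat_nonneg: "0 \<le> hat T N k t"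
  by (simp add: hat_def)

lemma node_mem: "0 < T \<Longrightarrow> 0 < N \<Longrightarrow> k \<le> N \<Longrightarrow> node T N k \<in> {0..T}"
  by (auto simp: node_def divide_le_eq)

lemma hat_sum_pos:
  assumes "0 < T" "0 < N" "t \<in> {0..T}"
  shows "0 < (\<Sum>k\<le>N. hat T N k t)"
proof -
  define k where "k = nat \<lfloor>t * N / T\<rfloor>"
  have "0 \<le> t * N / T" using assms by auto
  then have k1: "real k \<le> t * N / T" and k2: "t * N / T < real k + 1"
    unfolding k_def by linarith+
  have "t * N / T \<le> N" using assms by (auto simp: divide_le_eq intro: mult_right_mono)
  with k1 have kN: "k \<le> N" by linarith
  have "node T N k \<le> t" using k1 assms by (simp add: node_def field_simps)
  moreover have "t < node T N k + T / N" using k2 assms by (simp add: node_def field_simps)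
  moreover have "T / N < 2 * T / N" using assms by (simp add: divide_strict_right_mono)
  ultimately have "0 < hat T N k t" by (simp add: hat_def)
  also have "hat T N k t \<le> (\<Sum>k\<le>N. hat T N k t)"
    by (rule member_le_sum) (use kN hat_nonneg in auto)
  finally show ?thesis .
qed

lemma continuous_on_hat_interp:
  assumes "0 < T" "0 < N"
  shows "continuous_on {0..T} (hat_interp T N x)"
proof -
  have "(\<Sum>k\<le>N. hat T N k t) \<noteq> 0" if "t \<in> {0..T}" for t
    using hat_sum_pos[OF assms that] by simp
  then have "continuous_on {0..T} (\<lambda>t. (\<Sum>k\<le>N. x k * hat T N k t) / (\<Sum>k\<le>N. hat T N k t))"
    unfolding hat_def by (intro continuous_intros) auto
  then show ?thesis by (simp add: hat_interp_def[abs_def])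
qed

text \<open>The interpolant is a convex combination of the coefficients, and only nodes within reach
  of \<open>t\<close> have positive weight. With \<open>c = 0\<close> this keeps the interpolant in
  a ball; with \<open>c\<close> the target value at \<open>t\<close> it measures the interpolation
  error.\<close>

lemma hat_interp_dist:
  assumes "0 < T" "0 < N" "t \<in> {0..T}"
    and "\<And>k. k \<le> N \<Longrightarrow> \<bar>t - node T N k\<bar> \<le> 2 * T / real N \<Longrightarrow> \<bar>x k - c\<bar> \<le> e"
  shows "\<bar>hat_interp T N x t - c\<bar> \<le> e"
proof -
  let ?S = "\<Sum>k\<le>N. hat T N k t"
  have S: "0 < ?S" by (rule hat_sum_pos[OF assms(1-3)])
  have "hat_interp T N x t - c = (\<Sum>k\<le>N. x k * hat T N k t) / ?S - c * ?S / ?S"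
    using S by (simp add: hat_interp_def)
  also have "\<dots> = (\<Sum>k\<le>N. (x k - c) * hat T N k t) / ?S"
    by (simp add: left_diff_distrib sum_subtractf sum_distrib_left diff_divide_distrib)
  finally have "\<bar>hat_interp T N x t - c\<bar> = \<bar>\<Sum>k\<le>N. (x k - c) * hat T N k t\<bar> / ?S"
    using S by simp
  also have "\<bar>\<Sum>k\<le>N. (x k - c) * hat T N k t\<bar> \<le> (\<Sum>k\<le>N. e * hat T N k t)"
  proof (rule order_trans[OF sum_abs], rule sum_mono)
    fix k assume "k \<in> {..N}"
    then show "\<bar>(x k - c) * hat T N k t\<bar> \<le> e * hat T N k t"
    proof (cases "\<bar>t - node T N k\<bar> \<le> 2 * T / real N")
      case True
      with \<open>k \<in> {..N}\<close> assms(4) show ?thesis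
        by (simp add: abs_mult hat_nonneg mult_right_mono)
    qed (simp add: hat_def)
  qed
  also have "(\<Sum>k\<le>N. e * hat T N k t) = e * ?S" by (simp add: sum_distrib_left)
  finally show ?thesis using S by (simp add: divide_right_mono)
qed

lemma uniform_limit_hat_interp:
  assumes "0 < T" "0 < N" "\<And>k. k \<le> N \<Longrightarrow> (\<lambda>m. x m k) \<longlonglongrightarrow> y k"
  shows "uniform_limit {0..T} (\<lambda>m. hat_interp T N (x m)) (hat_interp T N y) sequentially"
proof (rule uniform_limitI)
  fix e :: real assume "0 < e"
  have "\<forall>\<^sub>F m in sequentially. \<forall>k\<in>{..N}. dist (x m k) (y k) < e / 2"
    using tendstoD[OF assms(3), of _ "e / 2"] \<open>0 < e\<close> by (intro eventually_ball_finite ballI) simp_all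
  then show "\<forall>\<^sub>F m in sequentially. \<forall>t\<in>{0..T}. dist (hat_interp T N (x m) t) (hat_interp T N y t) < e"
  proof eventually_elim
    case (elim m)
    show ?case
    proof
      fix t assume t: "t \<in> {0..T}"
      have "hat_interp T N (x m) t - hat_interp T N y t = hat_interp T N (\<lambda>k. x m k - y k) t - 0"
        by (simp add: hat_interp_def left_diff_distrib sum_subtractf diff_divide_distrib)
      also have "\<bar>\<dots>\<bar> \<le> e / 2"
        by (rule hat_interp_dist[OF assms(1,2) t]) (use elim in \<open>auto simp: dist_real_def intro: less_imp_le\<close>)
      finally show "dist (hat_interp T N (x m) t) (hat_interp T N y t) < e"
        using \<open>0 < e\<close> by (simp add: dist_real_def)
    qed
  qed
qed

text \<open>The Lipschitz bound on \<open>H\<close> plays the part of compactness, and the two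
  scalar unknowns ride along as extra coordinates. Brouwer applied to nodal values gives a fixed
  point up to the error \<open>L * (2 * T / N)\<close>; Arzela-Ascoli then removes the error.
  Continuity is asked along uniformly convergent \<open>zs\<close> and only pointwise for
  \<open>H\<close>, as dominated convergence delivers it.\<close>

lemma schauder_box:
  fixes G1 G2 :: "real \<Rightarrow> real \<Rightarrow> (real \<Rightarrow> real) \<Rightarrow> real" and H :: "real \<Rightarrow> real \<Rightarrow> (real \<Rightarrow> real) \<Rightarrow> real \<Rightarrow> real"
  assumes T: "0 < T" and lr: "l1 \<le> r1" "l2 \<le> r2" and \<rho>: "0 \<le> \<rho>" and L: "0 \<le> L"
    and D: "\<And>\<tau> a z. D \<tau> a z \<longleftrightarrow> \<tau> \<in> {l1..r1} \<and> a \<in> {l2..r2} \<and> continuous_on {0..T} z \<and> (\<forall>t\<in>{0..T}. \<bar>z t\<bar> \<le> \<rho>)"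
    and ran: "\<And>\<tau> a z. D \<tau> a z \<Longrightarrow> G1 \<tau> a z \<in> {l1..r1}" "\<And>\<tau> a z. D \<tau> a z \<Longrightarrow> G2 \<tau> a z \<in> {l2..r2}"
      "\<And>\<tau> a z t. D \<tau> a z \<Longrightarrow> t \<in> {0..T} \<Longrightarrow> \<bar>H \<tau> a z t\<bar> \<le> \<rho>"
    and lip: "\<And>\<tau> a z t t'. D \<tau> a z \<Longrightarrow> t \<in> {0..T} \<Longrightarrow> t' \<in> {0..T} \<Longrightarrow> \<bar>H \<tau> a z t - H \<tau> a z t'\<bar> \<le> L * \<bar>t - t'\<bar>"
    and cont: "\<And>\<tau>s as zs \<tau> a z. (\<And>n. D (\<tau>s n) (as n) (zs n)) \<Longrightarrow> D \<tau> a z \<Longrightarrow> \<tau>s \<longlonglongrightarrow> \<tau> \<Longrightarrow> as \<longlonglongrightarrow> a \<Longrightarrow>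
        uniform_limit {0..T} zs z sequentially \<Longrightarrow>
        (\<lambda>n. G1 (\<tau>s n) (as n) (zs n)) \<longlonglongrightarrow> G1 \<tau> a z \<and> (\<lambda>n. G2 (\<tau>s n) (as n) (zs n)) \<longlonglongrightarrow> G2 \<tau> a z \<and>
        (\<forall>t\<in>{0..T}. (\<lambda>n. H (\<tau>s n) (as n) (zs n) t) \<longlonglongrightarrow> H \<tau> a z t)"
  shows "\<exists>\<tau> a z. D \<tau> a z \<and> \<tau> = G1 \<tau> a z \<and> a = G2 \<tau> a z \<and> (\<forall>t\<in>{0..T}. z t = H \<tau> a z t)"
proof -
  have approx: "\<exists>\<tau> a z. D \<tau> a z \<and> \<tau> = G1 \<tau> a z \<and> a = G2 \<tau> a z \<and> (\<forall>t\<in>{0..T}. \<bar>z t - H \<tau> a z t\<bar> \<le> L * (2 * T / real N))"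
    if N: "0 < N" for N
  proof -
    define Z where "Z x = hat_interp T N (\<lambda>k. x (k + 2))" for x :: "nat \<Rightarrow> real"
    \<comment> \<open>Coordinates 0 and 1 are the scalars and coordinate \<open>k + 2\<close> is the
      value at node \<open>k\<close>; the \<open>N + 1\<close> nodes make \<open>N + 3\<close>
      coordinates.\<close>
    define l where "l i = (if i = 0 then l1 else if i = 1 then l2 else - \<rho>)" for i :: nat
    define r where "r i = (if i = 0 then r1 else if i = 1 then r2 else \<rho>)" for i :: nat
    define F where "F x i = (if i = 0 then G1 (x 0) (x 1) (Z x) else if i = 1 then G2 (x 0) (x 1) (Z x)
       else H (x 0) (x 1) (Z x) (node T N (i - 2)))" for x :: "nat \<Rightarrow> real" and i :: nat
    have DZ: "D (x 0) (x 1) (Z x)" if x: "\<forall>j<N+3. x j \<in> {l j..r j}" for x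
    proof -
      have "x 0 \<in> {l1..r1}" using x[rule_format, of 0] by (simp add: l_def r_def)
      moreover have "x 1 \<in> {l2..r2}" using x[rule_format, of 1] by (simp add: l_def r_def)
      moreover have "\<bar>Z x t\<bar> \<le> \<rho>" if "t \<in> {0..T}" for t
      proof -
        have "\<bar>x (k + 2)\<bar> \<le> \<rho>" if "k \<le> N" for k
          using x[rule_format, of "k + 2"] that by (auto simp: l_def r_def)
        then have "\<bar>Z x t - 0\<bar> \<le> \<rho>" unfolding Z_def
          by (intro hat_interp_dist[OF T N that]) auto
        then show ?thesis by simp
      qed
      ultimately show ?thesis using continuous_on_hat_interp[OF T N] by (simp add: D Z_def)
    qed
    have "\<exists>x. \<forall>i<N+3. x i \<in> {l i..r i} \<and> F x i = x i"
    proof (rule brouwer_box_nat)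
      show "l i \<le> r i" for i using lr \<rho> by (simp add: l_def r_def)
    next
      fix x i assume x: "\<forall>j<N+3. x j \<in> {l j..r j}" and i: "i < N + 3"
      note d = DZ[OF x]
      have "\<bar>H (x 0) (x 1) (Z x) (node T N (i - 2))\<bar> \<le> \<rho>"
        by (rule ran(3)[OF d node_mem[OF T N]]) (use i in auto)
      with ran(1,2)[OF d] show "F x i \<in> {l i..r i}" by (auto simp: F_def l_def r_def)
    next
      fix x y i assume x: "\<forall>k. \<forall>j<N+3. x k j \<in> {l j..r j}" and y: "\<forall>j<N+3. y j \<in> {l j..r j}"
        and lim: "\<forall>j<N+3. (\<lambda>k. x k j) \<longlonglongrightarrow> y j" and i: "i < N + 3"
      have "uniform_limit {0..T} (\<lambda>k. Z (x k)) (Z y) sequentially"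
        unfolding Z_def by (rule uniform_limit_hat_interp[OF T N]) (use lim in auto)
      moreover have "D (x k 0) (x k 1) (Z (x k))" for k using DZ x by simp
      ultimately have c: "(\<lambda>n. G1 (x n 0) (x n 1) (Z (x n))) \<longlonglongrightarrow> G1 (y 0) (y 1) (Z y) \<and> (\<lambda>n. G2 (x n 0) (x n 1) (Z (x n))) \<longlonglongrightarrow> G2 (y 0) (y 1) (Z y) \<and>
        (\<forall>t\<in>{0..T}. (\<lambda>n. H (x n 0) (x n 1) (Z (x n)) t) \<longlonglongrightarrow> H (y 0) (y 1) (Z y) t)"
        using DZ[OF y] lim by (intro cont) auto
      have "node T N (i - 2) \<in> {0..T}" by (rule node_mem[OF T N]) (use i in auto)
      with c show "(\<lambda>k. F (x k) i) \<longlonglongrightarrow> F y i" by (simp add: F_def)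
    qed
    then obtain x where x: "\<forall>i<N+3. x i \<in> {l i..r i}" and fx: "\<And>i. i < N+3 \<Longrightarrow> F x i = x i" by blast
    note d = DZ[OF x]
    have h: "x (k + 2) = H (x 0) (x 1) (Z x) (node T N k)" if "k \<le> N" for k
      using fx[of "k + 2"] that by (simp add: F_def)
    have "\<bar>Z x t - H (x 0) (x 1) (Z x) t\<bar> \<le> L * (2 * T / real N)" if t: "t \<in> {0..T}" for t
      unfolding Z_def
    proof (rule hat_interp_dist[OF T N t], fold Z_def)
      fix k assume k: "k \<le> N" "\<bar>t - node T N k\<bar> \<le> 2 * T / real N"
      have "\<bar>x (k + 2) - H (x 0) (x 1) (Z x) t\<bar> \<le> L * \<bar>node T N k - t\<bar>"
        unfolding h[OF k(1)] by (rule lip[OF d node_mem[OF T N k(1)] t])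
      also have "\<dots> \<le> L * (2 * T / real N)"
        using k(2) L by (intro mult_left_mono) (auto simp: abs_minus_commute)
      finally show "\<bar>x (k + 2) - H (x 0) (x 1) (Z x) t\<bar> \<le> L * (2 * T / real N)" .
    qed
    moreover have "x 0 = G1 (x 0) (x 1) (Z x)" "x 1 = G2 (x 0) (x 1) (Z x)"
      using fx[of 0] fx[of 1] by (simp_all add: F_def)
    ultimately show ?thesis using d by blast
  qed
  have "\<forall>n. \<exists>p. D (fst p) (fst (snd p)) (snd (snd p)) \<and> fst p = G1 (fst p) (fst (snd p)) (snd (snd p))
      \<and> fst (snd p) = G2 (fst p) (fst (snd p)) (snd (snd p)) \<and>
      (\<forall>t\<in>{0..T}. \<bar>snd (snd p) t - H (fst p) (fst (snd p)) (snd (snd p)) t\<bar> \<le> L * (2 * T / real (Suc n)))"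
    using approx[OF zero_less_Suc] by auto
  from choice[OF this] obtain p where p:
    "\<And>n. D (fst (p n)) (fst (snd (p n))) (snd (snd (p n))) \<and> fst (p n) = G1 (fst (p n)) (fst (snd (p n))) (snd (snd (p n)))
      \<and> fst (snd (p n)) = G2 (fst (p n)) (fst (snd (p n))) (snd (snd (p n))) \<and>
      (\<forall>t\<in>{0..T}. \<bar>snd (snd (p n)) t - H (fst (p n)) (fst (snd (p n))) (snd (snd (p n))) t\<bar> \<le> L * (2 * T / real (Suc n)))"
    by blast
  define \<tau> a z where "\<tau> n = fst (p n)" and "a n = fst (snd (p n))" and "z n = snd (snd (p n))" for n
  have D': "D (\<tau> n) (a n) (z n)" and f1: "\<tau> n = G1 (\<tau> n) (a n) (z n)" and f2: "a n = G2 (\<tau> n) (a n) (z n)"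
    and f3: "\<And>t. t \<in> {0..T} \<Longrightarrow> \<bar>z n t - H (\<tau> n) (a n) (z n) t\<bar> \<le> L * (2 * T / real (Suc n))" for n
    using p[of n] by (auto simp: \<tau>_def a_def z_def)
  \<comment> \<open>Compactness is extracted for the images \<open>w n\<close>, which share the
    Lipschitz constant \<open>L\<close>; the interpolants \<open>z n\<close> lie within a vanishing
    distance of them.\<close>
  define w where "w n = H (\<tau> n) (a n) (z n)" for n
  obtain w' s where w': "continuous_on {0..T} w'" and s: "strict_mono (s :: nat \<Rightarrow> nat)"
    and wlim: "\<And>e. 0 < e \<Longrightarrow> \<exists>N. \<forall>n x. n \<ge> N \<and> x \<in> {0..T} \<longrightarrow> norm (w (s n) x - w' x) < e"
  proof (rule Arzela_Ascoli[of "{0..T}" w \<rho>])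
    show "norm (w n x) \<le> \<rho>" if "x \<in> {0..T}" for n x
      using ran(3)[OF D' that] by (simp add: w_def)
    fix x e :: real assume x: "x \<in> {0..T}" and e: "0 < e"
    have "norm (w n x - w n y) < e" if "y \<in> {0..T}" "norm (x - y) < e / (L + 1)" for n y
    proof -
      have "norm (w n x - w n y) \<le> L * \<bar>x - y\<bar>" using lip[OF D' x that(1)] by (simp add: w_def)
      also have "\<dots> \<le> (L + 1) * \<bar>x - y\<bar>" by (simp add: mult_right_mono)
      also have "\<dots> < e" using that(2) L by (simp add: pos_less_divide_eq mult.commute)
      finally show ?thesis .
    qed
    then show "\<exists>d>0. \<forall>n y. y \<in> {0..T} \<and> norm (x - y) < d \<longrightarrow> norm (w n x - w n y) < e"
      using e L by (intro exI[of _ "e / (L + 1)"]) auto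
  qed auto
  have "seq_compact ({l1..r1} \<times> {l2..r2})" by (intro compact_imp_seq_compact compact_Times) auto
  moreover have "\<forall>n. (\<tau> (s n), a (s n)) \<in> {l1..r1} \<times> {l2..r2}" using D' by (auto simp: D)
  ultimately obtain ta q where ta: "ta \<in> {l1..r1} \<times> {l2..r2}" and q: "strict_mono (q :: nat \<Rightarrow> nat)"
    and lim: "((\<lambda>n. (\<tau> (s n), a (s n))) \<circ> q) \<longlonglongrightarrow> ta"
    by (rule seq_compactE)
  define \<sigma> where "\<sigma> n = s (q n)" for n
  have \<sigma>: "strict_mono \<sigma>" unfolding \<sigma>_def using strict_mono_o[OF s q] by (simp add: o_def)
  have l1: "(\<lambda>n. \<tau> (\<sigma> n)) \<longlonglongrightarrow> fst ta" and l2: "(\<lambda>n. a (\<sigma> n)) \<longlonglongrightarrow> snd ta"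
    using tendsto_fst[OF lim] tendsto_snd[OF lim] by (simp_all add: o_def \<sigma>_def)
  have uw0: "uniform_limit {0..T} (\<lambda>n. w (s n)) w' sequentially"
    unfolding uniform_limit_iff eventually_sequentially dist_norm using wlim by blast
  have uw: "uniform_limit {0..T} (\<lambda>n. w (\<sigma> n)) w' sequentially"
    using filterlim_compose[OF uw0[unfolded comp_def] filterlim_subseq[OF q]] by (simp add: \<sigma>_def)
  have "(\<lambda>n. L * (2 * T / real (Suc n))) \<longlonglongrightarrow> 0"
    using tendsto_mult_right_zero[OF LIMSEQ_Suc[OF lim_1_over_n], of "L * (2 * T)"] by simp
  from LIMSEQ_subseq_LIMSEQ[OF this \<sigma>] have err: "(\<lambda>n. L * (2 * T / real (Suc (\<sigma> n)))) \<longlonglongrightarrow> 0" by (simp add: o_def)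
  have uz: "uniform_limit {0..T} (\<lambda>n. z (\<sigma> n)) w' sequentially"
  proof (rule uniform_limitI)
    fix e :: real assume e: "0 < e"
    have "\<forall>\<^sub>F n in sequentially. dist (L * (2 * T / real (Suc (\<sigma> n)))) 0 < e / 2"
      by (rule tendstoD[OF err]) (use e in simp)
    moreover have "\<forall>\<^sub>F n in sequentially. \<forall>t\<in>{0..T}. dist (w (\<sigma> n) t) (w' t) < e / 2"
      by (rule uniform_limitD[OF uw]) (use e in simp)
    ultimately show "\<forall>\<^sub>F n in sequentially. \<forall>t\<in>{0..T}. dist (z (\<sigma> n) t) (w' t) < e"
    proof eventually_elim
      case (elim n)
      show ?case
      proof
        fix t assume t: "t \<in> {0..T}"
        have "\<bar>z (\<sigma> n) t - w (\<sigma> n) t\<bar> \<le> L * (2 * T / real (Suc (\<sigma> n)))" using f3[OF t] by (simp add: w_def)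
        moreover have "L * (2 * T / real (Suc (\<sigma> n))) < e / 2" using elim(1) unfolding dist_real_def by linarith
        moreover have "\<bar>w (\<sigma> n) t - w' t\<bar> < e / 2" using elim(2) t by (auto simp: dist_real_def)
        ultimately show "dist (z (\<sigma> n) t) (w' t) < e" unfolding dist_real_def by linarith
      qed
    qed
  qed
  have zw: "(\<lambda>n. z (\<sigma> n) t) \<longlonglongrightarrow> w' t" "(\<lambda>n. w (\<sigma> n) t) \<longlonglongrightarrow> w' t" if "t \<in> {0..T}" for t
    using tendsto_uniform_limitI[OF uz that] tendsto_uniform_limitI[OF uw that] .
  have Dw: "D (fst ta) (snd ta) w'"
  proof -
    have "\<bar>w' t\<bar> \<le> \<rho>" if "t \<in> {0..T}" for t
      by (rule LIMSEQ_le_const2[OF tendsto_rabs[OF zw(1)[OF that]]]) (use D' that in \<open>auto simp: D\<close>)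
    with ta w' show ?thesis by (auto simp: D)
  qed
  note c = cont[OF D' Dw l1 l2 uz]
  have "fst ta = G1 (fst ta) (snd ta) w'"
    by (rule LIMSEQ_unique[OF l1]) (use c in \<open>simp add: f1[symmetric]\<close>)
  moreover have "snd ta = G2 (fst ta) (snd ta) w'"
    by (rule LIMSEQ_unique[OF l2]) (use c in \<open>simp add: f2[symmetric]\<close>)
  moreover have "\<forall>t\<in>{0..T}. w' t = H (fst ta) (snd ta) w' t"
    using zw(2) c LIMSEQ_unique unfolding w_def by blast
  ultimately show ?thesis using Dw by blast
qed

section \<open>Absolute continuity and Lebesgue differentiation\<close>

lemma AE_lebesgue_on_iff_negligible:
  fixes S :: "'a::euclidean_space set"
  assumes "S \<in> sets lebesgue"
  shows "(AE t in lebesgue_on S. P t) \<longleftrightarrow> (\<exists>N. negligible N \<and> (\<forall>t\<in>S - N. P t))"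
proof
  assume "AE t in lebesgue_on S. P t"
  then have "AE t in lebesgue. t \<in> S \<longrightarrow> P t"
    using assms by (simp add: AE_restrict_space_iff)
  then show "\<exists>N. negligible N \<and> (\<forall>t\<in>S - N. P t)"
    unfolding eventually_ae_filter negligible_iff_null_sets by auto
next
  assume "\<exists>N. negligible N \<and> (\<forall>t\<in>S - N. P t)"
  then obtain N where "negligible N" "\<forall>t\<in>S - N. P t" by blast
  then have "AE t in lebesgue. t \<in> S \<longrightarrow> P t"
    unfolding eventually_ae_filter negligible_iff_null_sets by auto
  then show "AE t in lebesgue_on S. P t"
    using assms by (simp add: AE_restrict_space_iff)
qed

lemma negligible_open_superset:
  fixes N :: "real set"
  assumes "negligible N" "0 < \<delta>"
  obtains U where "open U" "N \<subseteq> U" "U \<in> lmeasurable" "measure lebesgue U < \<delta>"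
proof -
  have "N \<in> sets lebesgue" using assms(1) by (rule negligible_imp_sets)
  then obtain U where U: "open U" "N \<subseteq> U" "U - N \<in> lmeasurable" "emeasure lebesgue (U - N) < ennreal \<delta>"
    using sets_lebesgue_outer_open assms(2) by blast
  have "negligible ((U - N) - U \<union> (U - (U - N)))"
    by (rule negligible_subset[OF assms(1)]) auto
  note sd = lmeasurable_negligible_symdiff[OF U(3) this] measure_negligible_symdiff[OF U(3) this]
  have "emeasure lebesgue (U - N) = ennreal (measure lebesgue (U - N))"
    using U(3) by (metis emeasure_eq_measure2)
  with U(4) have "measure lebesgue (U - N) < \<delta>" by (simp add: ennreal_less_iff)
  with sd U that show ?thesis by simp
qed

text \<open>Reindexes a finite family by an initial segment of the naturals, as
  \<open>abs_cont_on\<close> demands. The strict inequality \<open>l p < r p\<close> lets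
  disjointness of open intervals yield the order of endpoints; for a degenerate interval it would
  say nothing.\<close>

lemma abs_cont_on_finite_intervals:
  assumes ac: "\<forall>(n::nat) (a::nat \<Rightarrow> real) b.
        (\<forall>i<n. a i \<in> {\<alpha>..\<beta>} \<and> b i \<in> {\<alpha>..\<beta>} \<and> a i \<le> b i \<and> {a i..b i} \<subseteq> {\<alpha>..\<beta>}) \<and>
        (\<forall>i<n. \<forall>j<n. i \<noteq> j \<longrightarrow> b i \<le> a j \<or> b j \<le> a i) \<and>
        (\<Sum>i<n. b i - a i) < \<delta>
        \<longrightarrow> (\<Sum>i<n. \<bar>F (b i) - F (a i)\<bar>) < (\<epsilon>::real)"
    and fin: "finite P"
    and l: "\<And>p. p \<in> P \<Longrightarrow> \<alpha> \<le> l p \<and> l p < r p \<and> r p \<le> \<beta>"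
    and disj: "\<And>p p'. p \<in> P \<Longrightarrow> p' \<in> P \<Longrightarrow> p \<noteq> p' \<Longrightarrow> {l p<..<r p} \<inter> {l p'<..<r p'} = {}"
    and small: "(\<Sum>p\<in>P. r p - l p) < \<delta>"
  shows "(\<Sum>p\<in>P. \<bar>F (r p) - F (l p)\<bar>) < \<epsilon>"
proof -
  obtain e where e: "bij_betw e {..<card P} P"
    using ex_bij_betw_nat_finite[OF fin] by (auto simp: atLeast0LessThan)
  have eP: "e i \<in> P" if "i < card P" for i using e that by (auto simp: bij_betw_def)
  have "(\<Sum>i<card P. \<bar>F (r (e i)) - F (l (e i))\<bar>) < \<epsilon>"
  proof (rule ac[rule_format], intro conjI allI impI)
    show "l (e i) \<in> {\<alpha>..\<beta>}" "r (e i) \<in> {\<alpha>..\<beta>}" "l (e i) \<le> r (e i)" "{l (e i)..r (e i)} \<subseteq> {\<alpha>..\<beta>}"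
      if "i < card P" for i using l[OF eP[OF that]] by auto
    show "r (e i) \<le> l (e j) \<or> r (e j) \<le> l (e i)" if "i < card P" "j < card P" "i \<noteq> j" for i j
    proof (rule ccontr)
      assume "\<not> ?thesis"
      then have lt: "l (e j) < r (e i)" "l (e i) < r (e j)" by auto
      have "e i \<noteq> e j" using e that by (auto simp: bij_betw_def inj_on_def)
      note d = disj[OF eP[OF that(1)] eP[OF that(2)] this]
      have "max (l (e i)) (l (e j)) < min (r (e i)) (r (e j))"
        using lt l[OF eP[OF that(1)]] l[OF eP[OF that(2)]] by auto
      then obtain x where "max (l (e i)) (l (e j)) < x" "x < min (r (e i)) (r (e j))" using dense by blast
      with d show False by auto
    qed
    show "(\<Sum>i<card P. r (e i) - l (e i)) < \<delta>"
      using small sum.reindex_bij_betw[OF e, of "\<lambda>p. r p - l p"] by simp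
  qed
  then show ?thesis using sum.reindex_bij_betw[OF e, of "\<lambda>p. \<bar>F (r p) - F (l p)\<bar>"] by simp
qed

text \<open>Splitting the increment at \<open>x\<close> transfers the derivative estimate to any
  small interval containing \<open>x\<close>, which is the shape of a tagged interval in a gauge
  division.\<close>

lemma straddle_derivative:
  assumes "(F has_real_derivative D) (at x within S)" "0 < \<eta>"
  shows "\<exists>r>0. \<forall>u\<in>S. \<forall>v\<in>S. u \<le> x \<longrightarrow> x \<le> v \<longrightarrow> \<bar>u - x\<bar> < r \<longrightarrow> \<bar>v - x\<bar> < r \<longrightarrow>
     \<bar>F v - F u - D * (v - u)\<bar> \<le> \<eta> * (v - u)"
proof -
  obtain r where r: "0 < r" and d: "\<And>y. y \<in> S \<Longrightarrow> \<bar>y - x\<bar> < r \<Longrightarrow> \<bar>F y - F x - D * (y - x)\<bar> \<le> \<eta> * \<bar>y - x\<bar>"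
    using assms unfolding has_field_derivative_def has_derivative_within_alt by (auto simp: mult.commute)
  show ?thesis
  proof (intro exI[of _ r] conjI ballI impI r)
    fix u v assume a: "u \<in> S" "v \<in> S" "u \<le> x" "x \<le> v" "\<bar>u - x\<bar> < r" "\<bar>v - x\<bar> < r"
    have "\<bar>F v - F u - D * (v - u)\<bar> \<le> \<bar>F v - F x - D * (v - x)\<bar> + \<bar>F u - F x - D * (u - x)\<bar>"
      by (simp add: algebra_simps)
    also have "\<dots> \<le> \<eta> * \<bar>v - x\<bar> + \<eta> * \<bar>u - x\<bar>"
      using d[OF a(1,5)] d[OF a(2,6)] by linarith
    also have "\<dots> = \<eta> * (v - u)" using a by (simp add: algebra_simps)
    finally show "\<bar>F v - F u - D * (v - u)\<bar> \<le> \<eta> * (v - u)" .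
  qed
qed

text \<open>A gauge with two regimes proves it. Off \<open>N\<close> the straddle lemma makes each
  Riemann term close to the increment of \<open>F\<close>; at tags in \<open>N\<close> the integrand
  is set to 0 and the gauge confines the intervals to an open set of measure below the \<delta> of
  absolute continuity, so that their increments are small in total.\<close>

theorem abs_cont_has_integral:
  fixes F w :: "real \<Rightarrow> real"
  assumes ab: "a < b" and ac: "abs_cont_on {a..b} F" and N: "negligible N"
    and der: "\<And>t. t \<in> {a..b} - N \<Longrightarrow> (F has_real_derivative w t) (at t within {a..b})"
  shows "(w has_integral (F b - F a)) {a..b}"
proof (rule has_integral_spike[OF N])
  define w' where "w' t = (if t \<in> N then 0 else w t)" for t
  show "w t = w' t" if "t \<in> {a..b} - N" for t using that by (simp add: w'_def)
  show "(w' has_integral (F b - F a)) {a..b}"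
    unfolding has_integral_real
  proof (intro allI impI)
    fix e :: real assume e: "0 < e"
    have "0 < e / 2" using e by simp
    from ac[unfolded abs_cont_on_def, THEN spec, THEN mp, OF this]
    obtain \<delta> where \<delta>: "0 < \<delta>" and d: "\<forall>(n::nat) (a'::nat \<Rightarrow> real) b'.
        (\<forall>i<n. a' i \<in> {a..b} \<and> b' i \<in> {a..b} \<and> a' i \<le> b' i \<and> {a' i..b' i} \<subseteq> {a..b}) \<and>
        (\<forall>i<n. \<forall>j<n. i \<noteq> j \<longrightarrow> b' i \<le> a' j \<or> b' j \<le> a' i) \<and>
        (\<Sum>i<n. b' i - a' i) < \<delta>
        \<longrightarrow> (\<Sum>i<n. \<bar>F (b' i) - F (a' i)\<bar>) < e / 2"
      by (elim exE conjE) (rule that)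
    obtain U where U: "open U" "N \<subseteq> U" "U \<in> lmeasurable" "measure lebesgue U < \<delta>"
      using negligible_open_superset[OF N \<delta>] by blast
    define \<eta> where "\<eta> = e / (2 * (b - a))"
    have \<eta>: "0 < \<eta>" using e ab by (simp add: \<eta>_def)
    have "\<forall>x\<in>{a..b} - N. \<exists>r>0. \<forall>u\<in>{a..b}. \<forall>v\<in>{a..b}. u \<le> x \<longrightarrow> x \<le> v \<longrightarrow> \<bar>u - x\<bar> < r \<longrightarrow> \<bar>v - x\<bar> < r \<longrightarrow>
        \<bar>F v - F u - w x * (v - u)\<bar> \<le> \<eta> * (v - u)"
      using straddle_derivative[OF der \<eta>] by simp
    from bchoice[OF this] obtain r where "\<forall>x\<in>{a..b} - N. 0 < r x \<and> (\<forall>u\<in>{a..b}. \<forall>v\<in>{a..b}. u \<le> x \<longrightarrow> x \<le> v \<longrightarrow>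
        \<bar>u - x\<bar> < r x \<longrightarrow> \<bar>v - x\<bar> < r x \<longrightarrow> \<bar>F v - F u - w x * (v - u)\<bar> \<le> \<eta> * (v - u))" ..
    then have r: "\<And>x. x \<in> {a..b} - N \<Longrightarrow> 0 < r x" and
      st: "\<And>x u v. x \<in> {a..b} - N \<Longrightarrow> u \<in> {a..b} \<Longrightarrow> v \<in> {a..b} \<Longrightarrow> u \<le> x \<Longrightarrow> x \<le> v \<Longrightarrow> \<bar>u - x\<bar> < r x \<Longrightarrow> \<bar>v - x\<bar> < r x \<Longrightarrow>
        \<bar>F v - F u - w x * (v - u)\<bar> \<le> \<eta> * (v - u)"
      by simp_all
    define \<gamma> where "\<gamma> x = (if x \<in> N then U else if x \<in> {a..b} then ball x (r x) else UNIV)" for x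
    have gauge: "gauge \<gamma>" unfolding gauge_def \<gamma>_def using U(1,2) r by auto
    have key: "norm ((\<Sum>(x,k)\<in>p. measure lborel k *\<^sub>R w' x) - (F b - F a)) < e"
      if p: "p tagged_division_of {a..b}" "\<gamma> fine p" for p
    proof -
      note pD = tagged_division_ofD[OF p(1)]
      have fin: "finite p" by (rule pD(1))
      define lo where "lo xk = Inf (snd xk)" for xk :: "real \<times> real set"
      define up where "up xk = Sup (snd xk)" for xk :: "real \<times> real set"
      have K: "snd xk = {lo xk..up xk} \<and> a \<le> lo xk \<and> lo xk \<le> fst xk \<and> fst xk \<le> up xk \<and> up xk \<le> b" if "xk \<in> p" for xk
      proof -
        obtain x k where xk: "xk = (x, k)" by force
        with that pD(2,3,4) have "x \<in> k" "k \<subseteq> {a..b}" "\<exists>u v. k = {u..v}" by auto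
        then show ?thesis by (auto simp: xk lo_def up_def)
      qed
      have fine: "snd xk \<subseteq> \<gamma> (fst xk)" if "xk \<in> p" for xk
        using p(2) that unfolding fine_def split_beta by blast
      have tele: "(\<Sum>xk\<in>p. F (up xk) - F (lo xk)) = F b - F a"
        using additive_tagged_division_1[OF less_imp_le[OF ab] p(1), of F] by (simp add: lo_def up_def split_def)
      have cont: "measure lborel (snd xk) = up xk - lo xk" if "xk \<in> p" for xk using K[OF that] by auto
      have sumc: "(\<Sum>xk\<in>p. up xk - lo xk) = b - a"
        using additive_tagged_division_1[OF less_imp_le[OF ab] p(1), of "\<lambda>x. x"] by (simp add: lo_def up_def split_def)
      \<comment> \<open>Intervals of length zero are left out: they contribute nothing, and
        \<open>abs_cont_on_finite_intervals\<close> wants proper ones.\<close>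
      define B where "B = {xk\<in>p. fst xk \<in> N \<and> lo xk < up xk}"
      have B: "finite B" "B \<subseteq> p" using fin by (auto simp: B_def)
      have disj: "{lo xk<..<up xk} \<inter> {lo xk'<..<up xk'} = {}" if "xk \<in> p" "xk' \<in> p" "xk \<noteq> xk'" for xk xk'
      proof -
        have "interior (snd xk) \<inter> interior (snd xk') = {}"
          using pD(5)[of "fst xk" "snd xk" "fst xk'" "snd xk'"] that by (auto simp: prod_eq_iff)
        then show ?thesis using K[OF that(1)] K[OF that(2)] by (metis interior_atLeastAtMost_real)
      qed
      have "(\<Sum>xk\<in>B. up xk - lo xk) = (\<Sum>xk\<in>B. measure lebesgue {lo xk<..<up xk})"
        by (intro sum.cong) (auto simp: B_def)
      also have "\<dots> = measure lebesgue (\<Union>xk\<in>B. {lo xk<..<up xk})"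
      proof (rule measure_finite_Union[symmetric])
        show "disjoint_family_on (\<lambda>xk. {lo xk<..<up xk}) B"
          unfolding disjoint_family_on_def using B disj by blast
        show "emeasure lebesgue {lo xk<..<up xk} \<noteq> \<infinity>" if "xk \<in> B" for xk
          using that by (simp add: B_def)
      qed (use B in auto)
      also have "\<dots> \<le> measure lebesgue U"
      proof (rule measure_mono_fmeasurable[OF _ _ U(3)])
        show "(\<Union>xk\<in>B. {lo xk<..<up xk}) \<subseteq> U"
        proof (rule UN_least)
          fix xk assume xk: "xk \<in> B"
          then have "snd xk \<subseteq> \<gamma> (fst xk)" using fine B by blast
          then have "snd xk \<subseteq> U" using xk by (simp add: B_def \<gamma>_def)
          moreover have "snd xk = {lo xk..up xk}" using K xk B by blast
          ultimately show "{lo xk<..<up xk} \<subseteq> U" using greaterThanLessThan_subseteq_atLeastAtMost_iff by blast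
        qed
      qed (use B in auto)
      finally have small: "(\<Sum>xk\<in>B. up xk - lo xk) < \<delta>" using U(4) by simp
      have badsum: "(\<Sum>xk\<in>B. \<bar>F (up xk) - F (lo xk)\<bar>) < e / 2"
        by (rule abs_cont_on_finite_intervals[OF d B(1) _ _ small]) (use K disj B in \<open>auto simp: B_def\<close>)
      have tm: "\<bar>measure lborel (snd xk) * w' (fst xk) - (F (up xk) - F (lo xk))\<bar> \<le>
          \<eta> * (up xk - lo xk) + (if xk \<in> B then \<bar>F (up xk) - F (lo xk)\<bar> else 0)" if xk: "xk \<in> p" for xk
      proof (cases "fst xk \<in> N")
        case True
        then have w0: "w' (fst xk) = 0" by (simp add: w'_def)
        have "0 \<le> \<eta> * (up xk - lo xk)" using \<eta> K[OF xk] by simp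
        moreover have "xk \<in> B \<or> up xk = lo xk" using True K[OF xk] xk by (auto simp: B_def)
        ultimately show ?thesis using w0 by auto
      next
        case False
        have x: "fst xk \<in> {a..b} - N" using K[OF xk] False by auto
        have "snd xk \<subseteq> \<gamma> (fst xk)" by (rule fine[OF xk])
        moreover have "lo xk \<in> snd xk" "up xk \<in> snd xk" using K[OF xk] by auto
        ultimately have "lo xk \<in> ball (fst xk) (r (fst xk))" "up xk \<in> ball (fst xk) (r (fst xk))"
          using x by (auto simp: \<gamma>_def)
        then have "\<bar>F (up xk) - F (lo xk) - w (fst xk) * (up xk - lo xk)\<bar> \<le> \<eta> * (up xk - lo xk)"
          using K[OF xk] by (intro st[OF x]) (auto simp: dist_real_def abs_minus_commute)
        moreover have "xk \<notin> B" "w' (fst xk) = w (fst xk)" using False by (auto simp: B_def w'_def)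
        ultimately show ?thesis unfolding cont[OF xk] by (simp add: mult.commute abs_minus_commute)
      qed
      have "(\<Sum>(x,k)\<in>p. measure lborel k *\<^sub>R w' x) - (F b - F a) = (\<Sum>xk\<in>p. measure lborel (snd xk) * w' (fst xk) - (F (up xk) - F (lo xk)))"
        by (simp add: tele[symmetric] sum_subtractf split_def)
      also have "\<bar>\<dots>\<bar> \<le> (\<Sum>xk\<in>p. \<eta> * (up xk - lo xk) + (if xk \<in> B then \<bar>F (up xk) - F (lo xk)\<bar> else 0))"
        by (rule order_trans[OF sum_abs sum_mono[OF tm]])
      also have "\<dots> = \<eta> * (b - a) + (\<Sum>xk\<in>B. \<bar>F (up xk) - F (lo xk)\<bar>)"
        using sum.inter_restrict[OF fin, of "\<lambda>xk. \<bar>F (up xk) - F (lo xk)\<bar>" B] B(2)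
        by (simp add: sum.distrib sum_distrib_left[symmetric] sumc Int_absorb1)
      also have "\<eta> * (b - a) = e / 2" using ab by (simp add: \<eta>_def field_simps)
      finally have "\<bar>(\<Sum>(x,k)\<in>p. measure lborel k *\<^sub>R w' x) - (F b - F a)\<bar> < e" using badsum by linarith
      then show ?thesis by simp
    qed
    show "\<exists>\<gamma>. gauge \<gamma> \<and> (\<forall>p. p tagged_division_of {a..b} \<and> \<gamma> fine p \<longrightarrow>
        norm ((\<Sum>(x,k)\<in>p. measure lborel k *\<^sub>R w' x) - (F b - F a)) < e)"
      using gauge key by (intro exI[of _ \<gamma>] conjI allI impI) (assumption, elim conjE)
  qed
qed

text \<open>The exceptional set is a countable union of sets \<open>E n\<close>, where the
  difference quotient misses \<open>q\<close> by more than \<open>1 / (n + 1)\<close> at arbitrarily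
  near points. Each miss is the error of one tagged interval in the Henstock lemma, whose total is
  as small as desired; Vitali covering selects disjoint intervals whose fivefold enlargements still
  cover \<open>E n\<close>.\<close>

theorem lebesgue_differentiation_real:
  fixes q :: "real \<Rightarrow> real"
  assumes q: "q integrable_on {a..b}"
  shows "\<exists>N. negligible N \<and> (\<forall>t\<in>{a..b} - N. ((\<lambda>t. integral {a..t} q) has_real_derivative q t) (at t within {a..b}))"
proof -
  define Q where "Q t = integral {a..t} q" for t
  have Qdiff: "Q v - Q u = integral {u..v} q" if "a \<le> u" "u \<le> v" "v \<le> b" for u v
  proof -
    have "q integrable_on {a..v}" by (rule integrable_subinterval_real[OF q]) (use that in auto)
    from Henstock_Kurzweil_Integration.integral_combine[OF that(1,2) this] show ?thesis by (simp add: Q_def)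
  qed
  define bad where "bad n x y \<longleftrightarrow> y \<in> {a..b} \<and> y \<noteq> x \<and> \<bar>y - x\<bar> < real (Suc n) * \<bar>Q y - Q x - q x * (y - x)\<bar>" for n x y
  define E where "E n = {x \<in> {a..b}. \<forall>r>0. \<exists>y. bad n x y \<and> \<bar>y - x\<bar> < r}" for n
  have "negligible (E n)" for n
    unfolding negligible_outer_le
  proof (intro allI impI)
    fix e :: real assume e: "0 < e"
    \<comment> \<open>The 5 pays for the Vitali enlargement and \<open>Suc n\<close> for turning the
      error of an interval into its length, so the enlarged intervals have total length at most
      \<open>e\<close>.\<close>
    define \<epsilon> where "\<epsilon> = e / (5 * real (Suc n))"
    have \<epsilon>: "0 < \<epsilon>" using e by (simp add: \<epsilon>_def)
    obtain \<gamma> where \<gamma>: "gauge \<gamma>" and hen: "\<And>p. p tagged_partial_division_of cbox a b \<Longrightarrow> \<gamma> fine p \<Longrightarrow>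
         (\<Sum>(x, k)\<in>p. norm (measure lborel k *\<^sub>R q x - integral k q)) < \<epsilon>"
      using Henstock_lemma[of q a b \<epsilon>] q \<epsilon> by auto
    have "\<forall>x\<in>E n. \<exists>y. bad n x y \<and> cball ((x + y) / 2) (\<bar>y - x\<bar> / 2) \<subseteq> \<gamma> x"
    proof
      fix x assume x: "x \<in> E n"
      obtain r where r: "0 < r" "ball x r \<subseteq> \<gamma> x"
        using \<gamma> unfolding gauge_def open_contains_ball by blast
      then obtain y where y: "bad n x y" "\<bar>y - x\<bar> < r" using x by (auto simp: E_def)
      have "cball ((x + y) / 2) (\<bar>y - x\<bar> / 2) \<subseteq> ball x r"
        using y(2) by (auto simp: dist_real_def field_simps abs_if split: if_splits)
      with r y show "\<exists>y. bad n x y \<and> cball ((x + y) / 2) (\<bar>y - x\<bar> / 2) \<subseteq> \<gamma> x" by blast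
    qed
    from bchoice[OF this] obtain y where "\<forall>x\<in>E n. bad n x (y x) \<and> cball ((x + y x) / 2) (\<bar>y x - x\<bar> / 2) \<subseteq> \<gamma> x" ..
    then have y: "\<And>x. x \<in> E n \<Longrightarrow> bad n x (y x)"
      and yc: "\<And>x. x \<in> E n \<Longrightarrow> cball ((x + y x) / 2) (\<bar>y x - x\<bar> / 2) \<subseteq> \<gamma> x" by blast+
    \<comment> \<open>\<open>cball (m x) (r x)\<close> is the closed segment between
      \<open>x\<close> and \<open>y x\<close>, written as a ball for the covering lemma; the tag
      \<open>x\<close> is one of its endpoints.\<close>
    define m where "m x = (x + y x) / 2" for x
    define r where "r x = \<bar>y x - x\<bar> / 2" for x
    have Eab: "x \<in> {a..b}" "y x \<in> {a..b}" "y x \<noteq> x" if "x \<in> E n" for x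
      using that y[OF that] by (auto simp: E_def bad_def)
    have r: "0 < r x \<and> r x \<le> b - a" if "x \<in> E n" for x
      using Eab[OF that] by (auto simp: r_def abs_if)
    have mem: "x \<in> cball (m x) (r x)" for x
      by (auto simp: m_def r_def dist_real_def field_simps abs_if)
    have "E n \<subseteq> (\<Union>x\<in>E n. cball (m x) (r x))" using mem by blast
    then obtain C where C: "countable C" "C \<subseteq> E n" and pw: "pairwise (\<lambda>i j. disjnt (cball (m i) (r i)) (cball (m j) (r j))) C"
      and cov: "E n \<subseteq> (\<Union>i\<in>C. cball (m i) (5 * r i))"
      by (rule Vitali_covering_lemma_cballs[OF _ r])
    have sumr: "(\<Sum>x\<in>C'. 10 * r x) \<le> e" if C': "C' \<subseteq> C" "finite C'" for C'
    proof -
      have C'E: "x \<in> E n" if "x \<in> C'" for x using that C' C by blast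
      have disj: "cball (m x) (r x) \<inter> cball (m x') (r x') = {}" if "x \<in> C'" "x' \<in> C'" "x \<noteq> x'" for x x'
        using pw that C' unfolding pairwise_def disjnt_def by blast
      define p where "p = (\<lambda>x. (x, cball (m x) (r x))) ` C'"
      have "p tagged_partial_division_of cbox a b"
        unfolding tagged_partial_division_of_def
      proof (intro conjI allI impI)
        show "finite p" using C' by (simp add: p_def)
        fix x K assume "(x, K) \<in> p"
        then have x: "x \<in> E n" and K: "K = cball (m x) (r x)" using C'E by (auto simp: p_def)
        show "x \<in> K" using mem K by simp
        show "K \<subseteq> cbox a b"
          unfolding K cball_eq_atLeastAtMost using Eab[OF x] by (auto simp: m_def r_def abs_if field_simps)
        show "\<exists>u v. K = cbox u v" unfolding K cball_eq_atLeastAtMost by auto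
      next
        fix x K x' K' assume "(x, K) \<in> p \<and> (x', K') \<in> p \<and> (x, K) \<noteq> (x', K')"
        then have "x \<in> C'" "x' \<in> C'" "x \<noteq> x'" "K = cball (m x) (r x)" "K' = cball (m x') (r x')" by (auto simp: p_def)
        with disj[of x x'] show "interior K \<inter> interior K' = {}" using interior_subset by blast
      qed
      moreover have "\<gamma> fine p" using yc C'E by (auto simp: fine_def p_def m_def r_def)
      ultimately have "(\<Sum>(x, k)\<in>p. norm (measure lborel k *\<^sub>R q x - integral k q)) < \<epsilon>" by (rule hen)
      then have lt: "(\<Sum>x\<in>C'. norm (measure lborel (cball (m x) (r x)) *\<^sub>R q x - integral (cball (m x) (r x)) q)) < \<epsilon>"
        unfolding p_def by (subst (asm) sum.reindex) (auto simp: inj_on_def)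
      have "2 * r x \<le> real (Suc n) * norm (measure lborel (cball (m x) (r x)) *\<^sub>R q x - integral (cball (m x) (r x)) q)"
        if "x \<in> C'" for x
      proof -
        note xE = C'E[OF that]
        have b: "2 * r x \<le> real (Suc n) * \<bar>Q (y x) - Q x - q x * (y x - x)\<bar>"
          using y[OF xE] by (simp add: bad_def r_def)
        show ?thesis
        proof (cases "x \<le> y x")
          case True
          then have cb: "cball (m x) (r x) = {x..y x}"
            unfolding cball_eq_atLeastAtMost m_def r_def by (simp add: field_simps)
          have "Q (y x) - Q x = integral {x..y x} q" using True Eab[OF xE] by (intro Qdiff) auto
          with b True show ?thesis unfolding cb by (simp add: abs_minus_commute mult.commute)
        next
          case False
          then have cb: "cball (m x) (r x) = {y x..x}"
            unfolding cball_eq_atLeastAtMost m_def r_def by (simp add: field_simps)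
          have "Q x - Q (y x) = integral {y x..x} q" using False Eab[OF xE] by (intro Qdiff) auto
          then have "Q (y x) - Q x - q x * (y x - x) = (x - y x) * q x - integral {y x..x} q" by (simp add: algebra_simps)
          with b False show ?thesis unfolding cb by simp
        qed
      qed
      then have "(\<Sum>x\<in>C'. 2 * r x) \<le> (\<Sum>x\<in>C'. real (Suc n) * norm (measure lborel (cball (m x) (r x)) *\<^sub>R q x - integral (cball (m x) (r x)) q))"
        by (rule sum_mono)
      also have "\<dots> \<le> real (Suc n) * \<epsilon>" unfolding sum_distrib_left[symmetric] using lt by (intro mult_left_mono) auto
      also have "\<dots> = e / 5" by (simp add: \<epsilon>_def del: of_nat_Suc)
      finally show ?thesis by (simp add: sum_distrib_left[symmetric])
    qed
    have bound: "measure lebesgue (\<Union>x\<in>C'. cball (m x) (5 * r x)) \<le> e" if C': "C' \<subseteq> C" "finite C'" for C'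
    proof -
      have "measure lebesgue (\<Union>x\<in>C'. cball (m x) (5 * r x)) \<le> (\<Sum>x\<in>C'. measure lebesgue (cball (m x) (5 * r x)))"
        by (rule measure_UNION_le) (use C' in auto)
      also have "\<dots> = (\<Sum>x\<in>C'. 10 * r x)"
      proof (rule sum.cong[OF refl])
        fix x assume "x \<in> C'"
        then have "0 < r x" using r C' C by blast
        then show "measure lebesgue (cball (m x) (5 * r x)) = 10 * r x"
          unfolding cball_eq_atLeastAtMost by simp
      qed
      finally show ?thesis using sumr[OF C'] by simp
    qed
    show "\<exists>U. E n \<subseteq> U \<and> U \<in> lmeasurable \<and> measure lebesgue U \<le> e"
    proof (intro exI conjI)
      show "(\<Union>x\<in>C. cball (m x) (5 * r x)) \<in> lmeasurable"
        by (rule fmeasurable_UN_bound[OF C(1) _ bound]) auto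
      show "measure lebesgue (\<Union>x\<in>C. cball (m x) (5 * r x)) \<le> e"
        by (rule measure_UN_bound[OF C(1) _ bound]) auto
    qed (rule cov)
  qed
  then have N: "negligible (\<Union>n. E n)" by (rule negligible_Union_nat)
  show ?thesis
  proof (intro exI conjI ballI, rule N)
    fix t assume t: "t \<in> {a..b} - (\<Union>n. E n)"
    show "((\<lambda>t. integral {a..t} q) has_real_derivative q t) (at t within {a..b})"
      unfolding has_field_derivative_def has_derivative_within_alt Q_def[symmetric]
    proof (intro conjI allI impI)
      show "bounded_linear ((*) (q t))" by (rule bounded_linear_mult_right)
      fix e :: real assume e: "0 < e"
      obtain n where n: "1 / real (Suc n) < e" using e nat_approx_posE by blast
      have "t \<notin> E n" "t \<in> {a..b}" using t by blast+
      then have "\<not> (\<forall>r>0. \<exists>y. bad n t y \<and> \<bar>y - t\<bar> < r)" unfolding E_def by blast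
      then have "\<exists>r>0. \<forall>y. \<bar>y - t\<bar> < r \<longrightarrow> \<not> bad n t y" by blast
      then obtain r where r: "0 < r" and nb: "\<And>y. \<bar>y - t\<bar> < r \<Longrightarrow> \<not> bad n t y" by blast
      have "\<bar>Q y - Q t - q t * (y - t)\<bar> \<le> e * \<bar>y - t\<bar>" if "y \<in> {a..b}" "\<bar>y - t\<bar> < r" for y
      proof (cases "y = t")
        case False
        then have "real (Suc n) * \<bar>Q y - Q t - q t * (y - t)\<bar> \<le> \<bar>y - t\<bar>" using nb[OF that(2)] that(1) by (auto simp: bad_def)
        then have "\<bar>Q y - Q t - q t * (y - t)\<bar> \<le> 1 / real (Suc n) * \<bar>y - t\<bar>" by (simp add: field_simps)
        also have "\<dots> \<le> e * \<bar>y - t\<bar>" using n by (intro mult_right_mono) auto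
        finally show ?thesis .
      qed simp
      with r show "\<exists>d>0. \<forall>y\<in>{a..b}. norm (y - t) < d \<longrightarrow> norm (Q y - Q t - q t * (y - t)) \<le> e * norm (y - t)" by auto
    qed
  qed
qed

text \<open>The integrand is split at height \<open>n\<close>: the excess of \<open>|q|\<close> over
  \<open>n\<close> has small integral over all of \<open>{a..b}\<close> by dominated convergence,
  while the part below \<open>n\<close> contributes at most \<open>n\<close> times the total
  length.\<close>

theorem abs_cont_on_indefinite_integral:
  fixes q :: "real \<Rightarrow> real"
  assumes q: "q absolutely_integrable_on {a..b}"
  shows "abs_cont_on {a..b} (\<lambda>t. integral {a..t} q)"
  unfolding abs_cont_on_def
proof (intro allI impI)
  fix e :: real assume e: "0 < e"
  have qi: "q integrable_on {a..b}" and qn: "(\<lambda>x. \<bar>q x\<bar>) integrable_on {a..b}"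
    using q by (auto simp: absolutely_integrable_on_def)
  define h where "h n x = max 0 (\<bar>q x\<bar> - real n)" for n :: nat and x
  have hi: "h n absolutely_integrable_on {a..b}" for n
    unfolding h_def by (rule absolutely_integrable_max_1) (auto intro!: set_integral_diff set_integrable_abs q absolutely_integrable_on_const)
  have "(\<lambda>n. integral {a..b} (h n)) \<longlonglongrightarrow> integral {a..b} (\<lambda>x. 0)"
  proof (rule dominated_convergence(2)[OF _ qn])
    show "h n integrable_on {a..b}" for n using hi by (simp add: absolutely_integrable_on_def)
    show "norm (h n x) \<le> \<bar>q x\<bar>" for n x by (auto simp: h_def)
    show "(\<lambda>n. h n x) \<longlonglongrightarrow> 0" for x
    proof (rule tendsto_eventually)
      obtain k :: nat where "\<bar>q x\<bar> < real k" using reals_Archimedean2 by blast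
      then show "\<forall>\<^sub>F n in sequentially. h n x = 0"
        unfolding eventually_sequentially h_def by (intro exI[of _ k]) (auto simp: max_def)
    qed
  qed
  then have "\<forall>\<^sub>F n in sequentially. integral {a..b} (h n) < e / 2"
    by (rule order_tendstoD) (use e in simp)
  then obtain n where n: "integral {a..b} (h n) < e / 2" unfolding eventually_sequentially by blast
  have hn: "h n integrable_on {a..b}" using hi by (simp add: absolutely_integrable_on_def)
  show "\<exists>\<delta>>0. \<forall>(m::nat) (l::nat \<Rightarrow> real) r.
        (\<forall>i<m. l i \<in> {a..b} \<and> r i \<in> {a..b} \<and> l i \<le> r i \<and> {l i..r i} \<subseteq> {a..b}) \<and>
        (\<forall>i<m. \<forall>j<m. i \<noteq> j \<longrightarrow> r i \<le> l j \<or> r j \<le> l i) \<and> (\<Sum>i<m. r i - l i) < \<delta> \<longrightarrow>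
        (\<Sum>i<m. \<bar>integral {a..r i} q - integral {a..l i} q\<bar>) < e"
  proof (intro exI conjI allI impI)
    show "0 < e / (2 * (real n + 1))" using e by simp
    fix m :: nat and l r :: "nat \<Rightarrow> real"
    assume A: "(\<forall>i<m. l i \<in> {a..b} \<and> r i \<in> {a..b} \<and> l i \<le> r i \<and> {l i..r i} \<subseteq> {a..b}) \<and>
        (\<forall>i<m. \<forall>j<m. i \<noteq> j \<longrightarrow> r i \<le> l j \<or> r j \<le> l i) \<and> (\<Sum>i<m. r i - l i) < e / (2 * (real n + 1))"
    have lr: "a \<le> l i" "l i \<le> r i" "r i \<le> b" if "i < m" for i using A that by auto
    have sub: "f integrable_on {l i..r i}" if "i < m" "f integrable_on {a..b}" for i and f :: "real \<Rightarrow> real"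
      by (rule integrable_subinterval_real[OF that(2)]) (use lr[OF that(1)] in auto)
    have tm: "\<bar>integral {a..r i} q - integral {a..l i} q\<bar> \<le> integral {l i..r i} (h n) + real n * (r i - l i)" if i: "i < m" for i
    proof -
      have "q integrable_on {a..r i}" by (rule integrable_subinterval_real[OF qi]) (use lr[OF i] in auto)
      from Henstock_Kurzweil_Integration.integral_combine[OF lr(1,2)[OF i] this]
      have "\<bar>integral {a..r i} q - integral {a..l i} q\<bar> = \<bar>integral {l i..r i} q\<bar>" by simp
      also have "\<dots> \<le> integral {l i..r i} (\<lambda>x. h n x + real n)"
      proof -
        have "(\<lambda>x. h n x + real n) integrable_on {l i..r i}" using sub[OF i hn] by (intro integrable_add) auto
        moreover have "\<bar>q x\<bar> \<le> h n x + real n" for x by (simp add: h_def)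
        ultimately show ?thesis using integral_norm_bound_integral[OF sub[OF i qi], of "\<lambda>x. h n x + real n"] by simp
      qed
      also have "\<dots> = integral {l i..r i} (h n) + real n * (r i - l i)"
        using sub[OF i hn] lr[OF i] by (subst integral_add) auto
      finally show ?thesis .
    qed
    define u where "u i x = (if x \<in> box (l i) (r i) then h n x else 0)" for i x
    have u: "(u i has_integral integral {l i..r i} (h n)) {a..b}" if "i < m" for i
      using has_integral_restrict_open_subinterval[of "h n" "integral {l i..r i} (h n)" "l i" "r i" a b]
        integrable_integral[OF sub[OF that hn]] lr[OF that] by (simp add: u_def[abs_def])
    have us: "((\<lambda>x. \<Sum>i<m. u i x) has_integral (\<Sum>i<m. integral {l i..r i} (h n))) {a..b}"
      by (rule has_integral_sum) (use u in auto)
    have ule: "(\<Sum>i<m. u i x) \<le> h n x" for x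
    proof (cases "\<exists>j<m. x \<in> box (l j) (r j)")
      case True
      then obtain j where j: "j < m" "x \<in> box (l j) (r j)" by blast
      have "u i x = 0" if "i \<in> {..<m} - {j}" for i
      proof -
        have "r i \<le> l j \<or> r j \<le> l i" using A that j by blast
        then show ?thesis using j by (auto simp: u_def)
      qed
      then have "(\<Sum>i<m. u i x) = u j x" using j(1) by (subst sum.remove[of _ j]) auto
      then show ?thesis by (simp add: u_def h_def)
    next
      case False
      then have "(\<Sum>i<m. u i x) = 0" by (intro sum.neutral) (auto simp: u_def)
      then show ?thesis by (simp add: h_def)
    qed
    have hs: "(\<Sum>i<m. integral {l i..r i} (h n)) \<le> integral {a..b} (h n)"
      by (rule has_integral_le[OF us integrable_integral[OF hn] ule])
    have "(\<Sum>i<m. \<bar>integral {a..r i} q - integral {a..l i} q\<bar>) \<le> (\<Sum>i<m. integral {l i..r i} (h n) + real n * (r i - l i))"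
      by (intro sum_mono tm) auto
    also have "\<dots> = (\<Sum>i<m. integral {l i..r i} (h n)) + real n * (\<Sum>i<m. r i - l i)"
      by (simp add: sum.distrib sum_distrib_left)
    also have "\<dots> \<le> integral {a..b} (h n) + real n * (e / (2 * (real n + 1)))"
      using hs A by (intro add_mono mult_left_mono) auto
    also have "real n * (e / (2 * (real n + 1))) \<le> e / 2" using e by (simp add: field_simps)
    finally show "(\<Sum>i<m. \<bar>integral {a..r i} q - integral {a..l i} q\<bar>) < e" using n by simp
  qed
qed

section \<open>Integral estimates and superposition operators\<close>

text \<open>Absolute continuity sees only increments, so it passes between functions that differ by
  a constant and to smaller intervals.\<close>

lemma abs_cont_on_increments:
  assumes "abs_cont_on S G" "S' \<subseteq> S" and inc: "\<And>x y. x \<in> S' \<Longrightarrow> y \<in> S' \<Longrightarrow> F y - F x = G y - G x"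
  shows "abs_cont_on S' F"
  unfolding abs_cont_on_def
proof (intro allI impI)
  fix e :: real assume "0 < e"
  from assms(1)[unfolded abs_cont_on_def, THEN spec, THEN mp, OF this]
  obtain d where d: "0 < d" "\<forall>(n::nat) (a::nat \<Rightarrow> real) b.
        (\<forall>i<n. a i \<in> S \<and> b i \<in> S \<and> a i \<le> b i \<and> {a i..b i} \<subseteq> S) \<and>
        (\<forall>i<n. \<forall>j<n. i \<noteq> j \<longrightarrow> b i \<le> a j \<or> b j \<le> a i) \<and> (\<Sum>i<n. b i - a i) < d \<longrightarrow>
        (\<Sum>i<n. \<bar>G (b i) - G (a i)\<bar>) < e"
    by (elim exE conjE)
  show "\<exists>d>0. \<forall>(n::nat) (a::nat \<Rightarrow> real) b.
        (\<forall>i<n. a i \<in> S' \<and> b i \<in> S' \<and> a i \<le> b i \<and> {a i..b i} \<subseteq> S') \<and>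
        (\<forall>i<n. \<forall>j<n. i \<noteq> j \<longrightarrow> b i \<le> a j \<or> b j \<le> a i) \<and> (\<Sum>i<n. b i - a i) < d \<longrightarrow>
        (\<Sum>i<n. \<bar>F (b i) - F (a i)\<bar>) < e"
  proof (intro exI[of _ d] conjI allI impI d(1))
    fix n :: nat and a b :: "nat \<Rightarrow> real"
    assume A: "(\<forall>i<n. a i \<in> S' \<and> b i \<in> S' \<and> a i \<le> b i \<and> {a i..b i} \<subseteq> S') \<and>
        (\<forall>i<n. \<forall>j<n. i \<noteq> j \<longrightarrow> b i \<le> a j \<or> b j \<le> a i) \<and> (\<Sum>i<n. b i - a i) < d"
    have "(\<Sum>i<n. \<bar>F (b i) - F (a i)\<bar>) = (\<Sum>i<n. \<bar>G (b i) - G (a i)\<bar>)"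
      by (intro sum.cong refl arg_cong[where f=abs] inc) (use A in auto)
    also have "\<dots> < e"
      using A assms(2) by (intro d(2)[rule_format] conjI) (auto dest: subsetD)
    finally show "(\<Sum>i<n. \<bar>F (b i) - F (a i)\<bar>) < e" .
  qed
qed

lemma antiderivative_real_ex:
  fixes f :: "real \<Rightarrow> real"
  assumes "continuous_on UNIV f"
  shows "\<exists>F. \<forall>x. (F has_real_derivative f x) (at x)"
proof -
  have "\<exists>F. \<forall>x::real. (-\<infinity>::ereal) < ereal x \<longrightarrow> ereal x < \<infinity> \<longrightarrow> (F has_vector_derivative f x) (at x)"
    by (rule einterval_antiderivative) (use assms in \<open>auto simp: continuous_on_eq_continuous_at\<close>)
  then show ?thesis by (simp add: has_real_derivative_iff_has_vector_derivative)
qed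

lemma integral_le_AE:
  fixes h k :: "real \<Rightarrow> real"
  assumes "h integrable_on {a..b}" "k integrable_on {a..b}" "{a..b} \<subseteq> {0..T}"
    and "AE t in lebesgue_on {0..T}. t \<in> {a..b} \<longrightarrow> h t \<le> k t"
  shows "integral {a..b} h \<le> integral {a..b} k"
proof -
  obtain N where N: "negligible N" "\<And>t. t \<in> {0..T} - N \<Longrightarrow> t \<in> {a..b} \<Longrightarrow> h t \<le> k t"
    using assms(4) by (subst (asm) AE_lebesgue_on_iff_negligible) auto
  define k' where "k' t = (if t \<in> N then max (h t) (k t) else k t)" for t
  have eq: "integral {a..b} k' = integral {a..b} k"
    by (rule integral_spike[OF N(1)]) (simp add: k'_def)
  have "k' integrable_on {a..b}"
    by (rule integrable_spike[OF assms(2) N(1)]) (simp add: k'_def)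
  moreover have "h t \<le> k' t" if "t \<in> {a..b}" for t
    using N(2)[of t] that assms(3) by (auto simp: k'_def)
  ultimately have "integral {a..b} h \<le> integral {a..b} k'" by (intro integral_le assms(1))
  with eq show ?thesis by simp
qed

lemma C1_chain:
  assumes "C1_with_deriv T u v" "\<And>x. (W has_real_derivative w x) (at x)" "t \<in> {0..T}"
  shows "((\<lambda>t. W (u t)) has_real_derivative w (u t) * v t) (at t within {0..T})"
proof -
  have "(u has_real_derivative v t) (at t within {0..T})" using assms by (simp add: C1_with_deriv_def)
  moreover have "(W has_real_derivative w (u t)) (at (u t) within u ` {0..T})"
    using assms(2) by (rule has_field_derivative_at_within)
  ultimately show ?thesis using DERIV_image_chain by (simp add: o_def)
qed

lemma C1_continuous:
  assumes "C1_with_deriv T u v" shows "continuous_on {0..T} u" "continuous_on {0..T} v"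
  using assms unfolding C1_with_deriv_def by (auto intro: DERIV_continuous_on)

lemma C1_integral:
  assumes "C1_with_deriv T u v" "\<And>x. (W has_real_derivative w x) (at x)" "0 \<le> a" "a \<le> b" "b \<le> T"
  shows "((\<lambda>t. w (u t) * v t) has_integral W (u b) - W (u a)) {a..b}"
proof (rule fundamental_theorem_of_calculus[OF assms(4)])
  fix t assume "t \<in> {a..b}"
  then have "t \<in> {0..T}" using assms by auto
  from C1_chain[OF assms(1,2) this]
  show "((\<lambda>t. W (u t)) has_vector_derivative w (u t) * v t) (at t within {a..b})"
    unfolding has_real_derivative_iff_has_vector_derivative
    by (rule has_vector_derivative_within_subset) (use assms in auto)
qed

text \<open>With \<open>W' = a - F\<close> the term \<open>v t * (a - F (u t))\<close> is the
  derivative of \<open>W (u t)\<close> and integrates to zero over a period. Moving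
  \<open>K * |v t|\<close> to the left leaves \<open>|v t|\<close> with coefficient 1, so
  \<open>(K + 1) * V * T\<close> bounds the total variation of \<open>u\<close>.\<close>

lemma oscillation_bound:
  assumes C1: "C1_with_deriv T u v" and per: "u 0 = u T" and T: "0 < T"
    and F: "continuous_on UNIV F" and K: "0 \<le> K" and V: "0 \<le> V"
    and ineq: "\<And>t. t \<in> {0..T} \<Longrightarrow> (K + 1) * (\<bar>v t\<bar> - V) \<le> v t * (a - F (u t)) + K * \<bar>v t\<bar>"
    and xy: "x \<in> {0..T}" "y \<in> {0..T}"
  shows "\<bar>u x - u y\<bar> \<le> (K + 1) * V * T"
proof -
  have "continuous_on UNIV (\<lambda>x. a - F x)" using F by (intro continuous_intros)
  from antiderivative_real_ex[OF this] obtain W where W: "\<And>x. (W has_real_derivative a - F x) (at x)" by blast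
  have I: "((\<lambda>t. (a - F (u t)) * v t) has_integral W (u T) - W (u 0)) {0..T}"
    by (rule C1_integral[OF C1 W]) (use T in auto)
  have vi: "v integrable_on {p..q}" "(\<lambda>t. \<bar>v t\<bar>) integrable_on {p..q}" if "0 \<le> p" "q \<le> T" for p q
  proof -
    have "continuous_on {p..q} v" by (rule continuous_on_subset[OF C1_continuous(2)[OF C1]]) (use that in auto)
    then show "v integrable_on {p..q}" "(\<lambda>t. \<bar>v t\<bar>) integrable_on {p..q}"
      by (auto intro!: integrable_continuous_real continuous_intros)
  qed
  have "integral {0..T} (\<lambda>t. \<bar>v t\<bar>) \<le> (K + 1) * V * T"
  proof (rule has_integral_le[OF integrable_integral[OF vi(2)]])
    show "((\<lambda>t. (K + 1) * V + (a - F (u t)) * v t) has_integral (K + 1) * V * T) {0..T}"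
      using has_integral_add[OF has_integral_const_real[of "(K + 1) * V" 0 T] I] per T by (simp add: mult.commute)
    show "\<bar>v t\<bar> \<le> (K + 1) * V + (a - F (u t)) * v t" if "t \<in> {0..T}" for t
      using ineq[OF that] by (simp add: algebra_simps)
  qed auto
  moreover have "\<bar>u q - u p\<bar> \<le> integral {0..T} (\<lambda>t. \<bar>v t\<bar>)" if "0 \<le> p" "p \<le> q" "q \<le> T" for p q
  proof -
    have "(v has_integral u q - u p) {p..q}"
      using C1_integral[OF C1, of "\<lambda>x. x" "\<lambda>_. 1" p q] that by (auto intro!: derivative_eq_intros)
    then have "\<bar>u q - u p\<bar> = \<bar>integral {p..q} v\<bar>" by (simp add: integral_unique)
    also have "\<dots> \<le> integral {p..q} (\<lambda>t. \<bar>v t\<bar>)"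
      using integral_norm_bound_integral[OF vi(1)[of p q] vi(2)[of p q]] that by simp
    also have "\<dots> \<le> integral {0..T} (\<lambda>t. \<bar>v t\<bar>)"
      by (rule integral_subset_le) (use that vi in auto)
    finally show ?thesis .
  qed
  note osc = this
  have "\<bar>u x - u y\<bar> \<le> integral {0..T} (\<lambda>t. \<bar>v t\<bar>)"
  proof (cases "x \<le> y")
    case True
    then show ?thesis using osc[of x y] xy by (simp add: abs_minus_commute)
  next
    case False
    then show ?thesis using osc[of y x] xy by simp
  qed
  ultimately show ?thesis by linarith
qed

text \<open>The integral over \<open>{0..t}\<close> is minus the integral over
  \<open>{t..T}\<close>, and both are at most the integral of \<beta>.\<close>

lemma primitive_bound:
  fixes q \<beta> :: "real \<Rightarrow> real"
  assumes q: "q integrable_on {0..T}" "integral {0..T} q = 0" and \<beta>: "\<beta> integrable_on {0..T}"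
    and le: "\<And>t. t \<in> {0..T} \<Longrightarrow> q t \<le> \<beta> t" "\<And>t. t \<in> {0..T} \<Longrightarrow> 0 \<le> \<beta> t" and t: "t \<in> {0..T}"
  shows "\<bar>integral {0..t} q\<bar> \<le> integral {0..T} \<beta>"
proof -
  have sub: "h integrable_on {a..b}" if "h integrable_on {0..T}" "0 \<le> a" "b \<le> T" for h :: "real \<Rightarrow> real" and a b
    by (rule integrable_subinterval_real[OF that(1)]) (use that in auto)
  have b: "integral {a..b} q \<le> integral {0..T} \<beta>" if "0 \<le> a" "b \<le> T" for a b
  proof -
    have "integral {a..b} q \<le> integral {a..b} \<beta>"
      by (rule integral_le) (use that q \<beta> le sub in auto)
    also have "\<dots> \<le> integral {0..T} \<beta>"
      by (rule integral_subset_le) (use that \<beta> le sub in auto)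
    finally show ?thesis .
  qed
  have "integral {0..t} q + integral {t..T} q = 0"
    using Henstock_Kurzweil_Integration.integral_combine[of 0 t T q] t q by auto
  with b[of 0 t] b[of t T] t show ?thesis by auto
qed

text \<open>Rounding \<open>u\<close> down to multiples of \<open>1 / Suc n\<close> makes it
  countably valued, so that countably many sections of \<open>g\<close> are glued together;
  continuity of \<open>g t\<close> then passes to the limit.\<close>

lemma measurable_superposition:
  assumes g: "caratheodory T g" and u: "continuous_on {0..T} u"
  shows "(\<lambda>t. g t (u t)) \<in> borel_measurable (lebesgue_on {0..T})"
proof (rule borel_measurable_LIMSEQ_real)
  define a where "a n t = real_of_int \<lfloor>real (Suc n) * u t\<rfloor> / real (Suc n)" for n t
  have um: "u \<in> borel_measurable (lebesgue_on {0..T})"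
    by (rule continuous_imp_measurable_on_sets_lebesgue[OF u]) auto
  show "(\<lambda>n. g t (a n t)) \<longlonglongrightarrow> g t (u t)" if "t \<in> space (lebesgue_on {0..T})" for t
  proof -
    have t: "t \<in> {0..T}" using that by simp
    have "(\<lambda>n. a n t) \<longlonglongrightarrow> u t"
    proof (rule real_tendsto_sandwich)
      show "\<forall>\<^sub>F n in sequentially. u t - 1 / real (Suc n) \<le> a n t"
      proof (intro always_eventually allI)
        fix n
        have "real (Suc n) * u t - 1 \<le> real_of_int \<lfloor>real (Suc n) * u t\<rfloor>" by linarith
        then have "(real (Suc n) * u t - 1) / real (Suc n) \<le> a n t"
          unfolding a_def by (intro divide_right_mono) auto
        then show "u t - 1 / real (Suc n) \<le> a n t" by (simp add: diff_divide_distrib)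
      qed
      show "\<forall>\<^sub>F n in sequentially. a n t \<le> u t"
        unfolding a_def by (intro always_eventually allI) (simp add: divide_le_eq mult.commute)
      show "(\<lambda>n. u t - 1 / real (Suc n)) \<longlonglongrightarrow> u t"
        using tendsto_diff[OF tendsto_const LIMSEQ_Suc[OF lim_1_over_n], of "u t"] by simp
    qed auto
    moreover have "isCont (g t) (u t)"
      using g t by (auto simp: caratheodory_def continuous_on_eq_continuous_at)
    ultimately show ?thesis by (rule isCont_tendsto_compose[rotated])
  qed
  show "(\<lambda>t. g t (a n t)) \<in> borel_measurable (lebesgue_on {0..T})" for n
  proof -
    have "(\<lambda>t. g t (real_of_int (\<lfloor>real (Suc n) * u t\<rfloor>) / real (Suc n))) \<in> borel_measurable (lebesgue_on {0..T})"
    proof (rule measurable_compose_countable[where f="\<lambda>i t. g t (real_of_int i / real (Suc n))"])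
      show "(\<lambda>t. g t (real_of_int i / real (Suc n))) \<in> borel_measurable (lebesgue_on {0..T})" for i
        using g by (simp add: caratheodory_def)
      show "(\<lambda>t. \<lfloor>real (Suc n) * u t\<rfloor>) \<in> lebesgue_on {0..T} \<rightarrow>\<^sub>M count_space UNIV"
        using um by measurable
    qed
    then show ?thesis by (simp add: a_def)
  qed
qed

lemma integrable_superposition:
  assumes g: "caratheodory T g" and u: "continuous_on {0..T} u"
  shows "(\<lambda>t. g t (u t)) absolutely_integrable_on {0..T}"
proof -
  have "bounded (u ` {0..T})" by (intro compact_imp_bounded compact_continuous_image u) auto
  then obtain r where r: "0 < r" "\<forall>x\<in>u ` {0..T}. norm x \<le> r" unfolding bounded_pos by (elim exE conjE)
  from r(1) g have "\<exists>h. integrable (lebesgue_on {0..T}) h \<and> (\<forall>t\<in>{0..T}. \<forall>x. \<bar>x\<bar> \<le> r \<longrightarrow> \<bar>g t x\<bar> \<le> h t)"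
    unfolding caratheodory_def by simp
  then obtain h where h: "integrable (lebesgue_on {0..T}) h" "\<forall>t\<in>{0..T}. \<forall>x. \<bar>x\<bar> \<le> r \<longrightarrow> \<bar>g t x\<bar> \<le> h t"
    by (elim exE conjE)
  show ?thesis
  proof (rule measurable_bounded_by_integrable_imp_absolutely_integrable[OF measurable_superposition[OF g u]])
    show "h integrable_on {0..T}" by (rule integrable_on_lebesgue_on[OF h(1)]) auto
  qed (use h(2) r(2) in auto)
qed

lemma continuous_Inf_attained:
  fixes h :: "real \<Rightarrow> real"
  assumes "continuous_on {0..T} h" "0 \<le> T"
  shows "\<exists>t\<in>{0..T}. h t = Inf (h ` {0..T})" "t \<in> {0..T} \<Longrightarrow> Inf (h ` {0..T}) \<le> h t"
proof -
  have ne: "{0..T} \<noteq> {}" using assms(2) by simp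
  obtain t0 where t0: "t0 \<in> {0..T}" "\<forall>t\<in>{0..T}. h t0 \<le> h t"
    using continuous_attains_inf[OF compact_Icc ne assms(1)] by blast
  have eq: "Inf (h ` {0..T}) = h t0"
    by (rule cInf_eq_minimum) (use t0 in auto)
  show "\<exists>t\<in>{0..T}. h t = Inf (h ` {0..T})" using t0(1) unfolding eq by blast
  show "t \<in> {0..T} \<Longrightarrow> Inf (h ` {0..T}) \<le> h t" using t0(2) unfolding eq by blast
qed

lemma Inf_dist_le:
  fixes h k :: "real \<Rightarrow> real"
  assumes "continuous_on {0..T} h" "continuous_on {0..T} k" "0 \<le> T" "\<And>t. t \<in> {0..T} \<Longrightarrow> \<bar>h t - k t\<bar> \<le> e"
  shows "\<bar>Inf (h ` {0..T}) - Inf (k ` {0..T})\<bar> \<le> e"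
proof -
  obtain t1 t2 where t: "t1 \<in> {0..T}" "h t1 = Inf (h ` {0..T})" "t2 \<in> {0..T}" "k t2 = Inf (k ` {0..T})"
    using continuous_Inf_attained(1)[OF assms(1,3)] continuous_Inf_attained(1)[OF assms(2,3)] by blast
  have "Inf (h ` {0..T}) \<le> h t2" "Inf (k ` {0..T}) \<le> k t1"
    by (rule continuous_Inf_attained(2)[OF assms(1,3) t(3)], rule continuous_Inf_attained(2)[OF assms(2,3) t(1)])
  with assms(4)[OF t(1)] assms(4)[OF t(3)] t(2,4) show ?thesis by linarith
qed

lemma continuous_bounded_Icc:
  fixes h :: "real \<Rightarrow> real"
  assumes "continuous_on {a..b} h"
  shows "\<exists>M>0. \<forall>t\<in>{a..b}. \<bar>h t\<bar> \<le> M"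
proof -
  have "bounded (h ` {a..b})" by (intro compact_imp_bounded compact_continuous_image assms) auto
  then show ?thesis by (auto simp: bounded_pos)
qed

text \<open>A fixed point of a clamped update can have a nonzero step \<open>y\<close> only at the
  end toward which the step points. Used for the integration constant with step
  \<open>- N \<tau> a z T\<close> and for the path parameter with step \<open>m - s\<close>.\<close>

lemma clamp_eq:
  fixes x y l r :: real
  assumes "x = max l (min r (x + y))" "l < r"
  shows "y < 0 \<Longrightarrow> x = l" "0 < y \<Longrightarrow> x = r"
  using assms by (auto simp: max_def min_def split: if_splits)

section \<open>Integrated form of the periodic problem\<close>

text \<open>The data in convenient form: an inverse \<psi> of \<phi>, a primitive \<open>F\<close>
  of \<open>f\<close>, and an upper bound for \<open>g\<close> valid at every time of
  \<open>{0..T}\<close>. Conditions about levels (sub-solutions, \<open>H3_cond\<close>,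
  \<open>H4_cond\<close>) stay outside and are supplied lemma by lemma.\<close>

locale phi_laplace =
  fixes T :: real and \<phi> \<psi> f F :: "real \<Rightarrow> real" and g :: "real \<Rightarrow> real \<Rightarrow> real" and \<gamma> :: "real \<Rightarrow> real"
  assumes T_pos: "0 < T"
    and phi_strict: "\<And>x y. x < y \<Longrightarrow> \<phi> x < \<phi> y"
    and psi_phi: "\<And>x. \<psi> (\<phi> x) = x" and phi_psi: "\<And>x. \<phi> (\<psi> x) = x"
    and psi_cont: "continuous_on UNIV \<psi>" and psi0: "\<psi> 0 = 0"
    and F_deriv: "\<And>x. (F has_real_derivative f x) (at x)" and f_cont: "continuous_on UNIV f"
    and car: "caratheodory T g"
    and H0: "\<And>t0 x0 \<epsilon>. t0 \<in> {0..T} \<Longrightarrow> 0 < \<epsilon> \<Longrightarrow> \<exists>\<delta>>0. AE t in lebesgue_on {0..T}.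
               \<forall>x. \<bar>t - t0\<bar> < \<delta> \<and> \<bar>x - x0\<bar> < \<delta> \<longrightarrow> \<bar>g t x - g t x0\<bar> < \<epsilon>"
    and \<gamma>_int: "\<gamma> integrable_on {0..T}" and \<gamma>_nonneg: "\<And>t. t \<in> {0..T} \<Longrightarrow> 0 \<le> \<gamma> t"
    and g_le: "\<And>t x. t \<in> {0..T} \<Longrightarrow> g t x \<le> \<gamma> t"
begin

text \<open>The equation integrated once, with \<open>v\<close> in the role of the derivative of
  \<open>u\<close>. It mentions no almost everywhere derivative and so survives pointwise limits;
  \<open>h\<close> is a parameter because the deformed nonlinearity is used as well.\<close>

definition isol :: "(real \<Rightarrow> real \<Rightarrow> real) \<Rightarrow> real \<Rightarrow> (real \<Rightarrow> real) \<Rightarrow> (real \<Rightarrow> real) \<Rightarrow> bool" where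
  "isol h m u v \<longleftrightarrow> C1_with_deriv T u v \<and> u 0 = u T \<and> v 0 = v T \<and>
     (\<forall>t\<in>{0..T}. \<phi> (v t) + F (u t) = \<phi> (v 0) + F (u 0) + integral {0..t} (\<lambda>\<tau>. m - h \<tau> (u \<tau>)))"

text \<open>A lower solution: formally \<open>(\<phi>(u'))' + f(u) u' + g(t,u) \<ge> s\<close>.
  Being an inequality, it has to be required on every subinterval and not just from 0.\<close>

definition sub_sol :: "real \<Rightarrow> (real \<Rightarrow> real) \<Rightarrow> (real \<Rightarrow> real) \<Rightarrow> bool" where
  "sub_sol s u v \<longleftrightarrow> C1_with_deriv T u v \<and> u 0 = u T \<and> v 0 = v T \<and>
     (\<forall>t t'. 0 \<le> t \<longrightarrow> t \<le> t' \<longrightarrow> t' \<le> T \<longrightarrow>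
        integral {t..t'} (\<lambda>\<tau>. s - g \<tau> (u \<tau>)) \<le> \<phi> (v t') + F (u t') - (\<phi> (v t) + F (u t)))"

definition super_sol :: "real \<Rightarrow> (real \<Rightarrow> real) \<Rightarrow> (real \<Rightarrow> real) \<Rightarrow> bool" where
  "super_sol s u v \<longleftrightarrow> C1_with_deriv T u v \<and> u 0 = u T \<and> v 0 = v T \<and>
     (\<forall>t t'. 0 \<le> t \<longrightarrow> t \<le> t' \<longrightarrow> t' \<le> T \<longrightarrow>
        \<phi> (v t') + F (u t') - (\<phi> (v t) + F (u t)) \<le> integral {t..t'} (\<lambda>\<tau>. s - g \<tau> (u \<tau>)))"

lemma F_cont: "continuous_on UNIV F"
  using F_deriv by (auto intro: DERIV_continuous_on has_field_derivative_at_within)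

lemma psi_strict: "x < y \<Longrightarrow> \<psi> x < \<psi> y"
  by (metis phi_psi phi_strict not_less_iff_gr_or_eq)

lemma superposition_abs_integrable:
  assumes "caratheodory T h" "continuous_on {0..T} u"
  shows "(\<lambda>\<tau>. m - h \<tau> (u \<tau>)) absolutely_integrable_on {0..T}"
  by (intro set_integral_diff absolutely_integrable_on_const integrable_superposition[OF assms]) auto

lemma superposition_integrable:
  assumes "caratheodory T h" "continuous_on {0..T} u" "0 \<le> a" "b \<le> T"
  shows "(\<lambda>\<tau>. m - h \<tau> (u \<tau>)) integrable_on {a..b}" "(\<lambda>\<tau>. h \<tau> (u \<tau>)) integrable_on {a..b}"
proof -
  have "(\<lambda>\<tau>. m - h \<tau> (u \<tau>)) integrable_on {0..T}" "(\<lambda>\<tau>. h \<tau> (u \<tau>)) integrable_on {0..T}"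
    using superposition_abs_integrable[OF assms(1,2)] integrable_superposition[OF assms(1,2)]
    by (auto simp: absolutely_integrable_on_def)
  then show "(\<lambda>\<tau>. m - h \<tau> (u \<tau>)) integrable_on {a..b}" "(\<lambda>\<tau>. h \<tau> (u \<tau>)) integrable_on {a..b}"
    using assms(3,4) by (auto intro: integrable_subinterval_real)
qed

lemma isolD:
  assumes "isol h m u v"
  shows "C1_with_deriv T u v" "u 0 = u T" "v 0 = v T"
    "t \<in> {0..T} \<Longrightarrow> \<phi> (v t) + F (u t) = \<phi> (v 0) + F (u 0) + integral {0..t} (\<lambda>\<tau>. m - h \<tau> (u \<tau>))"
proof -
  note * = assms[unfolded isol_def]
  from * show "C1_with_deriv T u v" by (rule conjunct1)
  from * show "u 0 = u T" by (rule conjunct1[OF conjunct2])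
  from * show "v 0 = v T" by (rule conjunct1[OF conjunct2[OF conjunct2]])
  from * show "t \<in> {0..T} \<Longrightarrow> \<phi> (v t) + F (u t) = \<phi> (v 0) + F (u 0) + integral {0..t} (\<lambda>\<tau>. m - h \<tau> (u \<tau>))"
    by (rule bspec[OF conjunct2[OF conjunct2[OF conjunct2]]])
qed

lemma isol_increment:
  assumes "isol h m u v" "caratheodory T h" "0 \<le> t" "t \<le> t'" "t' \<le> T"
  shows "\<phi> (v t') + F (u t') - (\<phi> (v t) + F (u t)) = integral {t..t'} (\<lambda>\<tau>. m - h \<tau> (u \<tau>))"
proof -
  have "C1_with_deriv T u v" using assms(1) by (rule isolD)
  from superposition_integrable(1)[OF assms(2) C1_continuous(1)[OF this], of 0 t'] assms(5)
  have "(\<lambda>\<tau>. m - h \<tau> (u \<tau>)) integrable_on {0..t'}" by simp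
  note Henstock_Kurzweil_Integration.integral_combine[OF assms(3,4) this]
  moreover have "\<phi> (v x) + F (u x) = \<phi> (v 0) + F (u 0) + integral {0..x} (\<lambda>\<tau>. m - h \<tau> (u \<tau>))"
    if "x \<in> {0..T}" for x by (rule isolD(4)[OF assms(1) that])
  from this[of t] this[of t'] have "\<phi> (v t) + F (u t) = \<phi> (v 0) + F (u 0) + integral {0..t} (\<lambda>\<tau>. m - h \<tau> (u \<tau>))"
    "\<phi> (v t') + F (u t') = \<phi> (v 0) + F (u 0) + integral {0..t'} (\<lambda>\<tau>. m - h \<tau> (u \<tau>))"
    using assms(3-5) by auto
  ultimately show ?thesis by linarith
qed

lemma isol_mean:
  assumes "isol h m u v" "caratheodory T h"
  shows "integral {0..T} (\<lambda>\<tau>. h \<tau> (u \<tau>)) = m * T"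
proof -
  have C: "C1_with_deriv T u v" "u 0 = u T" "v 0 = v T" by (rule isolD[OF assms(1)])+
  have "integral {0..T} (\<lambda>\<tau>. m - h \<tau> (u \<tau>)) = 0"
    using isol_increment[OF assms, of 0 T] T_pos C by simp
  then show ?thesis
    using superposition_integrable(2)[OF assms(2) C1_continuous(1)[OF C(1)], of 0 T] T_pos
    by (subst (asm) integral_diff) (auto simp: mult.commute)
qed

lemma isol_sub_sol:
  assumes "isol g s u v"
  shows "sub_sol s u v"
  unfolding sub_sol_def
proof (intro conjI allI impI isolD[OF assms])
  fix t t' assume "0 \<le> t" "t \<le> t'" "t' \<le> T"
  from isol_increment[OF assms car this]
  show "integral {t..t'} (\<lambda>\<tau>. s - g \<tau> (u \<tau>)) \<le> \<phi> (v t') + F (u t') - (\<phi> (v t) + F (u t))" by simp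
qed

text \<open>As \<open>f (u t) * v t\<close> is the derivative of \<open>F (u t)\<close>, the
  integrated equation makes \<open>\<phi> (v t)\<close> a constant plus the indefinite integral of
  \<open>q\<close>; such integrals are absolutely continuous and differentiable almost
  everywhere.\<close>

lemma isol_imp_periodic_solution:
  assumes "isol g s u v"
  shows "periodic_solution T \<phi> f g s u"
proof -
  have C: "C1_with_deriv T u v" "u 0 = u T" "v 0 = v T" by (rule isolD[OF assms])+
  note uc = C1_continuous[OF C(1)]
  define q where "q t = (s - g t (u t)) - f (u t) * v t" for t
  have fv: "continuous_on {0..T} (\<lambda>t. f (u t) * v t)"
    by (intro continuous_intros continuous_on_compose2[OF f_cont uc(1)] uc(2)) auto
  have qa: "q absolutely_integrable_on {0..T}"
    unfolding q_def by (intro set_integral_diff(1) superposition_abs_integrable[OF car uc(1)]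
        absolutely_integrable_continuous_real fv)
  then have qi: "q integrable_on {0..T}" by (simp add: absolutely_integrable_on_def)
  have eq: "\<phi> (v t) = \<phi> (v 0) + integral {0..t} q" if t: "t \<in> {0..T}" for t
  proof -
    have I: "((\<lambda>t. f (u t) * v t) has_integral F (u t) - F (u 0)) {0..t}"
      by (rule C1_integral[OF C(1) F_deriv]) (use t in auto)
    have "integral {0..t} q = integral {0..t} (\<lambda>\<tau>. s - g \<tau> (u \<tau>)) - (F (u t) - F (u 0))"
      unfolding q_def using I superposition_integrable(1)[OF car uc(1), of 0 t s] t
      by (subst integral_diff) (auto simp: integral_unique)
    moreover have "\<phi> (v t) + F (u t) = \<phi> (v 0) + F (u 0) + integral {0..t} (\<lambda>\<tau>. s - g \<tau> (u \<tau>))"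
      by (rule isolD(4)[OF assms t])
    ultimately show ?thesis by linarith
  qed
  from lebesgue_differentiation_real[OF qi] obtain N where N: "negligible N"
    "\<forall>t\<in>{0..T} - N. ((\<lambda>t. integral {0..t} q) has_real_derivative q t) (at t within {0..T})"
    by (elim exE conjE)
  have "\<phi> (v y) - \<phi> (v x) = integral {0..y} q - integral {0..x} q" if "x \<in> {0..T}" "y \<in> {0..T}" for x y
    using eq[OF that(1)] eq[OF that(2)] by linarith
  then have "abs_cont_on {0..T} (\<lambda>t. \<phi> (v t))"
    by (rule abs_cont_on_increments[OF abs_cont_on_indefinite_integral[OF qa] order_refl])
  moreover have "AE t in lebesgue_on {0..T}. \<exists>w. ((\<lambda>t. \<phi> (v t)) has_real_derivative w) (at t within {0..T}) \<and>
               w + f (u t) * v t + g t (u t) = s"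
  proof (subst AE_lebesgue_on_iff_negligible, simp, intro exI[of _ N] conjI ballI N(1))
    fix t assume t: "t \<in> {0..T} - N"
    have "((\<lambda>t. \<phi> (v 0) + integral {0..t} q) has_real_derivative q t) (at t within {0..T})"
      using N(2) t by (auto intro!: derivative_eq_intros)
    then have "((\<lambda>t. \<phi> (v t)) has_real_derivative q t) (at t within {0..T})"
    proof (rule has_field_derivative_transform_within[OF _ zero_less_one])
      show "t \<in> {0..T}" using t by simp
      show "\<phi> (v 0) + integral {0..x} q = \<phi> (v x)" if "x \<in> {0..T}" for x
        by (rule eq[OF that, symmetric])
    qed
    then show "\<exists>w. ((\<lambda>t. \<phi> (v t)) has_real_derivative w) (at t within {0..T}) \<and> w + f (u t) * v t + g t (u t) = s"
      by (intro exI[of _ "q t"]) (auto simp: q_def)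
  qed
  ultimately show ?thesis unfolding periodic_solution_def using C by (intro exI conjI)
qed

lemma periodic_solution_imp_isol:
  assumes "periodic_solution T \<phi> f g s u"
  shows "\<exists>v. isol g s u v"
proof -
  obtain v where C: "C1_with_deriv T u v" "u 0 = u T" "v 0 = v T" and ac: "abs_cont_on {0..T} (\<lambda>t. \<phi> (v t))"
    and ae: "AE t in lebesgue_on {0..T}. \<exists>w. ((\<lambda>t. \<phi> (v t)) has_real_derivative w) (at t within {0..T}) \<and>
               w + f (u t) * v t + g t (u t) = s"
    using assms unfolding periodic_solution_def by (elim exE conjE)
  define q where "q t = (s - g t (u t)) - f (u t) * v t" for t
  have "{0..T} \<in> sets lebesgue" by simp
  from iffD1[OF AE_lebesgue_on_iff_negligible[OF this] ae]
  obtain N where N: "negligible N" "\<forall>t\<in>{0..T} - N. \<exists>w. ((\<lambda>t. \<phi> (v t)) has_real_derivative w) (at t within {0..T}) \<and>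
               w + f (u t) * v t + g t (u t) = s"
    by (elim exE conjE)
  have der: "((\<lambda>t. \<phi> (v t)) has_real_derivative q t) (at t within {0..T})" if t: "t \<in> {0..T} - N" for t
  proof -
    from bspec[OF N(2) t] obtain w where "((\<lambda>t. \<phi> (v t)) has_real_derivative w) (at t within {0..T})"
      "w + f (u t) * v t + g t (u t) = s" by (elim exE conjE)
    moreover from this(2) have "w = q t" by (simp add: q_def)
    ultimately show ?thesis by simp
  qed
  have "\<phi> (v t) + F (u t) = \<phi> (v 0) + F (u 0) + integral {0..t} (\<lambda>\<tau>. s - g \<tau> (u \<tau>))" if t: "t \<in> {0..T}" for t
  proof (cases "t = 0")
    case False
    have sub: "{0..t} \<subseteq> {0..T}" using t by auto
    have "(q has_integral \<phi> (v t) - \<phi> (v 0)) {0..t}"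
    proof (rule abs_cont_has_integral[OF _ abs_cont_on_increments[OF ac sub refl] N(1)])
      show "0 < t" using t False by simp
      show "((\<lambda>t. \<phi> (v t)) has_real_derivative q \<tau>) (at \<tau> within {0..t})" if "\<tau> \<in> {0..t} - N" for \<tau>
        by (rule DERIV_subset[OF der sub]) (use that t in auto)
    qed
    moreover have "((\<lambda>t. f (u t) * v t) has_integral F (u t) - F (u 0)) {0..t}"
      by (rule C1_integral[OF C(1) F_deriv]) (use t in auto)
    ultimately have "((\<lambda>\<tau>. q \<tau> + f (u \<tau>) * v \<tau>) has_integral (\<phi> (v t) - \<phi> (v 0)) + (F (u t) - F (u 0))) {0..t}"
      by (rule has_integral_add)
    then have "((\<lambda>\<tau>. s - g \<tau> (u \<tau>)) has_integral (\<phi> (v t) - \<phi> (v 0)) + (F (u t) - F (u 0))) {0..t}"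
      by (simp add: q_def)
    from integral_unique[OF this] show ?thesis by simp
  qed simp
  with C have "isol g s u v" unfolding isol_def by blast
  then show ?thesis by blast
qed

text \<open>Right of a contact point, (H0) and the gap \<^term>\<open>s1 - s\<close> make \<^term>\<open>\<phi> (v t) + F (u t)\<close> fall
  linearly below its counterpart for \<^term>\<open>\<alpha>\<close>, whereas \<^term>\<open>F (u t) - F (\<alpha> t)\<close> is of smaller order;
  hence \<^term>\<open>u\<close> would cross \<^term>\<open>\<alpha>\<close>.\<close>

lemma no_contact:
  assumes sub: "sub_sol s1 \<alpha> \<alpha>'" and super: "super_sol s u v" and s: "s < s1"
    and ge: "\<And>t. t \<in> {0..T} \<Longrightarrow> \<alpha> t \<le> u t"
    and t0: "t0 \<in> {0..T}"
  shows "u t0 \<noteq> \<alpha> t0"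
proof
  assume touch: "u t0 = \<alpha> t0"
  have Cu: "C1_with_deriv T u v" "u 0 = u T" "v 0 = v T" using super by (auto simp: super_sol_def)
  have Ca: "C1_with_deriv T \<alpha> \<alpha>'" "\<alpha> 0 = \<alpha> T" "\<alpha>' 0 = \<alpha>' T" using sub by (auto simp: sub_sol_def)
  define y where "y t = u t - \<alpha> t" for t
  define w where "w t = v t - \<alpha>' t" for t
  have y: "(y has_real_derivative w t) (at t within {0..T})" if "t \<in> {0..T}" for t
    unfolding y_def w_def using Cu(1) Ca(1) that by (auto simp: C1_with_deriv_def intro!: derivative_eq_intros)
  have y0: "0 \<le> y t" if "t \<in> {0..T}" for t using ge[OF that] by (simp add: y_def)
  \<comment> \<open>The comparison runs to the right, so a contact at \<open>T\<close> is carried to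
    0 by periodicity.\<close>
  obtain t1 where t1: "0 \<le> t1" "t1 < T" "y t1 = 0"
  proof (cases "t0 = T")
    case True
    then have "y 0 = 0" using touch Cu Ca by (simp add: y_def)
    with that[of 0] T_pos show thesis by simp
  next
    case False
    with that[of t0] t0 touch show thesis by (simp add: y_def)
  qed
  have right: "0 \<le> w t" if t: "t \<in> {0..T}" "t < T" "y t = 0" for t
  proof (rule ccontr)
    assume "\<not> 0 \<le> w t"
    then have "w t < 0" by simp
    from has_real_derivative_neg_dec_right[OF y[OF t(1)] this]
    obtain d where d: "0 < d" "\<forall>h>0. t + h \<in> {0..T} \<longrightarrow> h < d \<longrightarrow> y (t + h) < y t"
      by (elim exE conjE)
    define h where "h = min (d / 2) (T - t)"
    have h: "0 < h" "h < d" "t + h \<in> {0..T}" using d(1) t by (auto simp: h_def)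
    with d(2)[rule_format, of h] y0[of "t + h"] t(3) show False by simp
  qed
  have left: "w t \<le> 0" if t: "t \<in> {0..T}" "0 < t" "y t = 0" for t
  proof (rule ccontr)
    assume "\<not> w t \<le> 0"
    then have "0 < w t" by simp
    from has_real_derivative_pos_inc_left[OF y[OF t(1)] this]
    obtain d where d: "0 < d" "\<forall>h>0. t - h \<in> {0..T} \<longrightarrow> h < d \<longrightarrow> y (t - h) < y t"
      by (elim exE conjE)
    define h where "h = min (d / 2) t"
    have h: "0 < h" "h < d" "t - h \<in> {0..T}" using d(1) t by (auto simp: h_def)
    with d(2)[rule_format, of h] y0[of "t - h"] t(3) show False by simp
  qed
  have t1m: "t1 \<in> {0..T}" using t1 by simp
  \<comment> \<open>At an interior contact both one-sided signs apply; at 0 the missing left sign is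
    read off at \<open>T\<close>, where the velocities agree with those at 0.\<close>
  have w1: "w t1 = 0"
  proof (cases "t1 = 0")
    case True
    then have "y T = 0" using t1(3) Cu Ca by (simp add: y_def)
    then have "w T \<le> 0" using T_pos by (intro left) auto
    moreover have "w T = w 0" using Cu Ca by (simp add: w_def)
    ultimately show ?thesis using right[OF t1m t1(2,3)] True by simp
  next
    case False
    then show ?thesis using right[OF t1m t1(2,3)] left[OF t1m _ t1(3)] t1(1) by simp
  qed
  define x0 where "x0 = \<alpha> t1"
  have ut1: "u t1 = x0" using t1(3) by (simp add: y_def x0_def)
  \<comment> \<open>The gap \<open>s1 - s\<close> is \<open>2 * \<epsilon>\<close>; applying
    \<open>(H0)\<close> at \<open>u\<close> and at \<alpha> costs \<open>\<epsilon> / 2\<close>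
    each, leaving a decay rate \<epsilon>.\<close>
  define \<epsilon> where "\<epsilon> = (s1 - s) / 2"
  have \<epsilon>: "0 < \<epsilon>" using s by (simp add: \<epsilon>_def)
  then have "0 < \<epsilon> / 2" by simp
  from H0[OF t1m this, of x0] obtain \<delta> where \<delta>: "0 < \<delta>"
    and ae: "AE t in lebesgue_on {0..T}. \<forall>x. \<bar>t - t1\<bar> < \<delta> \<and> \<bar>x - x0\<bar> < \<delta> \<longrightarrow> \<bar>g t x - g t x0\<bar> < \<epsilon> / 2"
    by (elim exE conjE)
  define L where "L = \<bar>f x0\<bar> + 1"
  have "isCont f x0" using f_cont by (simp add: continuous_on_eq_continuous_at)
  from this[unfolded continuous_at_eps_delta dist_real_def, THEN spec, THEN mp, OF zero_less_one]
  obtain \<delta>3 where \<delta>3: "0 < \<delta>3" "\<forall>x. \<bar>x - x0\<bar> < \<delta>3 \<longrightarrow> \<bar>f x - f x0\<bar> < 1"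
    by (elim exE conjE)
  define r where "r = min \<delta> \<delta>3"
  have r: "0 < r" using \<delta> \<delta>3 by (simp add: r_def)
  have FL: "\<bar>F x - F x'\<bar> \<le> L * \<bar>x - x'\<bar>" if "x \<in> ball x0 r" "x' \<in> ball x0 r" for x x'
  proof -
    have "norm (F x - F x') \<le> L * norm (x - x')"
    proof (rule field_differentiable_bound[OF convex_ball _ _ that])
      fix z assume z: "z \<in> ball x0 r"
      show "(F has_real_derivative f z) (at z within ball x0 r)" using F_deriv by (rule has_field_derivative_at_within)
      have "\<bar>z - x0\<bar> < \<delta>3" using z by (simp add: r_def dist_real_def abs_minus_commute)
      then have "\<bar>f z - f x0\<bar> < 1" using \<delta>3(2) by blast
      then show "norm (f z) \<le> L" unfolding L_def real_norm_def by linarith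
    qed
    then show ?thesis by simp
  qed
  have near: "\<exists>d>0. \<forall>t\<in>{0..T}. \<bar>t - t1\<bar> < d \<longrightarrow> h t \<in> ball x0 r" if "continuous_on {0..T} h" "h t1 = x0" for h
  proof -
    from that(1)[unfolded continuous_on_iff, rule_format, OF t1m r]
    obtain d where "0 < d" "\<forall>t\<in>{0..T}. dist t t1 < d \<longrightarrow> dist (h t) (h t1) < r" by (elim exE conjE)
    then show ?thesis using that(2) by (intro exI[of _ d]) (auto simp: dist_commute dist_real_def abs_minus_commute)
  qed
  from near[OF C1_continuous(1)[OF Cu(1)] ut1] obtain d1 where d1: "0 < d1" "\<forall>t\<in>{0..T}. \<bar>t - t1\<bar> < d1 \<longrightarrow> u t \<in> ball x0 r"
    by (elim exE conjE)
  from near[OF C1_continuous(1)[OF Ca(1)] x0_def[symmetric]] obtain d2 where d2: "0 < d2" "\<forall>t\<in>{0..T}. \<bar>t - t1\<bar> < d2 \<longrightarrow> \<alpha> t \<in> ball x0 r"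
    by (elim exE conjE)
  have L: "0 < L" by (simp add: L_def)
  have "0 < \<epsilon> / (2 * L)" using \<epsilon> L by simp
  \<comment> \<open>Since \<open>w t1 = 0\<close>, this bounds \<open>u - \<alpha>\<close> by
    \<open>\<epsilon> / (2 * L)\<close> times the elapsed time, so the difference of the
    \<open>F\<close> terms uses up only half of the decay.\<close>
  from straddle_derivative[OF y[OF t1m] this] obtain d3 where d3: "0 < d3"
    "\<forall>a\<in>{0..T}. \<forall>b\<in>{0..T}. a \<le> t1 \<longrightarrow> t1 \<le> b \<longrightarrow> \<bar>a - t1\<bar> < d3 \<longrightarrow> \<bar>b - t1\<bar> < d3 \<longrightarrow>
     \<bar>y b - y a - w t1 * (b - a)\<bar> \<le> \<epsilon> / (2 * L) * (b - a)" by (elim exE conjE)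
  define \<rho> where "\<rho> = min (min (min d1 d2) (min d3 \<delta>)) (T - t1) / 2"
  have \<rho>: "0 < \<rho>" "\<rho> < d1" "\<rho> < d2" "\<rho> < d3" "\<rho> < \<delta>" "t1 + \<rho> < T"
  proof -
    define \<mu> where "\<mu> = min (min (min d1 d2) (min d3 \<delta>)) (T - t1)"
    have "0 < \<mu>" "\<mu> \<le> d1" "\<mu> \<le> d2" "\<mu> \<le> d3" "\<mu> \<le> \<delta>" "\<mu> \<le> T - t1"
      using d1(1) d2(1) d3(1) \<delta> t1(2) by (simp_all add: \<mu>_def)
    moreover have "\<rho> = \<mu> / 2" by (simp add: \<rho>_def \<mu>_def)
    ultimately show "0 < \<rho>" "\<rho> < d1" "\<rho> < d2" "\<rho> < d3" "\<rho> < \<delta>" "t1 + \<rho> < T" by linarith+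
  qed
  have neg: "w t < 0" if t: "t1 < t" "t < t1 + \<rho>" for t
  proof -
    have tm: "t \<in> {0..T}" using t t1 \<rho> by auto
    have ii: "(\<lambda>\<tau>. s - g \<tau> (u \<tau>)) integrable_on {t1..t}" "(\<lambda>\<tau>. s1 - g \<tau> (\<alpha> \<tau>)) integrable_on {t1..t}"
      by (rule superposition_integrable(1)[OF car]; use C1_continuous(1) Cu Ca t1 tm in auto)+
    have "integral {t1..t} (\<lambda>\<tau>. s - g \<tau> (u \<tau>)) \<le> integral {t1..t} (\<lambda>\<tau>. s1 - g \<tau> (\<alpha> \<tau>) - \<epsilon>)"
    proof (rule integral_le_AE)
      show "AE \<tau> in lebesgue_on {0..T}. \<tau> \<in> {t1..t} \<longrightarrow> s - g \<tau> (u \<tau>) \<le> s1 - g \<tau> (\<alpha> \<tau>) - \<epsilon>"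
        using ae
      proof eventually_elim
        case (elim \<tau>)
        show ?case
        proof
          assume \<tau>: "\<tau> \<in> {t1..t}"
          then have "\<tau> \<in> {0..T}" "\<bar>\<tau> - t1\<bar> < \<rho>" using t t1 \<rho> by auto
          then have "u \<tau> \<in> ball x0 r" "\<alpha> \<tau> \<in> ball x0 r" "\<bar>\<tau> - t1\<bar> < \<delta>" using d1 d2 \<rho> by auto
          then have "\<bar>u \<tau> - x0\<bar> < \<delta>" "\<bar>\<alpha> \<tau> - x0\<bar> < \<delta>" by (auto simp: r_def dist_real_def)
          then have "\<bar>g \<tau> (u \<tau>) - g \<tau> x0\<bar> < \<epsilon> / 2" "\<bar>g \<tau> (\<alpha> \<tau>) - g \<tau> x0\<bar> < \<epsilon> / 2"
            using elim \<open>\<bar>\<tau> - t1\<bar> < \<delta>\<close> by blast+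
          moreover have "2 * \<epsilon> = s1 - s" by (simp add: \<epsilon>_def)
          ultimately show "s - g \<tau> (u \<tau>) \<le> s1 - g \<tau> (\<alpha> \<tau>) - \<epsilon>" unfolding abs_less_iff by argo
        qed
      qed
    qed (use ii t1 tm in \<open>auto intro!: integrable_diff\<close>)
    also have "\<dots> = integral {t1..t} (\<lambda>\<tau>. s1 - g \<tau> (\<alpha> \<tau>)) - \<epsilon> * (t - t1)"
      using ii(2) t by (subst integral_diff) auto
    finally have I: "integral {t1..t} (\<lambda>\<tau>. s - g \<tau> (u \<tau>)) \<le> integral {t1..t} (\<lambda>\<tau>. s1 - g \<tau> (\<alpha> \<tau>)) - \<epsilon> * (t - t1)" .
    have A: "\<phi> (v t) + F (u t) - (\<phi> (v t1) + F (u t1)) \<le> integral {t1..t} (\<lambda>\<tau>. s - g \<tau> (u \<tau>))"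
      using super t1 t tm by (auto simp: super_sol_def)
    have B: "integral {t1..t} (\<lambda>\<tau>. s1 - g \<tau> (\<alpha> \<tau>)) \<le> \<phi> (\<alpha>' t) + F (\<alpha> t) - (\<phi> (\<alpha>' t1) + F (\<alpha> t1))"
      using sub t1 t tm by (auto simp: sub_sol_def)
    have eq: "v t1 = \<alpha>' t1" "u t1 = \<alpha> t1" using w1 t1(3) by (simp_all add: w_def y_def)
    have "u t \<in> ball x0 r" "\<alpha> t \<in> ball x0 r" using d1(2) d2(2) tm t \<rho> by auto
    from FL[OF this] have "F (\<alpha> t) - F (u t) \<le> L * \<bar>u t - \<alpha> t\<bar>" by linarith
    also have "L * \<bar>u t - \<alpha> t\<bar> \<le> L * (\<epsilon> / (2 * L) * (t - t1))"
    proof (rule mult_left_mono)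
      have "\<bar>y t - y t1 - w t1 * (t - t1)\<bar> \<le> \<epsilon> / (2 * L) * (t - t1)"
        by (rule d3(2)[rule_format]) (use t1 t tm \<rho> d3(1) in auto)
      then show "\<bar>u t - \<alpha> t\<bar> \<le> \<epsilon> / (2 * L) * (t - t1)" using w1 t1(3) by (simp add: y_def)
    qed (use L in simp)
    also have "\<dots> = \<epsilon> * (t - t1) / 2" using L by simp
    finally have C: "F (\<alpha> t) - F (u t) \<le> \<epsilon> * (t - t1) / 2" .
    have "0 < \<epsilon> * (t - t1)" using \<epsilon> t by simp
    with A B C I have "\<phi> (v t) < \<phi> (\<alpha>' t)" unfolding eq by linarith
    then have "v t < \<alpha>' t" using phi_strict[of "\<alpha>' t" "v t"] by (cases "v t" "\<alpha>' t" rule: linorder_cases) auto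
    then show ?thesis by (simp add: w_def)
  qed
  have "y (t1 + \<rho>) < y t1"
  proof (rule DERIV_neg_imp_decreasing_open[where f=y])
    fix t assume t: "t1 < t" "t < t1 + \<rho>"
    have "t \<in> {0<..<T}" using t t1 \<rho> by auto
    then have "at t within {0..T} = at t" by (intro at_within_interior) (simp add: interior_atLeastAtMost_real)
    then show "\<exists>l. (y has_real_derivative l) (at t) \<and> l < 0"
      using y[of t] neg[OF t] t t1 \<rho> by (intro exI[of _ "w t"]) auto
  next
    have "continuous_on {0..T} y" using y by (rule DERIV_continuous_on)
    then show "continuous_on {t1..t1 + \<rho>} y" by (rule continuous_on_subset) (use t1 \<rho> in auto)
  qed (use \<rho> in simp)
  then show False using y0[of "t1 + \<rho>"] t1 \<rho> by auto
qed

section \<open>A priori bounds\<close>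

text \<open>The family \<^term>\<open>gk \<kappa> s\<close> joins \<^term>\<open>g\<close> (at 1) to a nonlinearity of mean at least \<^term>\<open>s\<close> (at 0), scaling
  down only the part below \<^term>\<open>s\<close>; it stays above \<^term>\<open>g\<close>, so super-solutions for it are super-solutions
  for \<^term>\<open>g\<close>.\<close>

definition gk :: "real \<Rightarrow> real \<Rightarrow> real \<Rightarrow> real \<Rightarrow> real" where
  "gk \<kappa> s t x = max (g t x) (\<kappa> * g t x + (1 - \<kappa>) * s)"

lemma gk_one: "gk 1 s = g"
  by (simp add: gk_def[abs_def])

lemma gk_zero_ge: "s \<le> gk 0 s t x"
  by (simp add: gk_def)

lemma gk_ge: "g t x \<le> gk \<kappa> s t x"
  by (simp add: gk_def)

lemma gk_bounds:
  assumes "\<kappa> \<in> {0..1}"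
  shows "gk \<kappa> s t x \<le> max (g t x) s" "\<bar>gk \<kappa> s t x\<bar> \<le> \<bar>g t x\<bar> + \<bar>s\<bar>"
proof -
  have "\<kappa> * g t x + (1 - \<kappa>) * s \<le> \<kappa> * max (g t x) s + (1 - \<kappa>) * max (g t x) s"
    using assms by (intro add_mono mult_left_mono) auto
  also have "\<dots> = max (g t x) s" by (simp add: algebra_simps)
  finally show 1: "gk \<kappa> s t x \<le> max (g t x) s" by (simp add: gk_def)
  have "g t x \<le> gk \<kappa> s t x" by (rule gk_ge)
  with 1 show "\<bar>gk \<kappa> s t x\<bar> \<le> \<bar>g t x\<bar> + \<bar>s\<bar>" by linarith
qed

lemma gk_le: "\<kappa> \<in> {0..1} \<Longrightarrow> t \<in> {0..T} \<Longrightarrow> gk \<kappa> s t x \<le> \<gamma> t + \<bar>s\<bar>"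
  using gk_bounds(1)[of \<kappa> s t x] g_le[of t x] \<gamma>_nonneg[of t] by linarith

lemma caratheodory_gk:
  assumes \<kappa>: "\<kappa> \<in> {0..1}"
  shows "caratheodory T (gk \<kappa> s)"
  unfolding caratheodory_def
proof (intro conjI allI ballI impI)
  show "(\<lambda>t. gk \<kappa> s t u) \<in> borel_measurable (lebesgue_on {0..T})" for u
  proof -
    have [measurable]: "(\<lambda>t. g t u) \<in> borel_measurable (lebesgue_on {0..T})" using car by (simp add: caratheodory_def)
    show ?thesis unfolding gk_def by measurable
  qed
  show "continuous_on UNIV (gk \<kappa> s t)" if "t \<in> {0..T}" for t
  proof -
    have "continuous_on UNIV (g t)" using car that by (simp add: caratheodory_def)
    then show ?thesis unfolding gk_def[abs_def] by (intro continuous_intros)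
  qed
  fix r :: real assume "0 < r"
  with car have "\<exists>h. integrable (lebesgue_on {0..T}) h \<and> (\<forall>t\<in>{0..T}. \<forall>u. \<bar>u\<bar> \<le> r \<longrightarrow> \<bar>g t u\<bar> \<le> h t)"
    unfolding caratheodory_def by simp
  then obtain h where h: "integrable (lebesgue_on {0..T}) h" "\<forall>t\<in>{0..T}. \<forall>u. \<bar>u\<bar> \<le> r \<longrightarrow> \<bar>g t u\<bar> \<le> h t"
    by (elim exE conjE)
  show "\<exists>h. integrable (lebesgue_on {0..T}) h \<and> (\<forall>t\<in>{0..T}. \<forall>u. \<bar>u\<bar> \<le> r \<longrightarrow> \<bar>gk \<kappa> s t u\<bar> \<le> h t)"
  proof (intro exI[of _ "\<lambda>t. h t + \<bar>s\<bar>"] conjI ballI allI impI)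
    show "integrable (lebesgue_on {0..T}) (\<lambda>t. h t + \<bar>s\<bar>)"
      using h(1) by (intro Bochner_Integration.integrable_add integrable_on_const) (auto simp: integrable_const_ivl)
    fix t u :: real assume "t \<in> {0..T}" "\<bar>u\<bar> \<le> r"
    with h(2) have "\<bar>g t u\<bar> \<le> h t" by blast
    with gk_bounds(2)[OF \<kappa>, of s t u] show "\<bar>gk \<kappa> s t u\<bar> \<le> h t + \<bar>s\<bar>" by linarith
  qed
qed

text \<open>From \<open>h \<le> \<gamma> + |s|\<close> and \<open>m \<ge> s\<close> follows
  \<open>h - m \<le> \<gamma> + 2 * |s|\<close>; the integral of this bound controls the primitive
  of \<open>h - m\<close>, uniformly in \<open>m\<close> and \<open>u\<close>.\<close>

definition K_const :: "real \<Rightarrow> real" where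
  "K_const s = integral {0..T} (\<lambda>t. \<gamma> t + 2 * \<bar>s\<bar>)"

text \<open>The largest absolute value that \<psi> takes on the interval of radius
  \<open>K_const s + 1\<close> about 0. The extra 1 is the margin over \<open>K_const s\<close> that
  survives in \<open>oscillation_bound\<close>.\<close>

definition V_const :: "real \<Rightarrow> real" where
  "V_const s = max (\<psi> (K_const s + 1)) (- \<psi> (- (K_const s + 1)))"

definition osc_const :: "real \<Rightarrow> real" where
  "osc_const s = (K_const s + 1) * V_const s * T"

lemma K_nonneg: "0 \<le> K_const s"
  unfolding K_const_def
  by (rule integral_nonneg) (use \<gamma>_int \<gamma>_nonneg in \<open>auto intro!: integrable_add\<close>)

lemma psi_mono: "x \<le> y \<Longrightarrow> \<psi> x \<le> \<psi> y"
  using psi_strict[of x y] by (cases "x = y") auto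

lemma psi_sign: "0 \<le> x \<Longrightarrow> 0 \<le> \<psi> x" "x \<le> 0 \<Longrightarrow> \<psi> x \<le> 0"
  using psi_mono[of 0 x] psi_mono[of x 0] psi0 by auto

lemma V_nonneg: "0 \<le> V_const s"
  using psi_sign(1)[of "K_const s + 1"] K_nonneg[of s] by (simp add: V_const_def max_def)

lemma osc_nonneg: "0 \<le> osc_const s"
  using K_nonneg V_nonneg T_pos by (simp add: osc_const_def)

text \<open>Either \<open>|x|\<close> is at most \<open>K_const s + 1\<close>, and then
  \<open>|p|\<close> is at most \<open>V_const s\<close>, or \<open>x * p\<close> is large by
  itself. Only the size of \<open>p\<close> relative to \<psi> and its sign enter, so truncations of
  \<psi> are covered.\<close>

lemma coercive:
  assumes "\<bar>p\<bar> \<le> \<bar>\<psi> x\<bar>" "0 \<le> x * p"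
  shows "(K_const s + 1) * (\<bar>p\<bar> - V_const s) \<le> x * p"
proof (cases "\<bar>x\<bar> \<le> K_const s + 1")
  case True
  have "\<bar>\<psi> x\<bar> \<le> V_const s"
    using psi_mono[of x "K_const s + 1"] psi_mono[of "- (K_const s + 1)" x] True
    unfolding V_const_def by linarith
  then have "(K_const s + 1) * (\<bar>p\<bar> - V_const s) \<le> 0"
    using assms(1) K_nonneg[of s] by (intro mult_nonneg_nonpos) auto
  with assms(2) show ?thesis by linarith
next
  case False
  have "(K_const s + 1) * (\<bar>p\<bar> - V_const s) \<le> (K_const s + 1) * \<bar>p\<bar>"
    using K_nonneg[of s] V_nonneg[of s] by (intro mult_left_mono) auto
  also have "\<dots> \<le> \<bar>x\<bar> * \<bar>p\<bar>" using False by (intro mult_right_mono) auto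
  also have "\<dots> = x * p" using assms(2) by (simp add: abs_mult[symmetric])
  finally show ?thesis .
qed

lemma J_bound:
  assumes h: "caratheodory T h" "\<And>t x. t \<in> {0..T} \<Longrightarrow> h t x \<le> \<gamma> t + \<bar>s\<bar>" and u: "continuous_on {0..T} u"
    and m: "s \<le> m" "integral {0..T} (\<lambda>\<tau>. m - h \<tau> (u \<tau>)) = 0" and t: "t \<in> {0..T}"
  shows "\<bar>integral {0..t} (\<lambda>\<tau>. m - h \<tau> (u \<tau>))\<bar> \<le> K_const s"
proof -
  have neg: "integral S (\<lambda>\<tau>. h \<tau> (u \<tau>) - m) = - integral S (\<lambda>\<tau>. m - h \<tau> (u \<tau>))" for S
    by (subst integral_neg[symmetric]) simp
  have "\<bar>integral {0..t} (\<lambda>\<tau>. h \<tau> (u \<tau>) - m)\<bar> \<le> K_const s"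
    unfolding K_const_def
  proof (rule primitive_bound[OF _ _ _ _ _ t])
    have "(\<lambda>\<tau>. - (m - h \<tau> (u \<tau>))) integrable_on {0..T}"
      by (rule integrable_neg, rule superposition_integrable(1)[OF h(1) u]) auto
    then show "(\<lambda>\<tau>. h \<tau> (u \<tau>) - m) integrable_on {0..T}" by simp
    show "integral {0..T} (\<lambda>\<tau>. h \<tau> (u \<tau>) - m) = 0" unfolding neg using m(2) by simp
    show "(\<lambda>t. \<gamma> t + 2 * \<bar>s\<bar>) integrable_on {0..T}" using \<gamma>_int by (intro integrable_add) auto
    fix \<tau> assume \<tau>: "\<tau> \<in> {0..T}"
    show "h \<tau> (u \<tau>) - m \<le> \<gamma> \<tau> + 2 * \<bar>s\<bar>" using h(2)[OF \<tau>, of "u \<tau>"] m(1) by linarith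
    show "0 \<le> \<gamma> \<tau> + 2 * \<bar>s\<bar>" using \<gamma>_nonneg[OF \<tau>] by simp
  qed
  then show ?thesis unfolding neg by simp
qed

text \<open>The bound does not see the damping term, since \<^term>\<open>(a - F (u t)) * v t\<close> has zero mean.\<close>

lemma a_priori_oscillation:
  assumes h: "caratheodory T h" "\<And>t x. t \<in> {0..T} \<Longrightarrow> h t x \<le> \<gamma> t + \<bar>s\<bar>"
    and C: "C1_with_deriv T u v" "u 0 = u T"
    and m: "s \<le> m" "integral {0..T} (\<lambda>\<tau>. m - h \<tau> (u \<tau>)) = 0"
    and b: "\<And>t. t \<in> {0..T} \<Longrightarrow> b t = a - F (u t) + integral {0..t} (\<lambda>\<tau>. m - h \<tau> (u \<tau>))"
    and v: "\<And>t. t \<in> {0..T} \<Longrightarrow> \<bar>v t\<bar> \<le> \<bar>\<psi> (b t)\<bar> \<and> 0 \<le> b t * v t"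
    and xy: "x \<in> {0..T}" "y \<in> {0..T}"
  shows "\<bar>u x - u y\<bar> \<le> osc_const s"
  unfolding osc_const_def
proof (rule oscillation_bound[OF C T_pos F_cont K_nonneg V_nonneg _ xy])
  fix t assume t: "t \<in> {0..T}"
  let ?J = "integral {0..t} (\<lambda>\<tau>. m - h \<tau> (u \<tau>))"
  have "(K_const s + 1) * (\<bar>v t\<bar> - V_const s) \<le> b t * v t"
    using v[OF t] by (intro coercive) auto
  also have "b t * v t = v t * (a - F (u t)) + ?J * v t" unfolding b[OF t] by (simp add: algebra_simps)
  also have "?J * v t \<le> K_const s * \<bar>v t\<bar>"
  proof -
    have "?J * v t \<le> \<bar>?J\<bar> * \<bar>v t\<bar>" by (simp add: abs_mult[symmetric])
    also have "\<dots> \<le> K_const s * \<bar>v t\<bar>"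
      by (intro mult_right_mono J_bound[OF h C1_continuous(1)[OF C(1)] m t]) auto
    finally show ?thesis .
  qed
  finally show "(K_const s + 1) * (\<bar>v t\<bar> - V_const s) \<le> v t * (a - F (u t)) + K_const s * \<bar>v t\<bar>" by simp
qed

text \<open>Rolle's theorem yields a time with \<open>v = 0\<close>, hence \<open>b = 0\<close>;
  comparing with it eliminates the unknown constant \<open>a\<close>. The hypothesis linking zeros
  of \<open>v\<close> and \<open>b\<close> fits both \<psi> and its truncation.\<close>

lemma a_priori_velocity:
  assumes h: "caratheodory T h" "\<And>t x. t \<in> {0..T} \<Longrightarrow> h t x \<le> \<gamma> t + \<bar>s\<bar>"
    and C: "C1_with_deriv T u v" "u 0 = u T"
    and m: "s \<le> m" "integral {0..T} (\<lambda>\<tau>. m - h \<tau> (u \<tau>)) = 0"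
    and b: "\<And>t. t \<in> {0..T} \<Longrightarrow> b t = a - F (u t) + integral {0..t} (\<lambda>\<tau>. m - h \<tau> (u \<tau>))"
    and v: "\<And>t. v t = 0 \<Longrightarrow> b t = 0"
    and FU: "\<And>t. t \<in> {0..T} \<Longrightarrow> \<bar>F (u t)\<bar> \<le> FU"
    and t: "t \<in> {0..T}"
  shows "\<bar>b t\<bar> \<le> 2 * (FU + K_const s)"
proof -
  have inner: "(u has_real_derivative v x) (at x)" if "0 < x" "x < T" for x
  proof -
    have "at x within {0..T} = at x"
      using that by (intro at_within_interior) (simp add: interior_atLeastAtMost_real)
    then show ?thesis using C(1) that by (auto simp: C1_with_deriv_def dest!: bspec[of _ _ x])
  qed
  have "\<exists>x>0. x < T \<and> (u has_real_derivative 0) (at x)"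
    using inner by (intro Rolle[OF T_pos C(2) C1_continuous(1)[OF C(1)]]) (auto simp: real_differentiable_def)
  then obtain x where x: "0 < x" "x < T" "(u has_real_derivative 0) (at x)" by blast
  then have "v x = 0" using DERIV_unique[OF x(3) inner] by simp
  then have bx: "b x = 0" by (rule v)
  have xm: "x \<in> {0..T}" using x by simp
  define I where "I x = integral {0..x} (\<lambda>\<tau>. m - h \<tau> (u \<tau>))" for x
  have I: "\<bar>I x\<bar> \<le> K_const s" if "x \<in> {0..T}" for x
    unfolding I_def by (rule J_bound[OF h C1_continuous(1)[OF C(1)] m that])
  have "b t = (F (u x) - F (u t)) + (I t - I x)"
    using bx b[OF t] b[OF xm] unfolding I_def by simp
  also have "\<bar>\<dots>\<bar> \<le> \<bar>F (u x) - F (u t)\<bar> + \<bar>I t - I x\<bar>" by (rule abs_triangle_ineq)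
  also have "\<bar>F (u x) - F (u t)\<bar> \<le> FU + FU" using FU[OF xm] FU[OF t] by linarith
  also have "\<bar>I t - I x\<bar> \<le> K_const s + K_const s" using I[OF xm] I[OF t] by linarith
  finally show ?thesis by simp
qed

text \<open>The constant belongs to \<open>s\<close> and not to \<open>m\<close>, so it serves all
  levels \<open>m \<ge> s\<close> at once; \<open>\<phi> (v t)\<close> takes the place of
  \<open>b\<close>.\<close>

lemma isol_oscillation:
  assumes i: "isol g m u v" and m: "s \<le> m" and xy: "x \<in> {0..T}" "y \<in> {0..T}"
  shows "\<bar>u x - u y\<bar> \<le> osc_const s"
proof (rule a_priori_oscillation[OF car _ isolD(1,2)[OF i] m _ _ _ xy])
  show "g t x \<le> \<gamma> t + \<bar>s\<bar>" if "t \<in> {0..T}" for t x using g_le[OF that, of x] by simp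
  show "integral {0..T} (\<lambda>\<tau>. m - g \<tau> (u \<tau>)) = 0"
    using isol_increment[OF i car, of 0 T] T_pos isolD(2,3)[OF i] by simp
  fix t assume t: "t \<in> {0..T}"
  show "\<phi> (v t) = (\<phi> (v 0) + F (u 0)) - F (u t) + integral {0..t} (\<lambda>\<tau>. m - g \<tau> (u \<tau>))"
    using isolD(4)[OF i t] by linarith
  have "0 \<le> \<phi> x * x" for x
    using psi_sign[of "\<phi> x"] unfolding psi_phi by (cases "0 \<le> \<phi> x") (auto intro: mult_nonneg_nonneg mult_nonpos_nonpos)
  then show "\<bar>v t\<bar> \<le> \<bar>\<psi> (\<phi> (v t))\<bar> \<and> 0 \<le> \<phi> (v t) * v t" by (simp add: psi_phi)
qed

section \<open>The intermediate value argument\<close>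

text \<open>In the fixed point problem, \<^term>\<open>a\<close> is the integration constant of \<open>\<phi>(u') + F(u)\<close> and \<^term>\<open>\<tau>\<close> drives a
  two-stage path: for \<^term>\<open>\<tau> \<ge> 0\<close> it is the offset \<open>c = \<sigma> \<tau>\<close> from \<^term>\<open>\<alpha>\<close>, for \<^term>\<open>\<tau> < 0\<close> the offset is 0 and
  \<^term>\<open>g\<close> is deformed to \<^term>\<open>gk (1 + \<tau>) s\<close>. The second stage keeps the level \<^term>\<open>m\<close> at least \<^term>\<open>s\<close> at
  every fixed point, which the a priori bounds need. Truncating \<^term>\<open>\<psi>\<close> at \<^term>\<open>k\<close> makes the box invariant, and
  the a priori bounds, independent of \<^term>\<open>k\<close>, show that the truncation is inactive.\<close>

lemma isol_between:
  assumes sub: "sub_sol s1 \<alpha> \<alpha>'" and s: "s < s1" and \<sigma>: "\<bar>\<sigma>\<bar> = (1::real)" and R: "0 < R"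
    and excl: "\<And>m u v. isol g m u v \<Longrightarrow> s < m \<Longrightarrow> (\<forall>t\<in>{0..T}. \<alpha> t + \<sigma> * R \<le> u t) \<Longrightarrow>
        (\<exists>t\<in>{0..T}. u t = \<alpha> t + \<sigma> * R) \<Longrightarrow> False"
  shows "\<exists>u v c. isol g s u v \<and> 0 < c \<and> (\<forall>t\<in>{0..T}. \<alpha> t + \<sigma> * c \<le> u t) \<and> (\<exists>t\<in>{0..T}. u t = \<alpha> t + \<sigma> * c)"
proof -
  have T: "0 < T" "0 \<le> T" using T_pos by auto
  have Ca: "C1_with_deriv T \<alpha> \<alpha>'" "\<alpha> 0 = \<alpha> T" "\<alpha>' 0 = \<alpha>' T" using sub by (auto simp: sub_sol_def)
  note ac = C1_continuous(1)[OF Ca(1)]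
  obtain M where M: "0 < M" "\<forall>t\<in>{0..T}. \<bar>\<alpha> t\<bar> \<le> M" using continuous_bounded_Icc[OF ac] by blast
  \<comment> \<open>\<open>U\<close> will bound every fixed point: it meets \<alpha> shifted by at
    most \<open>R\<close> and oscillates by at most \<open>osc_const s\<close>. The truncation
    \<open>k\<close> does not enter and may therefore be chosen afterwards.\<close>
  define U where "U = R + M + osc_const s"
  obtain FU where FU: "0 < FU" "\<forall>x\<in>{-U..U}. \<bar>F x\<bar> \<le> FU"
    using continuous_bounded_Icc[OF continuous_on_subset[OF F_cont subset_UNIV]] by blast
  define M' where "M' = 2 * (FU + K_const s)"
  define k where "k = 1 + max (\<psi> M') (- \<psi> (- M'))"
  have M': "0 \<le> M'" using FU(1) K_nonneg[of s] by (simp add: M'_def)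
  then have k: "0 < k" using psi_sign(1)[OF M'] by (simp add: k_def max_def)
  define p where "p x = max (- k) (min k (\<psi> x))" for x
  have pcont: "continuous_on UNIV p" unfolding p_def[abs_def] by (intro continuous_intros psi_cont)
  have pk: "\<bar>p x\<bar> \<le> k" for x using k by (auto simp: p_def)
  have ppos: "0 \<le> p x" if "0 \<le> x" for x using psi_sign(1)[OF that] k by (simp add: p_def)
  have pneg: "p x \<le> 0" if "x \<le> 0" for x using psi_sign(2)[OF that] k by (simp add: p_def)
  have ppsi: "\<bar>p x\<bar> \<le> \<bar>\<psi> x\<bar>" for x using k by (auto simp: p_def)
  have p0: "x = 0" if "p x = 0" for x
  proof -
    have "\<psi> x = 0" using that k by (auto simp: p_def max_def min_def split: if_splits)
    then show ?thesis using psi_strict[of x 0] psi_strict[of 0 x] psi0 by (cases x "0::real" rule: linorder_cases) auto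
  qed
  \<comment> \<open>A cruder bound, valid for every \<open>u\<close> that arises from the box and
    allowed to depend on \<open>k\<close>; it fixes the dominating function \<open>H\<close> and the
    size \<open>A\<close> of the box.\<close>
  define U' where "U' = 2 * (k * T) + R + M"
  have U': "0 < U'" using k T R M(1) by (simp add: U'_def add_pos_pos)
  with car have "\<exists>h. integrable (lebesgue_on {0..T}) h \<and> (\<forall>t\<in>{0..T}. \<forall>u. \<bar>u\<bar> \<le> U' \<longrightarrow> \<bar>g t u\<bar> \<le> h t)"
    unfolding caratheodory_def by simp
  then obtain h where h0: "integrable (lebesgue_on {0..T}) h" "\<forall>t\<in>{0..T}. \<forall>u. \<bar>u\<bar> \<le> U' \<longrightarrow> \<bar>g t u\<bar> \<le> h t"
    by (elim exE conjE)
  define H where "H t = h t + \<bar>s\<bar>" for t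
  have Hi: "H integrable_on {0..T}" unfolding H_def
    using integrable_on_lebesgue_on[OF h0(1)] by (intro integrable_add) auto
  have gH: "\<bar>gk \<kappa> s t x\<bar> \<le> H t" if "\<kappa> \<in> {0..1}" "t \<in> {0..T}" "\<bar>x\<bar> \<le> U'" for \<kappa> t x
  proof -
    have "\<bar>g t x\<bar> \<le> h t" using h0(2) that by blast
    with gk_bounds(2)[OF that(1), of s t x] show ?thesis by (simp add: H_def)
  qed
  define G where "G = integral {0..T} H"
  have H_nonneg: "0 \<le> H t" if "t \<in> {0..T}" for t using gH[of 0 t 0] that U' by simp
  have G: "0 \<le> G" unfolding G_def by (rule integral_nonneg[OF Hi]) (use H_nonneg in auto)
  obtain FU' where FU': "0 < FU'" "\<forall>x\<in>{-U'..U'}. \<bar>F x\<bar> \<le> FU'"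
    using continuous_bounded_Icc[OF continuous_on_subset[OF F_cont subset_UNIV]] by blast
  \<comment> \<open>Chosen so that \<open>b\<close> differs from \<open>a\<close> by less than
    \<open>A\<close>; at \<open>a = A\<close> or \<open>a = - A\<close> the sign of \<open>b\<close>
    is then constant in time.\<close>
  define A where "A = FU' + 2 * G + 1"
  have A: "0 < A" using FU'(1) G by (simp add: A_def)
  define D where "D \<tau> a z \<longleftrightarrow> \<tau> \<in> {-1..R} \<and> a \<in> {-A..A} \<and> continuous_on {0..T} z \<and> (\<forall>t\<in>{0..T}. \<bar>z t\<bar> \<le> k * T)"
    for \<tau> a :: real and z :: "real \<Rightarrow> real"
  define cc where "cc \<tau> = \<sigma> * max \<tau> 0" for \<tau>
  define kk where "kk \<tau> = 1 + min \<tau> 0" for \<tau> :: real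
  define mn where "mn z = Inf ((\<lambda>t. z t - \<alpha> t) ` {0..T})" for z
  define u where "u \<tau> z t = z t + cc \<tau> - mn z" for \<tau> z t
  define hh where "hh \<tau> z t = gk (kk \<tau>) s t (u \<tau> z t)" for \<tau> z t
  define mm where "mm \<tau> z = integral {0..T} (hh \<tau> z) / T" for \<tau> z
  define J where "J \<tau> z t = integral {0..t} (\<lambda>x. mm \<tau> z - hh \<tau> z x)" for \<tau> z t
  define b where "b \<tau> a z t = a - F (u \<tau> z t) + J \<tau> z t" for \<tau> a z t
  define N where "N \<tau> a z t = integral {0..t} (\<lambda>x. p (b \<tau> a z x))" for \<tau> a z t
  \<comment> \<open>Clamped steps with residuals \<open>mm \<tau> z - s\<close> and
    \<open>- N \<tau> a z T\<close>: both vanish for the sought solution, the second one expressing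
    \<open>u 0 = u T\<close>.\<close>
  define G1 where "G1 \<tau> a z = max (- 1) (min R (\<tau> + (mm \<tau> z - s)))" for \<tau> and a :: real and z
  define G2 where "G2 \<tau> a z = max (- A) (min A (a + (- N \<tau> a z T)))" for \<tau> a z
  have kk: "kk \<tau> \<in> {0..1}" if "D \<tau> a z" for \<tau> a z using that by (auto simp: D_def kk_def)
  have zac: "continuous_on {0..T} (\<lambda>t. z t - \<alpha> t)" if "D \<tau> a z" for \<tau> a z
    using that ac by (auto simp: D_def intro!: continuous_intros)
  have mn_le: "mn z \<le> z t - \<alpha> t" if "D \<tau> a z" "t \<in> {0..T}" for \<tau> a z t
    unfolding mn_def by (rule continuous_Inf_attained(2)[OF zac[OF that(1)] T(2) that(2)])
  have mn_eq: "\<exists>t\<in>{0..T}. z t - \<alpha> t = mn z" if "D \<tau> a z" for \<tau> a z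
    unfolding mn_def by (rule continuous_Inf_attained(1)[OF zac[OF that(1)] T(2)])
  have mn_bound: "\<bar>mn z\<bar> \<le> k * T + M" if d: "D \<tau> a z" for \<tau> a z
  proof -
    obtain t where t: "t \<in> {0..T}" "z t - \<alpha> t = mn z" using mn_eq[OF d] by blast
    have "\<bar>z t\<bar> \<le> k * T" "\<bar>\<alpha> t\<bar> \<le> M" using d t(1) M(2) by (auto simp: D_def)
    with t(2) show ?thesis by linarith
  qed
  have cc_bound: "\<bar>cc \<tau>\<bar> \<le> R" if "D \<tau> a z" for \<tau> a z
    using that \<sigma> R by (auto simp: D_def cc_def abs_mult)
  have uc: "continuous_on {0..T} (u \<tau> z)" if "D \<tau> a z" for \<tau> a z
    unfolding u_def[abs_def] using that by (auto simp: D_def intro!: continuous_intros)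
  have ub: "\<bar>u \<tau> z t\<bar> \<le> U'" if d: "D \<tau> a z" and t: "t \<in> {0..T}" for \<tau> a z t
  proof -
    have "\<bar>z t\<bar> \<le> k * T" using d t by (auto simp: D_def)
    with mn_bound[OF d] cc_bound[OF d] show ?thesis unfolding u_def U'_def by linarith
  qed
  have hH: "\<bar>hh \<tau> z t\<bar> \<le> H t" if "D \<tau> a z" "t \<in> {0..T}" for \<tau> a z t
    unfolding hh_def by (rule gH[OF kk[OF that(1)] that(2) ub[OF that]])
  have hhi: "hh \<tau> z integrable_on {0..t}" "(\<lambda>x. mm \<tau> z - hh \<tau> z x) integrable_on {0..t}"
    if "D \<tau> a z" "t \<in> {0..T}" for \<tau> a z t
    unfolding hh_def[abs_def]
    using superposition_integrable[OF caratheodory_gk[OF kk[OF that(1)]] uc[OF that(1)], of 0 t] that(2) by auto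
  have T_mem: "T \<in> {0..T}" using T by simp
  have hG: "\<bar>integral {0..t} (hh \<tau> z)\<bar> \<le> G" if d: "D \<tau> a z" and t: "t \<in> {0..T}" for \<tau> a z t
  proof -
    have sub: "H integrable_on {0..t}" by (rule integrable_subinterval_real[OF Hi]) (use t in auto)
    have "norm (integral {0..t} (hh \<tau> z)) \<le> integral {0..t} H"
      by (rule integral_norm_bound_integral[OF hhi(1)[OF d t] sub]) (use hH[OF d] t in auto)
    also have "\<dots> \<le> G" unfolding G_def
      by (rule integral_subset_le[OF _ sub Hi]) (use t H_nonneg in auto)
    finally show ?thesis by simp
  qed
  have Jeq: "J \<tau> z t = mm \<tau> z * t - integral {0..t} (hh \<tau> z)" if d: "D \<tau> a z" and t: "t \<in> {0..T}" for \<tau> a z t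
    unfolding J_def using hhi(1)[OF d t] t by (subst integral_diff) (auto simp: mult.commute)
  have JT: "J \<tau> z T = 0" if d: "D \<tau> a z" for \<tau> a z
    using Jeq[OF d T_mem] T by (simp add: mm_def)
  have Jb: "\<bar>J \<tau> z t\<bar> \<le> 2 * G" if d: "D \<tau> a z" and t: "t \<in> {0..T}" for \<tau> a z t
  proof -
    have "\<bar>mm \<tau> z * t\<bar> = \<bar>integral {0..T} (hh \<tau> z)\<bar> * (t / T)" using t T by (simp add: mm_def abs_mult)
    also have "\<dots> \<le> G * 1" by (rule mult_mono[OF hG[OF d T_mem]]) (use t T G in auto)
    finally show ?thesis using Jeq[OF d t] hG[OF d t] by linarith
  qed
  have Jc: "continuous_on {0..T} (J \<tau> z)" if d: "D \<tau> a z" for \<tau> a z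
    unfolding J_def[abs_def] by (rule indefinite_integral_continuous_1[OF hhi(2)[OF d T_mem]])
  have bc: "continuous_on {0..T} (b \<tau> a z)" if d: "D \<tau> a z" for \<tau> a z
    unfolding b_def[abs_def]
    by (intro continuous_intros Jc[OF d] continuous_on_compose2[OF F_cont uc[OF d]]) auto
  have pbc: "continuous_on {0..T} (\<lambda>x. p (b \<tau> a z x))" if d: "D \<tau> a z" for \<tau> a z
    by (rule continuous_on_compose2[OF pcont bc[OF d]]) auto
  have pbi: "(\<lambda>x. p (b \<tau> a z x)) integrable_on {x..y}" if d: "D \<tau> a z" and xy: "0 \<le> x" "y \<le> T" for \<tau> a z x y
    by (rule integrable_continuous_real, rule continuous_on_subset[OF pbc[OF d]]) (use xy in auto)
  have Nlip0: "\<bar>N \<tau> a z y - N \<tau> a z x\<bar> \<le> k * (y - x)" if d: "D \<tau> a z" and xy: "0 \<le> x" "x \<le> y" "y \<le> T" for \<tau> a z x y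
  proof -
    have "N \<tau> a z y - N \<tau> a z x = integral {x..y} (\<lambda>x. p (b \<tau> a z x))"
      using Henstock_Kurzweil_Integration.integral_combine[OF xy(1,2) pbi[OF d order_refl xy(3)]] by (simp add: N_def)
    also have "norm \<dots> \<le> integral {x..y} (\<lambda>_. k)"
      by (rule integral_norm_bound_integral[OF pbi[OF d xy(1,3)]]) (use pk in auto)
    finally show ?thesis using xy by (simp add: mult.commute)
  qed
  have Nlip: "\<bar>N \<tau> a z x - N \<tau> a z y\<bar> \<le> k * \<bar>x - y\<bar>" if d: "D \<tau> a z" and xy: "x \<in> {0..T}" "y \<in> {0..T}" for \<tau> a z x y
    using Nlip0[OF d, of x y] Nlip0[OF d, of y x] xy by (cases "x \<le> y") (auto simp: abs_minus_commute)
  have N0: "N \<tau> a z 0 = 0" for \<tau> a z by (simp add: N_def)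
  have Nb: "\<bar>N \<tau> a z t\<bar> \<le> k * T" if d: "D \<tau> a z" and t: "t \<in> {0..T}" for \<tau> a z t
  proof -
    have "\<bar>N \<tau> a z t\<bar> \<le> k * t" using Nlip[OF d t, of 0] t N0 by auto
    also have "\<dots> \<le> k * T" using t k by (intro mult_left_mono) auto
    finally show ?thesis .
  qed
  have "\<exists>\<tau> a z. D \<tau> a z \<and> \<tau> = G1 \<tau> a z \<and> a = G2 \<tau> a z \<and> (\<forall>t\<in>{0..T}. z t = N \<tau> a z t)"
  proof (rule schauder_box[where L=k and \<rho>="k * T"])
    show "D \<tau> a z \<longleftrightarrow> \<tau> \<in> {-1..R} \<and> a \<in> {-A..A} \<and> continuous_on {0..T} z \<and> (\<forall>t\<in>{0..T}. \<bar>z t\<bar> \<le> k * T)" for \<tau> a z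
      by (rule D_def)
    show "G1 \<tau> a z \<in> {-1..R}" for \<tau> a z using R by (simp add: G1_def)
    show "G2 \<tau> a z \<in> {-A..A}" for \<tau> a z using A by (simp add: G2_def)
    fix ts as zs \<tau> a z
    assume ds: "\<And>n. D (ts n) (as n) (zs n)" and d: "D \<tau> a z" and tl: "ts \<longlonglongrightarrow> \<tau>" and al: "as \<longlonglongrightarrow> a"
      and zl: "uniform_limit {0..T} zs z sequentially"
    have zl': "(\<lambda>n. zs n t) \<longlonglongrightarrow> z t" if "t \<in> {0..T}" for t by (rule tendsto_uniform_limitI[OF zl that])
    have mnl: "(\<lambda>n. mn (zs n)) \<longlonglongrightarrow> mn z"
    proof (rule tendstoI)
      fix e :: real assume e: "0 < e"
      have "\<forall>\<^sub>F n in sequentially. \<forall>t\<in>{0..T}. dist (zs n t) (z t) < e / 2"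
        by (rule uniform_limitD[OF zl]) (use e in simp)
      then show "\<forall>\<^sub>F n in sequentially. dist (mn (zs n)) (mn z) < e"
      proof eventually_elim
        case (elim n)
        have "\<bar>mn (zs n) - mn z\<bar> \<le> e / 2" unfolding mn_def
          by (rule Inf_dist_le[OF zac[OF ds] zac[OF d] T(2)]) (use elim in \<open>auto simp: dist_real_def intro: less_imp_le\<close>)
        then show ?case using e by (simp add: dist_real_def)
      qed
    qed
    have ul: "(\<lambda>n. u (ts n) (zs n) t) \<longlonglongrightarrow> u \<tau> z t" if "t \<in> {0..T}" for t
      unfolding u_def cc_def by (intro tendsto_intros zl'[OF that] mnl tl)
    have hl: "(\<lambda>n. hh (ts n) (zs n) t) \<longlonglongrightarrow> hh \<tau> z t" if t: "t \<in> {0..T}" for t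
    proof -
      have "isCont (g t) (u \<tau> z t)" using car t by (simp add: caratheodory_def continuous_on_eq_continuous_at)
      from isCont_tendsto_compose[OF this ul[OF t]]
      have "(\<lambda>n. g t (u (ts n) (zs n) t)) \<longlonglongrightarrow> g t (u \<tau> z t)" .
      then show ?thesis unfolding hh_def gk_def kk_def by (intro tendsto_intros tl)
    qed
    have hil: "(\<lambda>n. integral {0..t} (hh (ts n) (zs n))) \<longlonglongrightarrow> integral {0..t} (hh \<tau> z)" if t: "t \<in> {0..T}" for t
    proof (rule dominated_convergence(2))
      show "hh (ts n) (zs n) integrable_on {0..t}" for n by (rule hhi(1)[OF ds t])
      show "H integrable_on {0..t}" by (rule integrable_subinterval_real[OF Hi]) (use t in auto)
      show "norm (hh (ts n) (zs n) x) \<le> H x" if "x \<in> {0..t}" for n x using hH[OF ds, of x n] that t by simp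
      show "(\<lambda>n. hh (ts n) (zs n) x) \<longlonglongrightarrow> hh \<tau> z x" if "x \<in> {0..t}" for x using hl that t by simp
    qed
    have ml: "(\<lambda>n. mm (ts n) (zs n)) \<longlonglongrightarrow> mm \<tau> z"
      unfolding mm_def by (intro tendsto_intros hil[OF T_mem]) (use T in simp)
    have bl: "(\<lambda>n. b (ts n) (as n) (zs n) t) \<longlonglongrightarrow> b \<tau> a z t" if t: "t \<in> {0..T}" for t
    proof -
      have "isCont F (u \<tau> z t)" using F_deriv by (rule DERIV_isCont)
      from isCont_tendsto_compose[OF this ul[OF t]]
      show ?thesis unfolding b_def Jeq[OF ds t] Jeq[OF d t] by (intro tendsto_intros al ml hil[OF t])
    qed
    have Nl: "(\<lambda>n. N (ts n) (as n) (zs n) t) \<longlonglongrightarrow> N \<tau> a z t" if t: "t \<in> {0..T}" for t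
      unfolding N_def
    proof (rule dominated_convergence(2))
      show "(\<lambda>x. p (b (ts n) (as n) (zs n) x)) integrable_on {0..t}" for n by (rule pbi[OF ds]) (use t in auto)
      show "(\<lambda>_. k) integrable_on {0..t}" by (rule integrable_const_ivl)
      show "norm (p (b (ts n) (as n) (zs n) x)) \<le> k" if "x \<in> {0..t}" for n x using pk by simp
      show "(\<lambda>n. p (b (ts n) (as n) (zs n) x)) \<longlonglongrightarrow> p (b \<tau> a z x)" if "x \<in> {0..t}" for x
      proof (rule isCont_tendsto_compose[OF _ bl])
        show "isCont p (b \<tau> a z x)" using pcont by (simp add: continuous_on_eq_continuous_at)
      qed (use that t in auto)
    qed
    have "(\<lambda>n. G1 (ts n) (as n) (zs n)) \<longlonglongrightarrow> G1 \<tau> a z" unfolding G1_def by (intro tendsto_intros tl ml)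
    moreover have "(\<lambda>n. G2 (ts n) (as n) (zs n)) \<longlonglongrightarrow> G2 \<tau> a z" unfolding G2_def by (intro tendsto_intros al Nl[OF T_mem])
    ultimately show "(\<lambda>n. G1 (ts n) (as n) (zs n)) \<longlonglongrightarrow> G1 \<tau> a z \<and> (\<lambda>n. G2 (ts n) (as n) (zs n)) \<longlonglongrightarrow> G2 \<tau> a z \<and>
        (\<forall>t\<in>{0..T}. (\<lambda>n. N (ts n) (as n) (zs n) t) \<longlonglongrightarrow> N \<tau> a z t)" using Nl by blast
  qed (use T R A k Nb Nlip in auto)
  then obtain \<tau> a z where d: "D \<tau> a z" and f1: "\<tau> = G1 \<tau> a z" and f2: "a = G2 \<tau> a z" and f3: "\<forall>t\<in>{0..T}. z t = N \<tau> a z t"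
    by (elim exE conjE)
  define w where "w = u \<tau> z"
  define m where "m = mm \<tau> z"
  define \<kappa> where "\<kappa> = kk \<tau>"
  define B where "B = b \<tau> a z"
  define v where "v t = p (B t)" for t
  have \<kappa>: "\<kappa> \<in> {0..1}" using kk[OF d] by (simp add: \<kappa>_def)
  have Beq: "B t = a - F (w t) + integral {0..t} (\<lambda>x. m - gk \<kappa> s x (w x))" for t
    by (simp add: B_def b_def J_def hh_def w_def m_def \<kappa>_def)
  have vc: "continuous_on {0..T} v" unfolding v_def[abs_def] B_def by (rule pbc[OF d])
  have JT0: "integral {0..T} (\<lambda>x. m - gk \<kappa> s x (w x)) = 0"
    using JT[OF d] by (simp add: J_def hh_def w_def m_def \<kappa>_def)
  have Bab: "\<bar>B t - a\<bar> < A" if t: "t \<in> {0..T}" for t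
  proof -
    have "w t \<in> {-U'..U'}" using ub[OF d t] unfolding w_def by (simp add: abs_le_iff)
    then have "\<bar>F (w t)\<bar> \<le> FU'" using FU'(2) by blast
    with Jb[OF d t] show ?thesis unfolding B_def b_def A_def w_def by linarith
  qed
  \<comment> \<open>A nonzero \<open>N \<tau> a z T\<close> would put \<open>a\<close> at the end
    where \<open>B\<close>, and with it \<open>v\<close>, has the sign that contradicts
    \<open>N \<tau> a z T\<close> being the integral of \<open>v\<close>.\<close>
  have NT: "N \<tau> a z T = 0"
  proof (rule ccontr)
    assume ne: "N \<tau> a z T \<noteq> 0"
    have Ni: "N \<tau> a z T = integral {0..T} v" by (simp add: N_def v_def[abs_def] B_def)
    have vi: "v integrable_on {0..T}" using vc by (rule integrable_continuous_real)
    note f2' = f2[unfolded G2_def]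
    have AA: "- A < A" using A by simp
    from ne consider "0 < N \<tau> a z T" | "N \<tau> a z T < 0" by linarith
    then show False
    proof cases
      case 1
      then have "a = - A" using clamp_eq(1)[OF f2' AA] by simp
      then have "v t \<le> 0" if "t \<in> {0..T}" for t
        unfolding v_def using Bab[OF that] by (intro pneg) linarith
      then have "integral {0..T} v \<le> integral {0..T} (\<lambda>_. 0)" by (intro integral_le vi) auto
      with 1 Ni show False by simp
    next
      case 2
      then have "a = A" using clamp_eq(2)[OF f2' AA] by simp
      then have "0 \<le> v t" if "t \<in> {0..T}" for t
        unfolding v_def using Bab[OF that] by (intro ppos) linarith
      then have "0 \<le> integral {0..T} v" by (intro integral_nonneg vi) auto
      with 2 Ni show False by simp
    qed
  qed
  have R1: "- 1 < R" using R by simp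
  note f1' = f1[unfolded G1_def, folded m_def]
  \<comment> \<open>A level below \<open>s\<close> would force \<open>\<tau> = - 1\<close>, where
    the fully deformed nonlinearity is at least \<open>s\<close> and so is its mean.\<close>
  have ms: "s \<le> m"
  proof (rule ccontr)
    assume "\<not> s \<le> m"
    then have "\<tau> = - 1" using clamp_eq(1)[OF f1' R1] by simp
    then have "\<kappa> = 0" by (simp add: \<kappa>_def kk_def)
    then have "s \<le> hh \<tau> z t" for t using gk_zero_ge by (simp add: hh_def \<kappa>_def[symmetric])
    then have "integral {0..T} (\<lambda>_. s) \<le> integral {0..T} (hh \<tau> z)"
      by (intro integral_le hhi(1)[OF d T_mem]) auto
    then have "s * T \<le> integral {0..T} (hh \<tau> z)" using T by (simp add: mult.commute)
    then have "s \<le> m" using T by (simp add: m_def mm_def pos_le_divide_eq)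
    with \<open>\<not> s \<le> m\<close> show False by simp
  qed
  have weq: "w t = N \<tau> a z t + (cc \<tau> - mn z)" if "t \<in> {0..T}" for t
    using f3 that by (simp add: w_def u_def)
  have C: "C1_with_deriv T w v"
    unfolding C1_with_deriv_def
  proof (intro conjI ballI vc)
    fix t assume t: "t \<in> {0..T}"
    have "((\<lambda>t. integral {0..t} v) has_real_derivative v t) (at t within {0..T})"
      by (rule integral_has_real_derivative[OF vc t])
    then have "((\<lambda>t. N \<tau> a z t + (cc \<tau> - mn z)) has_real_derivative v t) (at t within {0..T})"
      unfolding N_def v_def[abs_def] B_def by (auto intro!: derivative_eq_intros)
    then show "(w has_real_derivative v t) (at t within {0..T})"
      by (rule has_field_derivative_transform_within[OF _ zero_less_one t]) (simp add: weq)
  qed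
  have w0: "w 0 = w T" using weq[of 0] weq[of T] N0 NT T by simp
  have v0: "v 0 = v T" unfolding v_def Beq JT0 w0 by simp
  have hle: "gk \<kappa> s t x \<le> \<gamma> t + \<bar>s\<bar>" if "t \<in> {0..T}" for t x by (rule gk_le[OF \<kappa> that])
  have vB: "\<bar>v t\<bar> \<le> \<bar>\<psi> (B t)\<bar> \<and> 0 \<le> B t * v t" for t
    unfolding v_def
  proof (intro conjI ppsi)
    show "0 \<le> B t * p (B t)"
      using ppos[of "B t"] pneg[of "B t"] by (cases "0 \<le> B t") (simp_all add: mult_nonpos_nonpos)
  qed
  \<comment> \<open>The truncated \<open>v\<close> is admissible in the oscillation bound, which
    avoids circularity: the bound on \<open>w\<close> comes first, then \<open>Bb\<close>, and only
    then does \<open>vpsi\<close> remove the truncation.\<close>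
  have osc: "\<bar>w x - w y\<bar> \<le> osc_const s" if "x \<in> {0..T}" "y \<in> {0..T}" for x y
    by (rule a_priori_oscillation[OF caratheodory_gk[OF \<kappa>] hle C w0 ms JT0 Beq vB that])
  have wge: "\<alpha> t + cc \<tau> \<le> w t" if "t \<in> {0..T}" for t
    using mn_le[OF d that] by (simp add: w_def u_def)
  obtain t0 where t0: "t0 \<in> {0..T}" "w t0 = \<alpha> t0 + cc \<tau>"
  proof -
    obtain t where "t \<in> {0..T}" "z t - \<alpha> t = mn z" using mn_eq[OF d] by blast
    then show thesis by (intro that[of t]) (auto simp: w_def u_def)
  qed
  have wU: "w t \<in> {-U..U}" if t: "t \<in> {0..T}" for t
  proof -
    have "\<bar>\<alpha> t0\<bar> \<le> M" using M(2) t0(1) by blast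
    then have "\<bar>w t\<bar> \<le> U" using osc[OF t t0(1)] cc_bound[OF d] t0(2) unfolding U_def by linarith
    then show ?thesis by (simp add: abs_le_iff)
  qed
  have Bb: "\<bar>B t\<bar> \<le> M'" if t: "t \<in> {0..T}" for t
    unfolding M'_def
  proof (rule a_priori_velocity[OF caratheodory_gk[OF \<kappa>] hle C w0 ms JT0 Beq _ _ t])
    show "B t = 0" if "v t = 0" for t using p0 that unfolding v_def by blast
    show "\<bar>F (w t)\<bar> \<le> FU" if "t \<in> {0..T}" for t using FU(2) wU[OF that] by blast
  qed
  have vpsi: "v t = \<psi> (B t)" if t: "t \<in> {0..T}" for t
  proof -
    have "- M' \<le> B t" "B t \<le> M'" using Bb[OF t] by linarith+
    then have "\<psi> (- M') \<le> \<psi> (B t)" "\<psi> (B t) \<le> \<psi> M'" by (auto intro: psi_mono)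
    then have "- k \<le> \<psi> (B t)" "\<psi> (B t) \<le> k" unfolding k_def by linarith+
    then show ?thesis by (simp add: v_def p_def)
  qed
  have ik: "isol (gk \<kappa> s) m w v"
    unfolding isol_def
  proof (intro conjI ballI C w0 v0)
    fix t assume t: "t \<in> {0..T}"
    have z: "0 \<in> {0..T}" using T by simp
    have "\<phi> (v t) = B t" "\<phi> (v 0) = B 0" using vpsi[OF t] vpsi[OF z] by (simp_all add: phi_psi)
    then show "\<phi> (v t) + F (w t) = \<phi> (v 0) + F (w 0) + integral {0..t} (\<lambda>\<tau>. m - gk \<kappa> s \<tau> (w \<tau>))"
      using Beq[of t] Beq[of 0] by simp
  qed
  have pos: "isol g m w v \<and> cc \<tau> = \<sigma> * \<tau>" if "0 < \<tau>"
  proof -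
    have "\<kappa> = 1" using that by (simp add: \<kappa>_def kk_def)
    with ik that show ?thesis by (simp add: gk_one cc_def)
  qed
  \<comment> \<open>A level above \<open>s\<close> would force \<open>\<tau> = R\<close>, where
    \<kappa> is 1 and \<open>excl\<close> forbids a solution with offset
    \<open>\<sigma> * R\<close>.\<close>
  have m_eq: "m = s"
  proof (rule ccontr)
    assume "m \<noteq> s"
    then have "s < m" using ms by simp
    then have "\<tau> = R" using clamp_eq(2)[OF f1' R1] by simp
    with pos R have i: "isol g m w v" and c: "cc \<tau> = \<sigma> * R" by auto
    from excl[OF i \<open>s < m\<close>] wge t0 show False unfolding c by blast
  qed
  \<comment> \<open>Otherwise the offset is 0, so \<open>w\<close> touches \<alpha> from above while
    being a super-solution for \<open>g\<close> at level \<open>s\<close>; \<open>no_contact\<close>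
    rules this out.\<close>
  have \<tau>pos: "0 < \<tau>"
  proof (rule ccontr)
    assume "\<not> 0 < \<tau>"
    then have c0: "cc \<tau> = 0" by (simp add: cc_def)
    have "super_sol s w v"
      unfolding super_sol_def
    proof (intro conjI allI impI C w0 v0)
      fix t t' assume tt: "0 \<le> t" "t \<le> t'" "t' \<le> T"
      have "\<phi> (v t') + F (w t') - (\<phi> (v t) + F (w t)) = integral {t..t'} (\<lambda>\<tau>. s - gk \<kappa> s \<tau> (w \<tau>))"
        using isol_increment[OF ik caratheodory_gk[OF \<kappa>] tt] by (simp add: m_eq)
      also have "\<dots> \<le> integral {t..t'} (\<lambda>\<tau>. s - g \<tau> (w \<tau>))"
        by (rule integral_le; (rule superposition_integrable(1)[OF _ C1_continuous(1)[OF C] tt(1,3)] diff_left_mono[OF gk_ge])?)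
           (rule caratheodory_gk[OF \<kappa>] car)+
      finally show "\<phi> (v t') + F (w t') - (\<phi> (v t) + F (w t)) \<le> integral {t..t'} (\<lambda>\<tau>. s - g \<tau> (w \<tau>))" .
    qed
    from no_contact[OF sub this s _ t0(1)] wge t0(2) show False unfolding c0 by auto
  qed
  have "isol g s w v" "cc \<tau> = \<sigma> * \<tau>" using pos[OF \<tau>pos] m_eq by auto
  with wge t0 \<tau>pos show ?thesis by (intro exI[of _ w] exI[of _ v] exI[of _ \<tau>] conjI) auto
qed

section \<open>The set of solvable levels\<close>

text \<open>The bound on \<open>u\<close> controls \<open>F (u)\<close>, then
  \<open>\<phi> (v)\<close>, then \<open>v\<close>, which gives a uniformly convergent subsequence
  of \<open>u\<close>. Only the initial value \<open>\<phi> (v n 0)\<close> takes a further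
  subsequence: the integrated equation determines the pointwise limit of the velocities. The common
  lower bound \<open>s\<close> of the levels makes the constants uniform.\<close>

lemma isol_limit:
  fixes S :: "nat \<Rightarrow> real"
  assumes i: "\<And>n. isol g (S n) (u n) (v n)" and S: "S \<longlonglongrightarrow> s0" "\<And>n. s \<le> S n"
    and U: "\<And>n t. t \<in> {0..T} \<Longrightarrow> \<bar>u n t\<bar> \<le> U"
  shows "\<exists>u v. isol g s0 u v"
proof -
  have z: "0 \<in> {0..T}" "T \<in> {0..T}" using T_pos by auto
  note C = isolD(1)[OF i]
  obtain FU where FU: "0 < FU" "\<forall>x\<in>{-U..U}. \<bar>F x\<bar> \<le> FU"
    using continuous_bounded_Icc[OF continuous_on_subset[OF F_cont subset_UNIV]] by blast
  define M where "M = 2 * (FU + K_const s)"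
  have int0: "integral {0..T} (\<lambda>\<tau>. S n - g \<tau> (u n \<tau>)) = 0" for n
    using isol_increment[OF i car, of 0 T n] T_pos isolD(2,3)[OF i] by simp
  have phib: "\<bar>\<phi> (v n t)\<bar> \<le> M" if t: "t \<in> {0..T}" for n t
    unfolding M_def
  proof (rule a_priori_velocity[OF car _ C isolD(2)[OF i] S(2) int0 _ _ _ t])
    show "g t x \<le> \<gamma> t + \<bar>s\<bar>" if "t \<in> {0..T}" for t x using g_le[OF that, of x] by simp
    show "\<phi> (v n t) = (\<phi> (v n 0) + F (u n 0)) - F (u n t) + integral {0..t} (\<lambda>\<tau>. S n - g \<tau> (u n \<tau>))"
      if "t \<in> {0..T}" for t using isolD(4)[OF i that, of n] by linarith
    show "\<phi> (v n t) = 0" if "v n t = 0" for t using that psi0 phi_psi[of 0] by simp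
    show "\<bar>F (u n t)\<bar> \<le> FU" if "t \<in> {0..T}" for t
    proof -
      have "u n t \<in> {-U..U}" using U[OF that, of n] by (simp add: abs_le_iff)
      with FU(2) show ?thesis by blast
    qed
  qed
  define k where "k = max (\<psi> M) (- \<psi> (- M))"
  have vb: "\<bar>v n t\<bar> \<le> k" if t: "t \<in> {0..T}" for n t
  proof -
    have "- M \<le> \<phi> (v n t)" "\<phi> (v n t) \<le> M" using phib[OF t, of n] by linarith+
    then have "\<psi> (- M) \<le> \<psi> (\<phi> (v n t))" "\<psi> (\<phi> (v n t)) \<le> \<psi> M" by (auto intro: psi_mono)
    then show ?thesis unfolding psi_phi k_def by linarith
  qed
  have k0: "0 \<le> k" using vb[OF z(1), of 0] by linarith
  have uv: "(v n has_integral u n y - u n x) {x..y}" if "0 \<le> x" "x \<le> y" "y \<le> T" for n x y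
    using C1_integral[OF C, of "\<lambda>x. x" "\<lambda>_. 1" x y] that by (auto intro!: derivative_eq_intros)
  have lip0: "\<bar>u n y - u n x\<bar> \<le> k * (y - x)" if xy: "0 \<le> x" "x \<le> y" "y \<le> T" for n x y
  proof -
    have "norm (integral {x..y} (v n)) \<le> integral {x..y} (\<lambda>_. k)"
      by (rule integral_norm_bound_integral) (use uv[OF xy] vb xy in \<open>auto simp: has_integral_integrable\<close>)
    then show ?thesis using uv[OF xy, of n] xy by (simp add: integral_unique mult.commute)
  qed
  have lip: "\<bar>u n x - u n y\<bar> \<le> k * \<bar>x - y\<bar>" if "x \<in> {0..T}" "y \<in> {0..T}" for n x y
    using lip0[of x y n] lip0[of y x n] that by (cases "x \<le> y") (auto simp: abs_minus_commute)
  have "\<exists>w r. continuous_on {0..T} w \<and> strict_mono (r :: nat \<Rightarrow> nat) \<and>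
     (\<forall>e>0. \<exists>N. \<forall>n x. n \<ge> N \<and> x \<in> {0..T} \<longrightarrow> norm (u (r n) x - w x) < e)"
  proof (rule Arzela_Ascoli[of "{0..T}" u U])
    show "norm (u n x) \<le> U" if "x \<in> {0..T}" for n x using U[OF that] by simp
    fix x e :: real assume x: "x \<in> {0..T}" and e: "0 < e"
    have "norm (u n x - u n y) < e" if "y \<in> {0..T}" "norm (x - y) < e / (k + 1)" for n y
    proof -
      have "norm (u n x - u n y) \<le> k * \<bar>x - y\<bar>" using lip[OF x that(1)] by simp
      also have "\<dots> \<le> (k + 1) * \<bar>x - y\<bar>" by (simp add: mult_right_mono)
      also have "\<dots> < e" using that(2) k0 by (simp add: pos_less_divide_eq mult.commute)
      finally show ?thesis .
    qed
    then show "\<exists>d>0. \<forall>n y. y \<in> {0..T} \<and> norm (x - y) < d \<longrightarrow> norm (u n x - u n y) < e"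
      using e k0 by (intro exI[of _ "e / (k + 1)"]) auto
  qed blast+
  then obtain w r where w: "continuous_on {0..T} w" and r: "strict_mono (r :: nat \<Rightarrow> nat)"
    and wl: "\<forall>e>0. \<exists>N. \<forall>n x. n \<ge> N \<and> x \<in> {0..T} \<longrightarrow> norm (u (r n) x - w x) < e" by (elim exE conjE)
  have "seq_compact {-M..M}" by (simp add: compact_imp_seq_compact)
  moreover have "\<forall>n. \<phi> (v (r n) 0) \<in> {-M..M}" using phib[OF z(1)] by (auto simp: abs_le_iff minus_le_iff)
  ultimately obtain c q where q: "strict_mono (q :: nat \<Rightarrow> nat)" and cl: "((\<lambda>n. \<phi> (v (r n) 0)) \<circ> q) \<longlonglongrightarrow> c"
    by (rule seq_compactE)
  define \<sigma> where "\<sigma> n = r (q n)" for n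
  have \<sigma>: "strict_mono \<sigma>" using strict_mono_o[OF r q] by (simp add: \<sigma>_def[abs_def] o_def)
  have cl: "(\<lambda>n. \<phi> (v (\<sigma> n) 0)) \<longlonglongrightarrow> c" using cl by (simp add: o_def \<sigma>_def)
  have ul: "(\<lambda>n. u (\<sigma> n) t) \<longlonglongrightarrow> w t" if t: "t \<in> {0..T}" for t
  proof -
    have "(\<lambda>n. u (r n) t) \<longlonglongrightarrow> w t"
      unfolding LIMSEQ_def dist_norm using wl t by blast
    from LIMSEQ_subseq_LIMSEQ[OF this q] show ?thesis by (simp add: o_def \<sigma>_def)
  qed
  have Sl: "(\<lambda>n. S (\<sigma> n)) \<longlonglongrightarrow> s0" using LIMSEQ_subseq_LIMSEQ[OF S(1) \<sigma>] by (simp add: o_def)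
  have "\<exists>h. integrable (lebesgue_on {0..T}) h \<and> (\<forall>t\<in>{0..T}. \<forall>x. \<bar>x\<bar> \<le> \<bar>U\<bar> + 1 \<longrightarrow> \<bar>g t x\<bar> \<le> h t)"
    using car unfolding caratheodory_def by simp
  then obtain h where h: "integrable (lebesgue_on {0..T}) h" "\<forall>t\<in>{0..T}. \<forall>x. \<bar>x\<bar> \<le> \<bar>U\<bar> + 1 \<longrightarrow> \<bar>g t x\<bar> \<le> h t"
    by (elim exE conjE)
  have hi: "h integrable_on {0..T}" by (rule integrable_on_lebesgue_on[OF h(1)]) auto
  have gl: "(\<lambda>n. integral {0..t} (\<lambda>\<tau>. g \<tau> (u (\<sigma> n) \<tau>))) \<longlonglongrightarrow> integral {0..t} (\<lambda>\<tau>. g \<tau> (w \<tau>))" if t: "t \<in> {0..T}" for t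
  proof (rule dominated_convergence(2))
    show "(\<lambda>\<tau>. g \<tau> (u (\<sigma> n) \<tau>)) integrable_on {0..t}" for n
      by (rule superposition_integrable(2)[OF car C1_continuous(1)[OF C]]) (use t in auto)
    show "h integrable_on {0..t}" by (rule integrable_subinterval_real[OF hi]) (use t in auto)
    show "norm (g x (u (\<sigma> n) x)) \<le> h x" if "x \<in> {0..t}" for n x
    proof -
      have x: "x \<in> {0..T}" using that t by simp
      have "\<bar>u (\<sigma> n) x\<bar> \<le> \<bar>U\<bar> + 1" using U[OF x, of "\<sigma> n"] by linarith
      with h(2) x show ?thesis by simp
    qed
    show "(\<lambda>n. g x (u (\<sigma> n) x)) \<longlonglongrightarrow> g x (w x)" if "x \<in> {0..t}" for x
    proof (rule isCont_tendsto_compose[OF _ ul])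
      show "isCont (g x) (w x)" using car that t by (simp add: caratheodory_def continuous_on_eq_continuous_at)
    qed (use that t in auto)
  qed
  have split: "integral {0..t} (\<lambda>\<tau>. m - g \<tau> (y \<tau>)) = m * t - integral {0..t} (\<lambda>\<tau>. g \<tau> (y \<tau>))"
    if "continuous_on {0..T} y" "t \<in> {0..T}" for m y t
    using superposition_integrable(2)[OF car that(1), of 0 t] that(2) by (subst integral_diff) (auto simp: mult.commute)
  \<comment> \<open>The limit of \<open>\<phi> (v)\<close> as dictated by the equation; its image
    \<open>p\<close> under \<psi> turns out to be the derivative of \<open>w\<close>.\<close>
  define B where "B t = c + F (w 0) - F (w t) + integral {0..t} (\<lambda>\<tau>. s0 - g \<tau> (w \<tau>))" for t
  define p where "p t = \<psi> (B t)" for t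
  have Fl: "(\<lambda>n. F (u (\<sigma> n) t)) \<longlonglongrightarrow> F (w t)" if "t \<in> {0..T}" for t
    by (rule isCont_tendsto_compose[OF DERIV_isCont[OF F_deriv] ul[OF that]])
  have phil: "(\<lambda>n. \<phi> (v (\<sigma> n) t)) \<longlonglongrightarrow> B t" if t: "t \<in> {0..T}" for t
  proof -
    have "\<phi> (v (\<sigma> n) t) = \<phi> (v (\<sigma> n) 0) + F (u (\<sigma> n) 0) - F (u (\<sigma> n) t) + (S (\<sigma> n) * t - integral {0..t} (\<lambda>\<tau>. g \<tau> (u (\<sigma> n) \<tau>)))" for n
      using isolD(4)[OF i t, of "\<sigma> n"] split[OF C1_continuous(1)[OF C] t, of "S (\<sigma> n)" "\<sigma> n"] by linarith
    then show ?thesis unfolding B_def split[OF w t]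
      by (simp only:) (intro tendsto_intros cl Fl z t Sl gl)
  qed
  have vl: "(\<lambda>n. v (\<sigma> n) t) \<longlonglongrightarrow> p t" if t: "t \<in> {0..T}" for t
  proof -
    have "isCont \<psi> (B t)" using psi_cont by (simp add: continuous_on_eq_continuous_at)
    from isCont_tendsto_compose[OF this phil[OF t]] show ?thesis by (simp add: psi_phi p_def)
  qed
  have pc: "continuous_on {0..T} p"
    unfolding p_def B_def
    by (intro continuous_on_compose2[OF psi_cont] continuous_intros continuous_on_compose2[OF F_cont w]
        indefinite_integral_continuous_1 superposition_integrable(1)[OF car w]) (use T_pos in auto)
  have weq: "w t = w 0 + integral {0..t} p" if t: "t \<in> {0..T}" for t
  proof -
    have "(\<lambda>n. integral {0..t} (v (\<sigma> n))) \<longlonglongrightarrow> integral {0..t} p"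
    proof (rule dominated_convergence(2))
      show "v (\<sigma> n) integrable_on {0..t}" for n using uv[of 0 t "\<sigma> n"] t by (auto simp: has_integral_integrable)
      show "(\<lambda>_. k) integrable_on {0..t}" by (rule integrable_const_ivl)
      show "norm (v (\<sigma> n) x) \<le> k" if "x \<in> {0..t}" for n x using vb[of x "\<sigma> n"] that t by simp
      show "(\<lambda>n. v (\<sigma> n) x) \<longlonglongrightarrow> p x" if "x \<in> {0..t}" for x using vl that t by simp
    qed
    moreover have "integral {0..t} (v (\<sigma> n)) = u (\<sigma> n) t - u (\<sigma> n) 0" for n
      using uv[of 0 t "\<sigma> n"] t by (auto simp: integral_unique)
    ultimately have "(\<lambda>n. u (\<sigma> n) t - u (\<sigma> n) 0) \<longlonglongrightarrow> integral {0..t} p" by simp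
    from LIMSEQ_unique[OF this tendsto_diff[OF ul[OF t] ul[OF z(1)]]] show ?thesis by simp
  qed
  have Cw: "C1_with_deriv T w p"
    unfolding C1_with_deriv_def
  proof (intro conjI ballI pc)
    fix t assume t: "t \<in> {0..T}"
    have "((\<lambda>t. integral {0..t} p) has_real_derivative p t) (at t within {0..T})"
      by (rule integral_has_real_derivative[OF pc t])
    then have "((\<lambda>t. w 0 + integral {0..t} p) has_real_derivative p t) (at t within {0..T})"
      by (auto intro!: derivative_eq_intros)
    then show "(w has_real_derivative p t) (at t within {0..T})"
      by (rule has_field_derivative_transform_within[OF _ zero_less_one t]) (rule weq[symmetric])
  qed
  have w0: "w 0 = w T"
    using LIMSEQ_unique[OF ul[OF z(1)]] ul[OF z(2)] isolD(2)[OF i] by simp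
  have p0: "p 0 = p T"
    using LIMSEQ_unique[OF vl[OF z(1)]] vl[OF z(2)] isolD(3)[OF i] by simp
  have "isol g s0 w p"
    unfolding isol_def
  proof (intro conjI ballI Cw w0 p0)
    fix t
    show "\<phi> (p t) + F (w t) = \<phi> (p 0) + F (w 0) + integral {0..t} (\<lambda>\<tau>. s0 - g \<tau> (w \<tau>))"
      by (simp add: p_def phi_psi B_def)
  qed
  then show ?thesis by blast
qed

lemma isol_mean_g:
  assumes "isol g m u v"
  shows "mean_g T g u = m"
proof -
  have "integrable (lebesgue_on {0..T}) (\<lambda>t. g t (u t))"
    using integrable_superposition[OF car C1_continuous(1)[OF isolD(1)[OF assms]]]
    by (rule absolutely_integrable_imp_integrable) auto
  then have "mean_g T g u = (1 / T) * integral {0..T} (\<lambda>t. g t (u t))"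
    unfolding mean_g_def by (subst lebesgue_integral_eq_integral) auto
  then show ?thesis using isol_mean[OF assms car] T_pos by simp
qed

lemma isol_C1T: "isol g m u v \<Longrightarrow> C1T T u"
  unfolding C1T_def using isolD(1-3) by blast

lemma isol_below_bound:
  assumes "isol g m u v" "H4_cond T g \<nu> d" "\<nu> < m"
  shows "\<exists>t\<in>{0..T}. u t < d"
proof (rule ccontr)
  assume "\<not> ?thesis"
  then have "\<forall>t\<in>{0..T}. u t \<ge> d" by (auto simp: not_less)
  with assms(2) isol_C1T[OF assms(1)] have "mean_g T g u < \<nu>" by (auto simp: H4_cond_def)
  with isol_mean_g[OF assms(1)] assms(3) show False by simp
qed

lemma isol_above_bound:
  assumes "isol g m u v" "H3_cond T g \<nu> d" "\<nu> < m"
  shows "\<exists>t\<in>{0..T}. - d < u t"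
proof (rule ccontr)
  assume "\<not> ?thesis"
  then have "\<forall>t\<in>{0..T}. u t \<le> - d" by (auto simp: not_less)
  with assms(2) isol_C1T[OF assms(1)] have "mean_g T g u < \<nu>" by (auto simp: H3_cond_def)
  with isol_mean_g[OF assms(1)] assms(3) show False by simp
qed

lemma isol_level_bound:
  assumes "isol g m u v"
  shows "m \<le> integral {0..T} \<gamma> / T"
proof -
  have "integral {0..T} (\<lambda>t. g t (u t)) \<le> integral {0..T} \<gamma>"
    by (intro integral_le superposition_integrable(2)[OF car C1_continuous(1)[OF isolD(1)[OF assms]]] \<gamma>_int g_le)
      (use T_pos in auto)
  with isol_mean[OF assms car] show ?thesis using T_pos by (simp add: pos_le_divide_eq)
qed

lemma sub_sol_bounded:
  assumes "sub_sol s1 \<alpha> \<alpha>'"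
  shows "\<exists>M>0. \<forall>t\<in>{0..T}. \<bar>\<alpha> t\<bar> \<le> M"
proof (rule continuous_bounded_Icc)
  have "C1_with_deriv T \<alpha> \<alpha>'" using assms by (simp add: sub_sol_def)
  then show "continuous_on {0..T} \<alpha>" by (rule C1_continuous)
qed

text \<open>An offset \<open>M + d\<close> lifts a solution above \<open>d\<close>, where
  \<open>(H4)\<close> holds its mean below \<nu>; this excludes levels above \<open>s\<close> at
  that end of the path.\<close>

lemma isol_above_sub_sol:
  assumes sub: "sub_sol s1 \<alpha> \<alpha>'" and s: "s < s1" and H4: "H4_cond T g \<nu> d" "0 < d" "\<nu> < s"
  shows "\<exists>u v. isol g s u v \<and> (\<forall>t\<in>{0..T}. \<alpha> t < u t)"
proof -
  obtain M where M: "0 < M" "\<forall>t\<in>{0..T}. \<bar>\<alpha> t\<bar> \<le> M" using sub_sol_bounded[OF sub] by blast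
  have "\<exists>u v c. isol g s u v \<and> 0 < c \<and> (\<forall>t\<in>{0..T}. \<alpha> t + 1 * c \<le> u t) \<and> (\<exists>t\<in>{0..T}. u t = \<alpha> t + 1 * c)"
  proof (rule isol_between[OF sub s, of 1 "M + d"])
    fix m u v assume i: "isol g m u v" and m: "s < m" and ge: "\<forall>t\<in>{0..T}. \<alpha> t + 1 * (M + d) \<le> u t"
    have "\<nu> < m" using m H4(3) by simp
    from isol_below_bound[OF i H4(1) this] obtain t where t: "t \<in> {0..T}" "u t < d" by blast
    have "\<bar>\<alpha> t\<bar> \<le> M" "\<alpha> t + (M + d) \<le> u t" using M(2) ge t(1) by auto
    with t(2) show False by linarith
  qed (use M(1) H4(2) in auto)
  then obtain u v c where i: "isol g s u v" and c: "0 < c" "\<forall>t\<in>{0..T}. \<alpha> t + 1 * c \<le> u t" by blast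
  have "\<alpha> t < u t" if "t \<in> {0..T}" for t using c(1) c(2)[rule_format, OF that] by simp
  with i show ?thesis by blast
qed

text \<open>At the offset \<open>- (M + d + osc_const s)\<close> a solution has a value at most
  \<open>- d - osc_const s\<close>, hence stays at or below \<open>- d\<close> by the oscillation
  bound, and \<open>(H3)\<close> excludes levels above \<open>s\<close>. The negative offset of the
  solution obtained is attained, so it dips strictly under \<alpha>.\<close>

lemma isol_crossing_sub_sol:
  assumes sub: "sub_sol s1 \<alpha> \<alpha>'" and s: "s < s1" and H3: "H3_cond T g \<nu> d" "0 < d" "\<nu> < s"
  shows "\<exists>u v. isol g s u v \<and> (\<exists>t\<in>{0..T}. u t < \<alpha> t)"
proof -
  obtain M where M: "0 < M" "\<forall>t\<in>{0..T}. \<bar>\<alpha> t\<bar> \<le> M" using sub_sol_bounded[OF sub] by blast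
  let ?R = "M + d + osc_const s"
  have "\<exists>u v c. isol g s u v \<and> 0 < c \<and> (\<forall>t\<in>{0..T}. \<alpha> t + (- 1) * c \<le> u t) \<and> (\<exists>t\<in>{0..T}. u t = \<alpha> t + (- 1) * c)"
  proof (rule isol_between[OF sub s, of "- 1" ?R])
    fix m u v assume i: "isol g m u v" and m: "s < m" and eq: "\<exists>t\<in>{0..T}. u t = \<alpha> t + (- 1) * ?R"
    obtain t0 where t0: "t0 \<in> {0..T}" "u t0 = \<alpha> t0 - ?R" using eq by auto
    have "\<nu> < m" using m H3(3) by simp
    from isol_above_bound[OF i H3(1) this] obtain t where t: "t \<in> {0..T}" "- d < u t" by blast
    have "\<bar>u t - u t0\<bar> \<le> osc_const s" by (rule isol_oscillation[OF i less_imp_le[OF m] t(1) t0(1)])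
    moreover have "\<bar>\<alpha> t0\<bar> \<le> M" using M(2) t0(1) by blast
    ultimately show False using t(2) t0(2) by linarith
  qed (use M(1) H3(2) osc_nonneg[of s] in auto)
  then obtain u v c t where i: "isol g s u v" and c: "0 < c" and t: "t \<in> {0..T}" "u t = \<alpha> t + (- 1) * c" by blast
  from c t(2) have "u t < \<alpha> t" by simp
  with i t(1) show ?thesis by blast
qed

text \<open>The first sub-solution, from \<open>(H2)\<close>; it makes the levels between
  \<open>\<nu>s\<close> and \<open>g0\<close> solvable before any solution is known.\<close>

lemma sub_sol_const:
  assumes "AE t in lebesgue_on {0..T}. g t u0 \<ge> g0"
  shows "sub_sol g0 (\<lambda>_. u0) (\<lambda>_. 0)"
  unfolding sub_sol_def
proof (intro conjI allI impI)
  show "C1_with_deriv T (\<lambda>_. u0) (\<lambda>_. 0)" by (auto simp: C1_with_deriv_def)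
  fix t t' assume t: "0 \<le> t" "t \<le> t'" "t' \<le> T"
  have "integral {t..t'} (\<lambda>\<tau>. g0 - g \<tau> u0) \<le> integral {t..t'} (\<lambda>_. 0)"
  proof (rule integral_le_AE)
    show "(\<lambda>\<tau>. g0 - g \<tau> u0) integrable_on {t..t'}"
      by (rule superposition_integrable(1)[OF car]) (use t in auto)
    show "AE \<tau> in lebesgue_on {0..T}. \<tau> \<in> {t..t'} \<longrightarrow> g0 - g \<tau> u0 \<le> 0"
      using assms by eventually_elim simp
  qed (use t in auto)
  then show "integral {t..t'} (\<lambda>\<tau>. g0 - g \<tau> u0) \<le> \<phi> 0 + F u0 - (\<phi> 0 + F u0)" by simp
qed simp_all

theorem ambrosetti_prodi:
  fixes \<nu>s \<nu>ss :: ereal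
  assumes H2: "AE t in lebesgue_on {0..T}. g t u0 \<ge> g0"
    and H4: "\<nu>4 < g0" "0 < d4" "H4_cond T g \<nu>4 d4"
    and nus: "\<nu>s = Inf (ereal ` {\<nu>. \<nu> < g0 \<and> (\<exists>d>0. H4_cond T g \<nu> d)})"
    and nuss: "\<nu>ss = Inf (ereal ` {\<nu>. \<nu>s \<le> ereal \<nu> \<and> \<nu> < g0 \<and> (\<exists>d>0. H3_cond T g \<nu> d)})"
  shows "\<exists>s0::real. \<nu>s < ereal s0 \<and>
           (\<forall>s. \<nu>s < ereal s \<and> s < s0 \<longrightarrow> (\<exists>u v. isol g s u v)) \<and>
           (\<forall>s u v. s0 < s \<longrightarrow> \<not> isol g s u v) \<and>
           ((\<exists>\<nu> d. \<nu> < g0 \<and> d > 0 \<and> H3_cond T g \<nu> d) \<longrightarrow>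
              (\<exists>u v. isol g s0 u v) \<and>
              (\<forall>s. \<nu>ss < ereal s \<and> s < s0 \<longrightarrow>
                 (\<exists>u1 v1 u2 v2. isol g s u1 v1 \<and> isol g s u2 v2 \<and> (\<exists>t\<in>{0..T}. u1 t \<noteq> u2 t))))"
proof -
  define S where "S = {s. \<exists>u v. isol g s u v}"
  define s0 where "s0 = Sup S"
  have bdd: "bdd_above S"
    using isol_level_bound by (intro bdd_aboveI[of _ "integral {0..T} \<gamma> / T"]) (auto simp: S_def)
  have S_le: "s \<le> s0" if "s \<in> S" for s unfolding s0_def by (rule cSup_upper[OF that bdd])
  have nus_less: "\<exists>\<nu> d. \<nu> < s \<and> 0 < d \<and> H4_cond T g \<nu> d" if "\<nu>s < ereal s" for s
    using that unfolding nus Inf_less_iff by auto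
  have above: "\<exists>u v. isol g s u v \<and> (\<forall>t\<in>{0..T}. \<alpha> t < u t)" if "sub_sol s1 \<alpha> \<alpha>'" "s < s1" "\<nu>s < ereal s" for s s1 \<alpha> \<alpha>'
    using nus_less[OF that(3)] isol_above_sub_sol[OF that(1,2)] by blast
  have nus4: "\<nu>s \<le> ereal \<nu>4" unfolding nus using H4 by (intro INF_lower) auto
  have low: "s \<in> S" if "s < g0" "\<nu>s < ereal s" for s
    using above[OF sub_sol_const[OF H2] that] by (auto simp: S_def)
  \<comment> \<open>Levels just below \<open>g0\<close> are solvable, so \<open>s0 < g0\<close>
    would leave a solvable level above \<open>s0\<close>; this is also what places
    \<open>\<nu>4\<close> below \<open>s0\<close>.\<close>
  have g0s0: "g0 \<le> s0"
  proof (rule ccontr)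
    assume "\<not> g0 \<le> s0"
    then have "max s0 \<nu>4 < g0" using H4(1) by simp
    then obtain s where s: "max s0 \<nu>4 < s" "s < g0" using dense by blast
    then have "\<nu>s < ereal s" using nus4 by (auto intro: le_less_trans)
    with s low S_le show False by fastforce
  qed
  have ne: "S \<noteq> {}"
  proof -
    obtain s where s: "\<nu>4 < s" "s < g0" using dense[OF H4(1)] by blast
    then have "\<nu>s < ereal s" using nus4 by (auto intro: le_less_trans)
    with s low show ?thesis by blast
  qed
  have nus0: "\<nu>s < ereal s0"
  proof -
    have "ereal \<nu>4 < ereal s0" using H4(1) g0s0 by simp
    with nus4 show ?thesis by (rule le_less_trans)
  qed
  have S_above: "\<exists>s1 u v. s < s1 \<and> isol g s1 u v" if "s < s0" for s
    using that less_cSup_iff[OF ne bdd, of s] by (auto simp: s0_def S_def)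
  have ex: "\<exists>u v. isol g s u v" if s: "\<nu>s < ereal s" "s < s0" for s
  proof -
    obtain s1 u v where "s < s1" "isol g s1 u v" using S_above[OF s(2)] by blast
    from above[OF isol_sub_sol[OF this(2)] this(1) s(1)] show ?thesis by blast
  qed
  have none: "\<not> isol g s u v" if "s0 < s" for s u v
    using that S_le[of s] by (auto simp: S_def)
  have critical: "\<exists>u v. isol g s0 u v" if H3: "\<nu>3 < g0" "0 < d3" "H3_cond T g \<nu>3 d3" for \<nu>3 d3
  proof -
    define \<nu> where "\<nu> = max \<nu>3 \<nu>4"
    have \<nu>: "\<nu> < s0" using H3(1) H4(1) g0s0 by (simp add: \<nu>_def)
    \<comment> \<open>Starting halfway between \<nu> and \<open>s0\<close> keeps every
      \<open>sn n\<close> above \<open>\<nu>3\<close> and \<open>\<nu>4\<close>. Each solution then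
      has a value above \<open>- d3\<close> and one below \<open>d4\<close>, and the oscillation
      bound for the common \<open>s\<close> makes the resulting bound uniform in
      \<open>n\<close>.\<close>
    define sn where "sn n = s0 - (s0 - \<nu>) / 2 / real (Suc n)" for n
    define s where "s = s0 - (s0 - \<nu>) / 2"
    have s\<nu>: "\<nu> < s" using \<nu> by (simp add: s_def field_simps)
    have sn: "s \<le> sn n" "sn n < s0" for n
    proof -
      have "(s0 - \<nu>) / 2 / real (Suc n) \<le> (s0 - \<nu>) / 2 / 1" using \<nu> by (intro divide_left_mono) auto
      then show "s \<le> sn n" by (simp add: sn_def s_def)
      show "sn n < s0" using \<nu> by (simp add: sn_def)
    qed
    have "\<exists>u v. isol g (sn n) u v" for n
    proof (rule ex)
      have "ereal \<nu>4 < ereal (sn n)" using s\<nu> sn(1)[of n] by (simp add: \<nu>_def)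
      with nus4 show "\<nu>s < ereal (sn n)" by (rule le_less_trans)
    qed (rule sn)
    then obtain u v where i: "\<And>n. isol g (sn n) (u n) (v n)" by metis
    show ?thesis
    proof (rule isol_limit[OF i])
      have "(\<lambda>n. s0 - (s0 - \<nu>) / 2 * (1 / real (Suc n))) \<longlonglongrightarrow> s0 - (s0 - \<nu>) / 2 * 0"
        by (intro tendsto_intros LIMSEQ_Suc[OF lim_1_over_n])
      then show "sn \<longlonglongrightarrow> s0" by (simp add: sn_def[abs_def])
      show "s \<le> sn n" for n by (rule sn)
      fix n t assume t: "t \<in> {0..T}"
      have "\<nu>3 < sn n" "\<nu>4 < sn n" using s\<nu> sn(1)[of n] by (simp_all add: \<nu>_def)
      then obtain t3 t4 where "t3 \<in> {0..T}" "- d3 < u n t3" "t4 \<in> {0..T}" "u n t4 < d4"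
        using isol_above_bound[OF i H3(3)] isol_below_bound[OF i H4(3)] by blast
      moreover from this have "\<bar>u n t - u n t3\<bar> \<le> osc_const s" "\<bar>u n t - u n t4\<bar> \<le> osc_const s"
        using isol_oscillation[OF i sn(1) t] by blast+
      ultimately show "\<bar>u n t\<bar> \<le> d3 + d4 + osc_const s" using H3(2) H4(2) by linarith
    qed
  qed
  have two: "\<exists>u1 v1 u2 v2. isol g s u1 v1 \<and> isol g s u2 v2 \<and> (\<exists>t\<in>{0..T}. u1 t \<noteq> u2 t)"
    if s: "\<nu>ss < ereal s" "s < s0" for s
  proof -
    \<comment> \<open>The witness lies at or above \<open>\<nu>s\<close>, so \<open>s\<close>
      exceeds \<open>\<nu>s\<close> too, and the solution above \<alpha> exists along with the
      crossing one.\<close>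
    obtain \<nu> d where \<nu>: "\<nu>s \<le> ereal \<nu>" "\<nu> < s" "0 < d" "H3_cond T g \<nu> d"
      using s(1) unfolding nuss Inf_less_iff by auto
    then have "ereal \<nu> < ereal s" by simp
    with \<nu>(1) have ns: "\<nu>s < ereal s" by (rule le_less_trans)
    obtain s1 \<alpha> \<alpha>' where s1: "s < s1" "isol g s1 \<alpha> \<alpha>'" using S_above[OF s(2)] by blast
    note sub = isol_sub_sol[OF s1(2)]
    obtain u1 v1 where u1: "isol g s u1 v1" "\<forall>t\<in>{0..T}. \<alpha> t < u1 t" using above[OF sub s1(1) ns] by blast
    obtain u2 v2 t where u2: "isol g s u2 v2" "t \<in> {0..T}" "u2 t < \<alpha> t"
      using isol_crossing_sub_sol[OF sub s1(1) \<nu>(4,3,2)] by blast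
    have "u1 t \<noteq> u2 t" using u1(2) u2(2,3) by force
    with u1(1) u2(1,2) show ?thesis by blast
  qed
  show ?thesis
    using nus0 ex none critical two by (intro exI[of _ s0] conjI allI impI) blast+
qed

end

section \<open>Removal of an exceptional null set of times, and the theorem in its stated
  form\<close>

lemma AE_lebesgue_on_not_in:
  fixes N :: "real set"
  assumes "negligible N" "S \<in> sets lebesgue"
  shows "AE t in lebesgue_on S. t \<notin> N"
  using assms by (subst AE_lebesgue_on_iff_negligible) auto

text \<open>Changing \<^term>\<open>g\<close> on a null set of times makes the bound in \<open>(H\<^sub>1)\<close> valid for every \<^term>\<open>t\<close>.\<close>

lemma caratheodory_null_change:
  assumes g: "caratheodory T g" and N: "negligible N"
  shows "caratheodory T (\<lambda>t x. if t \<in> N then 0 else g t x)"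
  unfolding caratheodory_def
proof (intro conjI allI ballI impI)
  fix x
  have N': "{t \<in> space (lebesgue_on {0..T}). t \<in> N} \<in> sets (lebesgue_on {0..T})"
  proof -
    have "{t \<in> space (lebesgue_on {0..T}). t \<in> N} = N \<inter> {0..T}" by auto
    moreover have "N \<inter> {0..T} \<in> sets lebesgue" using negligible_imp_sets[OF N] by auto
    ultimately show ?thesis by (auto simp: sets_restrict_space_iff)
  qed
  show "(\<lambda>t. if t \<in> N then 0 else g t x) \<in> borel_measurable (lebesgue_on {0..T})"
    by (rule measurable_If[OF _ _ N']) (use g in \<open>auto simp: caratheodory_def\<close>)
next
  show "continuous_on UNIV (\<lambda>x. if t \<in> N then 0 else g t x)" if "t \<in> {0..T}" for t
    using g that by (cases "t \<in> N") (auto simp: caratheodory_def)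
next
  fix r :: real assume "0 < r"
  with g have "\<exists>h. integrable (lebesgue_on {0..T}) h \<and> (\<forall>t\<in>{0..T}. \<forall>u. \<bar>u\<bar> \<le> r \<longrightarrow> \<bar>g t u\<bar> \<le> h t)"
    unfolding caratheodory_def by simp
  then obtain h where h: "integrable (lebesgue_on {0..T}) h" "\<forall>t\<in>{0..T}. \<forall>u. \<bar>u\<bar> \<le> r \<longrightarrow> \<bar>g t u\<bar> \<le> h t"
    by (elim exE conjE)
  have "\<bar>if t \<in> N then 0 else g t u\<bar> \<le> h t" if "t \<in> {0..T}" "\<bar>u\<bar> \<le> r" for t u
  proof -
    have "\<bar>g t u\<bar> \<le> h t" using h(2) that by blast
    then show ?thesis by auto
  qed
  with h(1) show "\<exists>h. integrable (lebesgue_on {0..T}) h \<and> (\<forall>t\<in>{0..T}. \<forall>u. \<bar>u\<bar> \<le> r \<longrightarrow> \<bar>if t \<in> N then 0 else g t u\<bar> \<le> h t)"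
    by blast
qed

lemma mean_g_null_change:
  assumes g: "caratheodory T g" and N: "negligible N" and u: "C1T T u"
  shows "mean_g T (\<lambda>t x. if t \<in> N then 0 else g t x) u = mean_g T g u"
proof -
  have uc: "continuous_on {0..T} u" using u by (auto simp: C1T_def intro: C1_continuous)
  have "integral\<^sup>L (lebesgue_on {0..T}) (\<lambda>t. if t \<in> N then 0 else g t (u t)) = integral\<^sup>L (lebesgue_on {0..T}) (\<lambda>t. g t (u t))"
  proof (rule integral_cong_AE)
    show "AE t in lebesgue_on {0..T}. (if t \<in> N then 0 else g t (u t)) = g t (u t)"
      using AE_lebesgue_on_not_in[OF N, of "{0..T}"] by (rule eventually_mono) auto
  qed (use measurable_superposition[OF g uc] measurable_superposition[OF caratheodory_null_change[OF g N] uc] in auto)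
  then show ?thesis by (simp add: mean_g_def)
qed

lemma H_cond_null_change:
  assumes "caratheodory T g" "negligible N"
  shows "H4_cond T (\<lambda>t x. if t \<in> N then 0 else g t x) \<nu> d = H4_cond T g \<nu> d"
    "H3_cond T (\<lambda>t x. if t \<in> N then 0 else g t x) \<nu> d = H3_cond T g \<nu> d"
  unfolding H4_cond_def H3_cond_def using mean_g_null_change[OF assms] by auto

lemma periodic_solution_null_change:
  assumes N: "negligible N"
  shows "periodic_solution T \<phi> f (\<lambda>t x. if t \<in> N then 0 else g t x) s u = periodic_solution T \<phi> f g s u"
proof -
  have "(AE t in lebesgue_on {0..T}. \<exists>w. ((\<lambda>t. \<phi> (v t)) has_real_derivative w) (at t within {0..T}) \<and>
               w + f (u t) * v t + (if t \<in> N then 0 else g t (u t)) = s) \<longleftrightarrow>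
        (AE t in lebesgue_on {0..T}. \<exists>w. ((\<lambda>t. \<phi> (v t)) has_real_derivative w) (at t within {0..T}) \<and>
               w + f (u t) * v t + g t (u t) = s)" for v
    by (rule eventually_subst) (use AE_lebesgue_on_not_in[OF N, of "{0..T}"] in \<open>auto elim!: eventually_mono\<close>)
  then show ?thesis unfolding periodic_solution_def by simp
qed

text \<open>The levels \<open>\<nu>s\<close> and \<open>\<nu>ss\<close> are extended reals since the
  infima can be minus infinity. Strict monotonicity of \<phi> is obtained from \<open>mono\<close>
  and the injectivity that the inverse provides.\<close>

theorem theorem3p2:
  fixes T :: real and \<phi> f :: "real \<Rightarrow> real" and g :: "real \<Rightarrow> real \<Rightarrow> real"
    and u\<^sub>0 g\<^sub>0 :: real and \<nu>s \<nu>ss :: ereal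
  assumes T_pos: "T > 0"
    and phi_incr: "mono \<phi>" and phi_homeo: "\<exists>\<psi>. homeomorphism UNIV UNIV \<phi> \<psi>"
    and phi0: "\<phi> 0 = 0"
    and f_cont: "continuous_on UNIV f"
    and g_car: "caratheodory T g"
    and H0: "\<forall>t\<^sub>0\<in>{0..T}. \<forall>x\<^sub>0 \<epsilon>. \<epsilon> > 0 \<longrightarrow> (\<exists>\<delta>>0. AE t in lebesgue_on {0..T}.
               \<forall>x. \<bar>t - t\<^sub>0\<bar> < \<delta> \<and> \<bar>x - x\<^sub>0\<bar> < \<delta> \<longrightarrow> \<bar>g t x - g t x\<^sub>0\<bar> < \<epsilon>)"
    and H1: "\<exists>\<gamma>\<^sub>0. integrable (lebesgue_on {0..T}) \<gamma>\<^sub>0 \<and> (\<forall>t\<in>{0..T}. \<gamma>\<^sub>0 t \<ge> 0) \<and>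
               (AE t in lebesgue_on {0..T}. \<forall>x. g t x \<le> \<gamma>\<^sub>0 t)"
    and H2: "AE t in lebesgue_on {0..T}. g t u\<^sub>0 \<ge> g\<^sub>0"
    and H4: "\<exists>\<nu> d. \<nu> < min 0 g\<^sub>0 \<and> d > 0 \<and> H4_cond T g \<nu> d"
    and nus_def: "\<nu>s = Inf (ereal ` {\<nu>. \<nu> < g\<^sub>0 \<and> (\<exists>d>0. H4_cond T g \<nu> d)})"
    and nuss_def: "\<nu>ss = Inf (ereal ` {\<nu>. \<nu>s \<le> ereal \<nu> \<and> \<nu> < g\<^sub>0 \<and> (\<exists>d>0. H3_cond T g \<nu> d)})"
  shows "\<exists>s\<^sub>0::real. \<nu>s < ereal s\<^sub>0 \<and>
           (\<forall>s. \<nu>s < ereal s \<and> s < s\<^sub>0 \<longrightarrow> (\<exists>u. periodic_solution T \<phi> f g s u)) \<and>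
           (\<forall>s. s > s\<^sub>0 \<longrightarrow> \<not> (\<exists>u. periodic_solution T \<phi> f g s u)) \<and>
           ((\<exists>\<nu> d. \<nu> < min 0 g\<^sub>0 \<and> d > 0 \<and> H3_cond T g \<nu> d) \<longrightarrow>
              (\<exists>u. periodic_solution T \<phi> f g s\<^sub>0 u) \<and>
              (\<forall>s. \<nu>ss < ereal s \<and> s < s\<^sub>0 \<longrightarrow>
                 (\<exists>u\<^sub>1 u\<^sub>2. periodic_solution T \<phi> f g s u\<^sub>1 \<and> periodic_solution T \<phi> f g s u\<^sub>2 \<and>
                    (\<exists>t\<in>{0..T}. u\<^sub>1 t \<noteq> u\<^sub>2 t))))"
proof -
  obtain \<psi> where \<psi>: "homeomorphism UNIV UNIV \<phi> \<psi>" using phi_homeo by blast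
  then have psi_phi: "\<psi> (\<phi> x) = x" and phi_psi: "\<phi> (\<psi> x) = x" for x by (auto simp: homeomorphism_def)
  from antiderivative_real_ex[OF f_cont] obtain F where F: "\<And>x. (F has_real_derivative f x) (at x)" by blast
  obtain \<gamma> where \<gamma>: "integrable (lebesgue_on {0..T}) \<gamma>" "\<forall>t\<in>{0..T}. \<gamma> t \<ge> 0"
    and ae: "AE t in lebesgue_on {0..T}. \<forall>x. g t x \<le> \<gamma> t" using H1 by (elim exE conjE)
  have "{0..T} \<in> sets lebesgue" by simp
  from iffD1[OF AE_lebesgue_on_iff_negligible[OF this] ae]
  obtain N where N: "negligible N" "\<forall>t\<in>{0..T} - N. \<forall>x. g t x \<le> \<gamma> t" by (elim exE conjE)
  \<comment> \<open>The value 0 on \<open>N\<close> respects the upper bound because \<gamma> is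
    nonnegative; \<open>(H0)\<close> and \<open>(H2)\<close> are almost everywhere statements, and
    solutions and means do not see \<open>N\<close>.\<close>
  define h where "h = (\<lambda>t x. if t \<in> N then 0 else g t x)"
  note notN = AE_lebesgue_on_not_in[OF N(1), of "{0..T}"]
  have h_car: "caratheodory T h" unfolding h_def by (rule caratheodory_null_change[OF g_car N(1)])
  have H34: "H4_cond T g = H4_cond T h" "H3_cond T g = H3_cond T h"
    unfolding h_def by (intro ext H_cond_null_change[OF g_car N(1), symmetric])+
  have sol: "periodic_solution T \<phi> f g = periodic_solution T \<phi> f h"
    unfolding h_def by (intro ext periodic_solution_null_change[OF N(1), symmetric])
  interpret phi_laplace T \<phi> \<psi> f F h \<gamma>
  proof
    show "0 < T" by (rule T_pos)
    show "\<phi> x < \<phi> y" if "x < y" for x y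
    proof -
      have "\<phi> x \<noteq> \<phi> y" using psi_phi[of x] psi_phi[of y] that by auto
      moreover have "\<phi> x \<le> \<phi> y" using phi_incr that by (simp add: monoD)
      ultimately show ?thesis by simp
    qed
    show "\<psi> (\<phi> x) = x" "\<phi> (\<psi> x) = x" for x by (rule psi_phi, rule phi_psi)
    show "continuous_on UNIV \<psi>" using \<psi> by (simp add: homeomorphism_def)
    show "\<psi> 0 = 0" using psi_phi[of 0] phi0 by simp
    show "(F has_real_derivative f x) (at x)" for x by (rule F)
    show "continuous_on UNIV f" by (rule f_cont)
    show "caratheodory T h" by (rule h_car)
    show "\<gamma> integrable_on {0..T}" by (rule integrable_on_lebesgue_on[OF \<gamma>(1)]) simp
    show "0 \<le> \<gamma> t" if "t \<in> {0..T}" for t using \<gamma>(2) that by blast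
    show "h t x \<le> \<gamma> t" if "t \<in> {0..T}" for t x using N(2) \<gamma>(2) that by (auto simp: h_def)
    fix t0 x0 \<epsilon> :: real assume "t0 \<in> {0..T}" "0 < \<epsilon>"
    with H0 have "\<exists>\<delta>>0. AE t in lebesgue_on {0..T}. \<forall>x. \<bar>t - t0\<bar> < \<delta> \<and> \<bar>x - x0\<bar> < \<delta> \<longrightarrow> \<bar>g t x - g t x0\<bar> < \<epsilon>" by blast
    then obtain \<delta> where \<delta>: "0 < \<delta>"
      "AE t in lebesgue_on {0..T}. \<forall>x. \<bar>t - t0\<bar> < \<delta> \<and> \<bar>x - x0\<bar> < \<delta> \<longrightarrow> \<bar>g t x - g t x0\<bar> < \<epsilon>" by (elim exE conjE)
    have "AE t in lebesgue_on {0..T}. \<forall>x. \<bar>t - t0\<bar> < \<delta> \<and> \<bar>x - x0\<bar> < \<delta> \<longrightarrow> \<bar>h t x - h t x0\<bar> < \<epsilon>"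
      using \<delta>(2) notN[OF \<open>{0..T} \<in> sets lebesgue\<close>] by eventually_elim (simp add: h_def)
    with \<delta>(1) show "\<exists>\<delta>>0. AE t in lebesgue_on {0..T}. \<forall>x. \<bar>t - t0\<bar> < \<delta> \<and> \<bar>x - x0\<bar> < \<delta> \<longrightarrow> \<bar>h t x - h t x0\<bar> < \<epsilon>" by blast
  qed
  have H2': "AE t in lebesgue_on {0..T}. h t u\<^sub>0 \<ge> g\<^sub>0"
    using H2 notN[OF \<open>{0..T} \<in> sets lebesgue\<close>] by eventually_elim (simp add: h_def)
  obtain \<nu>4 d4 where "\<nu>4 < min 0 g\<^sub>0" "0 < d4" "H4_cond T h \<nu>4 d4" using H4 unfolding H34 by (elim exE conjE)
  then have "\<nu>4 < g\<^sub>0" "0 < d4" "H4_cond T h \<nu>4 d4" by auto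
  from ambrosetti_prodi[OF H2' this nus_def[unfolded H34] nuss_def[unfolded H34]]
  obtain s0 where s0: "\<nu>s < ereal s0" "\<forall>s. \<nu>s < ereal s \<and> s < s0 \<longrightarrow> (\<exists>u v. isol h s u v)"
    "\<forall>s u v. s0 < s \<longrightarrow> \<not> isol h s u v"
    and two: "(\<exists>\<nu> d. \<nu> < g\<^sub>0 \<and> d > 0 \<and> H3_cond T h \<nu> d) \<longrightarrow>
              (\<exists>u v. isol h s0 u v) \<and>
              (\<forall>s. \<nu>ss < ereal s \<and> s < s0 \<longrightarrow>
                 (\<exists>u1 v1 u2 v2. isol h s u1 v1 \<and> isol h s u2 v2 \<and> (\<exists>t\<in>{0..T}. u1 t \<noteq> u2 t)))"
    by (elim exE conjE)
  note psol = isol_imp_periodic_solution periodic_solution_imp_isol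
  show ?thesis
    unfolding sol H34
  proof (intro exI[of _ s0] conjI impI)
    show "\<nu>s < ereal s0" by (rule s0)
    show "\<forall>s. \<nu>s < ereal s \<and> s < s0 \<longrightarrow> (\<exists>u. periodic_solution T \<phi> f h s u)" using s0(2) psol(1) by blast
    show "\<forall>s>s0. \<not> (\<exists>u. periodic_solution T \<phi> f h s u)" using s0(3) psol(2) by blast
    assume "\<exists>\<nu> d. \<nu> < min 0 g\<^sub>0 \<and> d > 0 \<and> H3_cond T h \<nu> d"
    then have "\<exists>\<nu> d. \<nu> < g\<^sub>0 \<and> d > 0 \<and> H3_cond T h \<nu> d" by auto
    note two = two[rule_format, OF this]
    show "\<exists>u. periodic_solution T \<phi> f h s0 u" using two psol(1) by blast
    show "\<forall>s. \<nu>ss < ereal s \<and> s < s0 \<longrightarrow> (\<exists>u\<^sub>1 u\<^sub>2. periodic_solution T \<phi> f h s u\<^sub>1 \<and> periodic_solution T \<phi> f h s u\<^sub>2 \<and>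
        (\<exists>t\<in>{0..T}. u\<^sub>1 t \<noteq> u\<^sub>2 t))"
      using conjunct2[OF two] psol(1) by blast
  qed
qed

end
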